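(* Let $K$ be a number field, let $f(x)\in K(x)$ be a rational map of degree $d\geq 2$, and let $\alpha\in\mathbb{P}^1(K)$ be a point which is not strictly preperiodic for $f$. Then there exist infinitely many non-Archimedean places $v$ of $K$ at which $f$ has good reduction and at which $\bar\alpha$ is $\bar f$-periodic in $\mathbb{P}^1(\mathbb{F}_v)$.
   Context: A point $\alpha$ is strictly preperiodic for $f$ if it is preperiodic (its forward orbit under $f$ is finite) but not periodic. For a non-Archimedean place $v$ of $K$, $\mathbb{F}_v$ is the residue field, $x\mapsto\bar x$ the reduction map $\mathbb{P}^1(K_v)\to\mathbb{P}^1(\mathbb{F}_v)$ (using homogeneous coordinates normalized so that the maximum of their $v$-adic absolute values is $1$). $f$ has good reduction at $v$ if $f=p/q$ with $p,q$ having $v$-integral coefficients, $\max(\deg p,\deg q)=d$, the reductions $\bar p,\bar q$ mod $v$ satisfy $\max(\deg\bar p,\deg\bar q)=d$ and have no common root in $\overline{\mathbb{F}}_v$; then $\bar f=\bar p/\bar q$ is the reduced map. *)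

theory Defs
  imports "HOL-Algebra.Algebraic_Closure_Type"
begin

section \<open>Number fields\<close>

definition number_field :: "'k::field_char_0 itself \<Rightarrow> bool" where
  "number_field _ \<longleftrightarrow>
     (\<exists>B :: 'k set. finite_dimensional_vector_space (\<lambda>(r::rat) x. of_rat r * x) B)"

section \<open>The projective line and rational maps on it\<close>

text \<open>
  The point \<open>[x : y]\<close> is the set of all its homogeneous coordinates; \<open>x\<close> in the field is
  \<open>[x : 1]\<close>, and infinity is \<open>[1 : 0]\<close>.
\<close>

definition proj_point :: "('a, 'b) ring_scheme \<Rightarrow> 'a \<Rightarrow> 'a \<Rightarrow> ('a \<times> 'a) set" where
  "proj_point R x y = {(c \<otimes>\<^bsub>R\<^esub> x, c \<otimes>\<^bsub>R\<^esub> y) | c. c \<in> carrier R - {\<zero>\<^bsub>R\<^esub>}}"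

definition proj_line :: "('a, 'b) ring_scheme \<Rightarrow> ('a \<times> 'a) set set" where
  "proj_line R = {proj_point R x y | x y.
     x \<in> carrier R \<and> y \<in> carrier R \<and> (x, y) \<noteq> (\<zero>\<^bsub>R\<^esub>, \<zero>\<^bsub>R\<^esub>)}"

definition homog_eval :: "('a, 'b) ring_scheme \<Rightarrow> nat \<Rightarrow> 'a list \<Rightarrow> 'a \<Rightarrow> 'a \<Rightarrow> 'a" where
  "homog_eval R d p x y =
     (\<Oplus>\<^bsub>R\<^esub>i\<in>{..d}. ring.coeff R p i \<otimes>\<^bsub>R\<^esub> (x [^]\<^bsub>R\<^esub> i) \<otimes>\<^bsub>R\<^esub> (y [^]\<^bsub>R\<^esub> (d - i)))"

text \<open>
  The self-map of the projective line given by \<open>p / q\<close>, where \<open>p\<close> and \<open>q\<close> have no common root and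
  \<open>d\<close> is the maximum of their degrees. The image of a point does not depend on the homogeneous
  coordinates \<open>(x, y)\<close>, so the image set below is a singleton.
\<close>

definition proj_map ::
    "('a, 'b) ring_scheme \<Rightarrow> nat \<Rightarrow> 'a list \<Rightarrow> 'a list \<Rightarrow> ('a \<times> 'a) set \<Rightarrow> ('a \<times> 'a) set" where
  "proj_map R d p q P =
     the_elem ((\<lambda>(x, y). proj_point R (homog_eval R d p x y) (homog_eval R d q x y)) ` P)"

text \<open>
  Elements of \<open>K(x)\<close> are elements of \<open>'k poly fract\<close>. A fraction in lowest terms is determined up
  to a common nonzero constant factor, which affects neither the degree nor the induced map.
\<close>

definition lowest_terms :: "'k::field poly fract \<Rightarrow> 'k poly \<times> 'k poly" where
  "lowest_terms f = (SOME (p, q). q \<noteq> 0 \<and> coprime p q \<and> f = Fract p q)"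

definition rat_degree :: "'k::field poly fract \<Rightarrow> nat" where
  "rat_degree f = (case lowest_terms f of (p, q) \<Rightarrow> max (Polynomial.degree p) (Polynomial.degree q))"

text \<open>Polynomials in HOL-Algebra list the leading coefficient first.\<close>

definition rat_map :: "'k::field poly fract \<Rightarrow> ('k \<times> 'k) set \<Rightarrow> ('k \<times> 'k) set" where
  "rat_map f = (case lowest_terms f of (p, q) \<Rightarrow>
     proj_map ring_of_type_algebra (rat_degree f) (rev (coeffs p)) (rev (coeffs q)))"

section \<open>Periodic points\<close>

definition periodic :: "('a \<Rightarrow> 'a) \<Rightarrow> 'a \<Rightarrow> bool" where
  "periodic F x \<longleftrightarrow> (\<exists>n>0. (F ^^ n) x = x)"

definition preperiodic :: "('a \<Rightarrow> 'a) \<Rightarrow> 'a \<Rightarrow> bool" where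
  "preperiodic F x \<longleftrightarrow> finite (range (\<lambda>n. (F ^^ n) x))"

definition strictly_preperiodic :: "('a \<Rightarrow> 'a) \<Rightarrow> 'a \<Rightarrow> bool" where
  "strictly_preperiodic F x \<longleftrightarrow> preperiodic F x \<and> \<not> periodic F x"

section \<open>Non-Archimedean places\<close>

definition nonarch_absval :: "('k::field \<Rightarrow> real) \<Rightarrow> bool" where
  "nonarch_absval v \<longleftrightarrow>
     (\<forall>x. 0 \<le> v x) \<and> (\<forall>x. v x = 0 \<longleftrightarrow> x = 0) \<and>
     (\<forall>x y. v (x * y) = v x * v y) \<and>
     (\<forall>x y. v (x + y) \<le> max (v x) (v y)) \<and>
     (\<exists>x. x \<noteq> 0 \<and> v x \<noteq> 1)"

definition absval_equiv :: "(('k::field \<Rightarrow> real) \<times> ('k \<Rightarrow> real)) set" where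
  "absval_equiv = {(v, w). nonarch_absval v \<and> nonarch_absval w \<and>
     (\<exists>s>0. \<forall>x. w x = v x powr s)}"

definition nonarch_places :: "('k::field \<Rightarrow> real) set set" where
  "nonarch_places = {v. nonarch_absval v} // absval_equiv"

text \<open>
  The residue field is formed from the valuation ring of \<open>K\<close> itself; the inclusion of \<open>K\<close> in its
  completion \<open>K\<^sub>v\<close> identifies it with the residue field of \<open>K\<^sub>v\<close>.
\<close>

definition val_ring :: "('k::field \<Rightarrow> real) \<Rightarrow> 'k ring" where
  "val_ring v = ring_of_type_algebra \<lparr>carrier := {x. v x \<le> 1}\<rparr>"

definition val_ideal :: "('k::field \<Rightarrow> real) \<Rightarrow> 'k set" where
  "val_ideal v = {x. v x < 1}"

definition residue_field :: "('k::field \<Rightarrow> real) \<Rightarrow> 'k set ring" where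
  "residue_field v = val_ring v Quot val_ideal v"

definition residue :: "('k::field \<Rightarrow> real) \<Rightarrow> 'k \<Rightarrow> 'k set" where
  "residue v x = val_ideal v +>\<^bsub>val_ring v\<^esub> x"

section \<open>Reduction of points and of rational maps\<close>

text \<open>
  The admissible coordinates of a point differ by a factor of absolute value 1, so the image set
  below is a singleton.
\<close>

definition reduce_point :: "('k::field \<Rightarrow> real) \<Rightarrow> ('k \<times> 'k) set \<Rightarrow> ('k set \<times> 'k set) set" where
  "reduce_point v P =
     the_elem ((\<lambda>(x, y). proj_point (residue_field v) (residue v x) (residue v y)) `
       {(x, y) \<in> P. max (v x) (v y) = 1})"

definition reduce_poly :: "('k::field \<Rightarrow> real) \<Rightarrow> 'k poly \<Rightarrow> 'k set list" where
  "reduce_poly v p = ring.normalize (residue_field v) (map (residue v) (rev (coeffs p)))"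

text \<open>\<open>ring.\<sigma> F\<close> maps polynomials over \<open>F\<close> to polynomials over its algebraic closure.\<close>

definition common_root_in_closure :: "('a, 'b) ring_scheme \<Rightarrow> 'a list \<Rightarrow> 'a list \<Rightarrow> bool" where
  "common_root_in_closure F p q \<longleftrightarrow>
     (\<exists>x \<in> carrier (field.alg_closure F).
        ring.eval (field.alg_closure F) (ring.\<sigma> F p) x = \<zero>\<^bsub>field.alg_closure F\<^esub> \<and>
        ring.eval (field.alg_closure F) (ring.\<sigma> F q) x = \<zero>\<^bsub>field.alg_closure F\<^esub>)"

definition good_model ::
    "('k::field \<Rightarrow> real) \<Rightarrow> 'k poly fract \<Rightarrow> 'k poly \<Rightarrow> 'k poly \<Rightarrow> bool" where
  "good_model v f p q \<longleftrightarrow>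
     q \<noteq> 0 \<and> f = Fract p q \<and>
     (\<forall>i. v (poly.coeff p i) \<le> 1) \<and> (\<forall>i. v (poly.coeff q i) \<le> 1) \<and>
     max (Polynomial.degree p) (Polynomial.degree q) = rat_degree f \<and>
     max (Polynomials.degree (reduce_poly v p)) (Polynomials.degree (reduce_poly v q)) = rat_degree f \<and>
     \<not> common_root_in_closure (residue_field v) (reduce_poly v p) (reduce_poly v q)"

definition good_reduction :: "('k::field \<Rightarrow> real) \<Rightarrow> 'k poly fract \<Rightarrow> bool" where
  "good_reduction v f \<longleftrightarrow> (\<exists>p q. good_model v f p q)"

text \<open>
  Any two choices of \<open>(p, q)\<close> differ by a factor of absolute value 1, so the reduced map does not
  depend on the choice.
\<close>

definition reduced_map ::
    "('k::field \<Rightarrow> real) \<Rightarrow> 'k poly fract \<Rightarrow> ('k set \<times> 'k set) set \<Rightarrow> ('k set \<times> 'k set) set" where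
  "reduced_map v f = (case (SOME (p, q). good_model v f p q) of (p, q) \<Rightarrow>
     proj_map (residue_field v) (rat_degree f) (reduce_poly v p) (reduce_poly v q))"

end

theory Submission
  imports Defs
begin

hide_const (open) Polynomials.degree Polynomials.lead_coeff

text \<open>
  Write \<open>[x\<^sub>n : y\<^sub>n]\<close> for the \<open>n\<close>-th iterate of \<open>\<alpha> = [a : b]\<close> in homogeneous coordinates and
  \<open>\<beta>\<^sub>n = x\<^sub>n b - y\<^sub>n a\<close>. If \<open>\<alpha>\<close> is periodic, it stays periodic at every place of good reduction. Otherwise
  suppose that only finitely many places qualify. At every place outside a finite set \<open>S\<close> the reduced orbit
  never returns to \<open>\<alpha>\<close>, that is, \<open>\<bar>\<beta>\<^sub>n\<bar>\<close> is as large as possible. At a place of \<open>S\<close>, or at an Archimedean one,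
  an orbit point very close to \<open>\<alpha>\<close> cannot be followed by another one within a bounded number of steps, by
  continuity and because \<open>\<alpha>\<close> is not periodic. By the pigeonhole principle, infinitely many orbit points are
  therefore uniformly far from \<open>\<alpha>\<close> at all these places simultaneously. For these \<open>n\<close>, the elements
  \<open>x\<^sub>n / \<beta>\<^sub>n\<close> and \<open>y\<^sub>n / \<beta>\<^sub>n\<close> have bounded denominators and bounded conjugates, so that
  there are only finitely many of them, and \<open>\<alpha>\<close> is preperiodic. Thus neither Siegel's nor Roth's theorem
  is needed.
\<close>

section \<open>Number fields over the rationals\<close>

text \<open>A number field enters only as a field of finite dimension over Q and its places only as
  classes of absolute values, so integrality has to be read off from absolute values. The link is
  \<open>exists_absval_gt_1\<close>: an element that is no algebraic integer exceeds 1 at some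
  place. That place comes from a valuation ring found by Zorn's lemma; the ring has a real-valued
  valuation because every nonzero element has a power that is a unit times a power of the residue
  characteristic.

  At the places of S closeness to \<alpha> is bounded only up to a factor \<epsilon>. A natural
  number N of absolute value at most \<epsilon> at all of them absorbs it, so that
  \<open>N * x\<^sub>n / \<beta>\<^sub>n\<close> and \<open>N * y\<^sub>n / \<beta>\<^sub>n\<close>
  are honest algebraic integers with conjugates at most N / \<epsilon>. This pair of numbers
  determines the point, so a repeated pair is a repeated orbit point.

  Continuity has to serve all absolute values alike. It is therefore stated for polynomials: the
  moving point has coordinates linear in a parameter e, and the same iteration, run over the
  polynomial ring, makes its iterates polynomial in e.\<close>

definition rat_basis :: "'k::field_char_0 itself \<Rightarrow> 'k set" where
  "rat_basis _ = (SOME B. finite_dimensional_vector_space (\<lambda>(r::rat) x. of_rat r * x) B)"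

lemma rat_basis:
  assumes "number_field TYPE('k::field_char_0)"
  shows "finite_dimensional_vector_space (\<lambda>(r::rat) (x::'k). of_rat r * x) (rat_basis TYPE('k))"
  unfolding rat_basis_def by (rule someI_ex) (use assms in \<open>simp add: number_field_def\<close>)

text \<open>Indexed families rather than sets, because the powers of an element may repeat: two
  equal members give the relation with coefficients 1 and -1, and an injective family larger than
  the basis is a dependent set.\<close>

lemma number_field_dependent:
  fixes z :: "'i \<Rightarrow> 'k::field_char_0"
  assumes K: "number_field TYPE('k)" and I: "finite I" "card I > card (rat_basis TYPE('k))"
  shows "\<exists>c :: 'i \<Rightarrow> rat. (\<exists>i\<in>I. c i \<noteq> 0) \<and> (\<Sum>i\<in>I. of_rat (c i) * z i) = 0"
proof -
  interpret finite_dimensional_vector_space "\<lambda>(r::rat) (x::'k). of_rat r * x" "rat_basis TYPE('k)"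
    by (rule rat_basis[OF K])
  show ?thesis
  proof (cases "inj_on z I")
    case True
    hence "card (z ` I) > card (rat_basis TYPE('k))" using I by (simp add: card_image)
    hence "dependent (z ` I)"
      using independent_span_bound[OF finite_Basis, of "z ` I"] span_Basis by auto
    then obtain u where u: "\<exists>v\<in>z ` I. u v \<noteq> 0" "(\<Sum>v\<in>z ` I. of_rat (u v) * v) = 0"
      using dependent_finite[of "z ` I"] I by auto
    have "(\<Sum>i\<in>I. of_rat (u (z i)) * z i) = 0"
      using u(2) by (simp add: sum.reindex[OF True])
    thus ?thesis using u(1) by (intro exI[of _ "\<lambda>i. u (z i)"]) auto
  next
    case False
    then obtain i j where ij: "i \<in> I" "j \<in> I" "i \<noteq> j" "z i = z j" by (auto simp: inj_on_def)
    let ?c = "\<lambda>k. if k = i then 1 else if k = j then -1 else (0::rat)"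
    have "(\<Sum>k\<in>I. of_rat (?c k) * z k) = (\<Sum>k\<in>{i,j}. of_rat (?c k) * z k)"
      by (rule sum.mono_neutral_right) (use ij I in auto)
    also have "\<dots> = 0" using ij by simp
    finally show ?thesis using ij by (intro exI[of _ ?c]) auto
  qed
qed

lemma rat_common_denominator:
  fixes c :: "'i \<Rightarrow> rat"
  assumes "finite I"
  shows "\<exists>D::int. D > 0 \<and> (\<forall>i\<in>I. of_int D * c i \<in> \<int>)"
  using assms
proof induction
  case empty
  show ?case by (auto intro: exI[of _ 1])
next
  case (insert j I)
  then obtain D where D: "D > 0" "\<forall>i\<in>I. of_int D * c i \<in> \<int>" by blast
  obtain a b where ab: "c j = of_int a / of_int b" "b > 0"
    by (cases "c j") (auto simp: Fract_of_int_quotient)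
  have "of_int (D * b) * c i \<in> \<int>" if "i \<in> insert j I" for i
  proof (cases "i = j")
    case True
    thus ?thesis using ab by simp
  next
    case False
    hence "of_int D * c i \<in> \<int>" using D(2) that by blast
    hence "of_int b * (of_int D * c i) \<in> \<int>" by (rule Ints_mult[OF Ints_of_int])
    thus ?thesis by (simp add: mult_ac)
  qed
  thus ?case using D ab by (intro exI[of _ "D * b"]) simp
qed

lemma poly_sum_bound:
  fixes p :: "'a::comm_ring_1 poly"
  assumes "degree p \<le> m"
  shows "poly p x = (\<Sum>i\<le>m. poly.coeff p i * x ^ i)"
  unfolding poly_altdef
  by (rule sum.mono_neutral_left) (use assms in \<open>auto simp: coeff_eq_0\<close>)

abbreviation ipoly :: "int poly \<Rightarrow> 'a::comm_ring_1 \<Rightarrow> 'a" where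
  "ipoly P \<equiv> poly (map_poly of_int P)"

text \<open>With m the dimension, the m + 1 powers up to \<open>y ^ m\<close> are dependent over Q,
  and a common denominator clears the relation. The degree bound later leaves only finitely many
  candidates for minimal polynomials with bounded coefficients.\<close>

lemma number_field_int_poly:
  fixes y :: "'k::field_char_0"
  assumes K: "number_field TYPE('k)"
  shows "\<exists>P::int poly. P \<noteq> 0 \<and> degree P \<le> card (rat_basis TYPE('k)) \<and>
           ipoly P y = 0"
proof -
  define m where "m = card (rat_basis TYPE('k))"
  obtain c :: "nat \<Rightarrow> rat" where c: "\<exists>i\<in>{..m}. c i \<noteq> 0" "(\<Sum>i\<in>{..m}. of_rat (c i) * y ^ i) = 0"
    using number_field_dependent[OF K, of "{..m}" "\<lambda>i. y ^ i"] by (auto simp: m_def)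
  obtain D where D: "D > 0" "\<forall>i\<in>{..m}. of_int D * c i \<in> \<int>"
    using rat_common_denominator[of "{..m}" c] by auto
  define a where "a i = (if i \<le> m then \<lfloor>of_int D * c i\<rfloor> else 0)" for i
  have a: "of_int (a i) = of_int D * c i" if "i \<le> m" for i
    using D that by (simp add: a_def)
  define P where "P = (\<Sum>i\<le>m. Polynomial.monom (a i) i)"
  have cP: "poly.coeff P i = a i" for i
    by (auto simp: P_def coeff_sum sum.delta' a_def)
  have "P \<noteq> 0"
  proof
    assume "P = 0"
    hence "a i = 0" for i using cP[of i] by simp
    hence "\<forall>i\<le>m. c i = 0" using a D(1) by simp
    thus False using c(1) by auto
  qed
  moreover have "degree P \<le> m"
    by (rule degree_le) (auto simp: cP a_def)
  moreover have "ipoly P y = 0"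
  proof -
    have "ipoly P y = (\<Sum>i\<le>m. of_int (a i) * y ^ i)"
      using poly_sum_bound[of "map_poly of_int P" m y] \<open>degree P \<le> m\<close>
      by (simp add: coeff_map_poly cP degree_map_poly)
    also have "\<dots> = (\<Sum>i\<le>m. of_int D * (of_rat (c i) * y ^ i))"
    proof (rule sum.cong)
      fix i assume "i \<in> {..m}"
      hence "of_rat (of_int (a i)) = (of_rat (of_int D * c i) :: 'k)" using a by simp
      thus "of_int (a i) * y ^ i = of_int D * (of_rat (c i) * y ^ i)"
        by (simp add: of_rat_mult)
    qed simp
    also have "\<dots> = 0" using c(2) by (simp flip: sum_distrib_left)
    finally show ?thesis .
  qed
  ultimately show ?thesis unfolding m_def by blast
qed

section \<open>Coprime polynomials over a field\<close>

text \<open>A nonzero combination of least degree divides every combination, because the remainder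
  of a division is again a combination.\<close>

lemma poly_field_gcd:
  fixes p q :: "'k::field poly"
  assumes "p \<noteq> 0 \<or> q \<noteq> 0"
  shows "\<exists>g u w. g \<noteq> 0 \<and> g = u * p + w * q \<and> g dvd p \<and> g dvd q"
proof -
  define J where "J = {u * p + w * q | u w. u * p + w * q \<noteq> 0}"
  have "p \<in> J \<or> q \<in> J"
  proof (cases "p = 0")
    case True
    hence "q = 0 * p + 1 * q \<and> q \<noteq> 0" using assms by simp
    thus ?thesis unfolding J_def by (metis (mono_tags, lifting) mem_Collect_eq)
  next
    case False
    hence "p = 1 * p + 0 * q \<and> p \<noteq> 0" by simp
    thus ?thesis unfolding J_def by (metis (mono_tags, lifting) mem_Collect_eq)
  qed
  then obtain h0 where "h0 \<in> J" by blast
  then obtain g where g: "g \<in> J" "\<And>h. h \<in> J \<Longrightarrow> degree g \<le> degree h"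
    using ex_has_least_nat[of "\<lambda>h. h \<in> J" h0 degree] by auto
  then obtain u w where uw: "g = u * p + w * q" "g \<noteq> 0" by (auto simp: J_def)
  have red: "r mod g = 0" if r: "r = a * p + b * q" for r a b
  proof (rule ccontr)
    assume nz: "r mod g \<noteq> 0"
    have "r mod g = r - (r div g) * g" by (simp add: minus_div_mult_eq_mod)
    also have "\<dots> = (a - (r div g) * u) * p + (b - (r div g) * w) * q"
      unfolding uw(1) r by (simp add: algebra_simps)
    finally have "r mod g \<in> J" using nz by (auto simp: J_def)
    hence "degree g \<le> degree (r mod g)" by (rule g)
    with degree_mod_less[OF uw(2), of r] nz show False by auto
  qed
  have "p mod g = 0" "q mod g = 0" using red[of p 1 0] red[of q 0 1] by simp_all
  hence "g dvd p" "g dvd q" by (simp_all add: mod_0_imp_dvd)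
  thus ?thesis using uw by blast
qed

lemma coprime_poly_bezout:
  fixes p q :: "'k::field poly"
  assumes "coprime p q"
  shows "\<exists>u w. u * p + w * q = 1"
proof -
  have "p \<noteq> 0 \<or> q \<noteq> 0" using assms by auto
  then obtain g u w where g: "g = u * p + w * q" "g dvd p" "g dvd q"
    using poly_field_gcd by metis
  hence "g dvd 1" using assms by (simp add: coprime_common_divisor)
  then obtain h where "1 = g * h" by (auto elim: dvdE)
  hence "(h * u) * p + (h * w) * q = 1" using g(1) by (simp add: algebra_simps)
  thus ?thesis by blast
qed

text \<open>Cancelling the gcd shows that the choice in the definition is made from a nonempty set;
  the Bezout relation of the gcd, divided by the gcd, gives coprimality.\<close>

lemma lowest_terms:
  fixes f :: "'k::field poly fract"
  assumes "lowest_terms f = (p, q)"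
  shows "q \<noteq> 0" "coprime p q" "f = Fract p q"
proof -
  obtain a b where ab: "f = Fract a b" "b \<noteq> 0" by (cases f)
  obtain g u w where g: "g \<noteq> 0" "g = u * a + w * b" "g dvd a" "g dvd b"
    using poly_field_gcd[of a b] ab by metis
  then obtain p' q' where pq: "a = g * p'" "b = g * q'" unfolding dvd_def by blast
  have "g * 1 = g * (u * p' + w * q')"
    using g(2) unfolding pq by (simp add: algebra_simps)
  hence "1 = u * p' + w * q'" using g(1) by (metis mult_left_cancel)
  hence "coprime p' q'"
    by (intro coprimeI) (metis dvd_add dvd_mult)
  moreover have "f = Fract p' q'" "q' \<noteq> 0"
    using ab g(1) by (auto simp: pq eq_fract algebra_simps)
  ultimately have "\<exists>x. (\<lambda>(p, q). q \<noteq> 0 \<and> coprime p q \<and> f = Fract p q) x" by auto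
  from someI_ex[OF this] have "(\<lambda>(p, q). q \<noteq> 0 \<and> coprime p q \<and> f = Fract p q) (p, q)"
    using assms by (simp add: lowest_terms_def)
  thus "q \<noteq> 0" "coprime p q" "f = Fract p q" by auto
qed

text \<open>Serves to compare an arbitrary good model with the chosen lowest terms. From
  \<open>u * p + w * q = 1\<close> the polynomial \<open>u * p' + w * q'\<close> turns out to be the
  common factor, and equality of the degree maxima leaves it constant.\<close>

lemma fract_lowest_multiple:
  fixes p q p' q' :: "'k::field poly"
  assumes "Fract p' q' = Fract p q" "coprime p q" "q \<noteq> 0" "q' \<noteq> 0"
    and deg: "max (degree p') (degree q') = max (degree p) (degree q)"
  shows "\<exists>c. c \<noteq> 0 \<and> p' = smult c p \<and> q' = smult c q"
proof -
  have eq: "p' * q = p * q'" using assms by (simp add: eq_fract)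
  obtain u w where uw: "u * p + w * q = 1" using coprime_poly_bezout assms(2) by blast
  define g where "g = u * p' + w * q'"
  have "g * p = u * p * p' + w * (p * q')" by (simp add: g_def algebra_simps)
  also have "\<dots> = (u * p + w * q) * p'" unfolding eq[symmetric] by (simp add: algebra_simps)
  finally have gp: "p' = g * p" using uw by simp
  have "g * q = u * (p' * q) + w * q * q'" by (simp add: g_def algebra_simps)
  also have "\<dots> = (u * p + w * q) * q'" unfolding eq by (simp add: algebra_simps)
  finally have gq: "q' = g * q" using uw by simp
  have g0: "g \<noteq> 0" using gq assms(4) by auto
  have "degree q' = degree g + degree q"
    unfolding gq using g0 assms(3) by (rule degree_mult_eq)
  moreover have "p \<noteq> 0 \<Longrightarrow> degree p' = degree g + degree p"
    unfolding gp using g0 by (rule degree_mult_eq)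
  moreover have "p = 0 \<Longrightarrow> p' = 0" by (simp add: gp)
  ultimately have "degree g = 0" using deg by (cases "p = 0") auto
  then obtain c where "g = [:c:]" by (rule degree_eq_zeroE)
  thus ?thesis using gp gq g0 by auto
qed

section \<open>Existence of non-Archimedean absolute values\<close>

definition subring_set :: "'k::comm_ring_1 set \<Rightarrow> bool" where
  "subring_set B \<longleftrightarrow> 0 \<in> B \<and> 1 \<in> B \<and> (\<forall>x\<in>B. \<forall>y\<in>B. x + y \<in> B \<and> x * y \<in> B) \<and> (\<forall>x\<in>B. - x \<in> B)"

lemma subring_setD:
  assumes "subring_set B"
  shows "0 \<in> B" "1 \<in> B" "x \<in> B \<Longrightarrow> y \<in> B \<Longrightarrow> x + y \<in> B" "x \<in> B \<Longrightarrow> y \<in> B \<Longrightarrow> x * y \<in> B"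
    "x \<in> B \<Longrightarrow> - x \<in> B" "x \<in> B \<Longrightarrow> y \<in> B \<Longrightarrow> x - y \<in> B"
proof -
  show "x \<in> B \<Longrightarrow> y \<in> B \<Longrightarrow> x - y \<in> B"
    using assms unfolding subring_set_def diff_conv_add_uminus by blast
qed (use assms in \<open>auto simp: subring_set_def\<close>)

lemma subring_set_power: "subring_set B \<Longrightarrow> x \<in> B \<Longrightarrow> x ^ n \<in> B"
  by (induction n) (auto intro: subring_setD)

lemma subring_set_sum: "subring_set B \<Longrightarrow> (\<And>i. i \<in> I \<Longrightarrow> f i \<in> B) \<Longrightarrow> sum f I \<in> B"
  by (induction I rule: infinite_finite_induct) (auto intro: subring_setD)

lemma subring_set_of_nat: "subring_set B \<Longrightarrow> of_nat n \<in> B"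
  by (induction n) (auto intro: subring_setD)

lemma subring_set_of_int: "subring_set B \<Longrightarrow> of_int n \<in> B"
  by (cases n rule: int_cases2) (auto intro!: subring_setD(5) subring_set_of_nat)

definition polys_over :: "'k::comm_ring_1 set \<Rightarrow> 'k poly set" where
  "polys_over B = {h. \<forall>i. poly.coeff h i \<in> B}"

lemma polys_over_subring: "subring_set B \<Longrightarrow> subring_set (polys_over B)"
  unfolding polys_over_def subring_set_def[of "{h. _ h}"]
  by (auto intro!: subring_setD subring_set_sum simp: coeff_1 coeff_mult)

lemma polys_over_monom: "subring_set B \<Longrightarrow> b \<in> B \<Longrightarrow> Polynomial.monom b n \<in> polys_over B"
  by (auto simp: polys_over_def subring_setD)

lemma polys_over_pCons [simp]: "pCons b h \<in> polys_over B \<longleftrightarrow> b \<in> B \<and> h \<in> polys_over B"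
  unfolding polys_over_def by (auto simp: coeff_pCons split: nat.splits)

lemma polys_over_eval: "subring_set B \<Longrightarrow> h \<in> polys_over B \<Longrightarrow> x \<in> B \<Longrightarrow> poly h x \<in> B"
  unfolding poly_altdef
  by (rule subring_set_sum) (auto simp: polys_over_def intro!: subring_setD(4) subring_set_power)

definition adjoin :: "'k::comm_ring_1 set \<Rightarrow> 'k \<Rightarrow> 'k set" where
  "adjoin B y = (\<lambda>h. poly h y) ` polys_over B"

lemma adjoinI: "h \<in> polys_over B \<Longrightarrow> poly h y \<in> adjoin B y"
  by (simp add: adjoin_def)

lemma adjoin_subring:
  assumes "subring_set B"
  shows "subring_set (adjoin B y)"
proof -
  note P = subring_setD[OF polys_over_subring[OF assms]]
  have "a + b \<in> adjoin B y \<and> a * b \<in> adjoin B y \<and> - a \<in> adjoin B y"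
    if ab: "a \<in> adjoin B y" "b \<in> adjoin B y" for a b
  proof -
    obtain g h where gh: "g \<in> polys_over B" "h \<in> polys_over B" "a = poly g y" "b = poly h y"
      using ab by (auto simp: adjoin_def)
    show ?thesis
      using adjoinI[OF P(3)[OF gh(1,2)], of y] adjoinI[OF P(4)[OF gh(1,2)], of y] adjoinI[OF P(5)[OF gh(1)], of y]
      by (simp add: gh)
  qed
  thus ?thesis
    using adjoinI[OF P(1), of y] adjoinI[OF P(2), of y] unfolding subring_set_def by simp
qed

lemma adjoin_superset: "subring_set B \<Longrightarrow> B \<subseteq> adjoin B y"
  unfolding adjoin_def by (rule subsetI, rule_tac x = "[:x:]" in image_eqI)
    (auto simp: polys_over_def coeff_pCons subring_setD split: nat.splits)

lemma adjoin_generator: "subring_set B \<Longrightarrow> y \<in> adjoin B y"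
  unfolding adjoin_def
  by (rule image_eqI[of _ _ "[:0, 1:]"]) (auto simp: subring_setD polys_over_def coeff_pCons split: nat.splits)

section \<open>Valuation rings that avoid a given element (Chevalley)\<close>

definition valuation_set :: "'k::field set \<Rightarrow> bool" where
  "valuation_set B \<longleftrightarrow> subring_set B \<and> (\<forall>y. y \<in> B \<or> inverse y \<in> B)"

text \<open>Here c is 1 / u, and \<open>u ^ n\<close> clears the denominators of h(1 / u).\<close>

lemma poly_times_power_in:
  assumes "subring_set B" "h \<in> polys_over B" "u \<in> B" "u * c = 1" "degree h \<le> n"
  shows "poly h c * u ^ n \<in> (B::'k::field set)"
proof -
  have "poly h c * u ^ n = (\<Sum>i\<le>n. poly.coeff h i * u ^ (n - i))"
    unfolding poly_sum_bound[OF assms(5)] sum_distrib_right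
  proof (rule sum.cong)
    fix i assume "i \<in> {..n}"
    hence "u ^ n = u ^ i * u ^ (n - i)" by (simp flip: power_add)
    moreover have "c ^ i * u ^ i = 1" using assms(4) by (simp flip: power_mult_distrib add: mult.commute)
    ultimately show "poly.coeff h i * c ^ i * u ^ n = poly.coeff h i * u ^ (n - i)"
      by (simp add: mult.assoc)
  qed simp
  also have "\<dots> \<in> B"
    by (intro subring_set_sum subring_setD(4)[OF assms(1)] subring_set_power assms)
      (use assms in \<open>auto simp: polys_over_def\<close>)
  finally show ?thesis .
qed

text \<open>
  A subring \<open>B\<close> containing \<open>t = 1 / x\<close> that is maximal among those not containing \<open>x\<close> is local
  enough for Chevalley's degree reduction to show that it is a valuation ring.
\<close>

locale maximal_avoiding =
  fixes B :: "'k::field set" and t x :: 'k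
  assumes B: "subring_set B" and t: "t \<in> B" "t * x = 1" and x: "x \<notin> B"
    and max: "\<And>y. y \<notin> B \<Longrightarrow> x \<in> adjoin B y"
begin

text \<open>Put u = \<open>1 - t * c\<close>. If its inverse were missing from B, maximality would
  give x in B[1/u], hence \<open>x * u ^ n\<close> in B. But \<open>u ^ n\<close> has again the form
  \<open>1 - t * c'\<close>, and \<open>t * x = 1\<close> turns \<open>x * u ^ n\<close> into
  \<open>x - c'\<close>, which would put x into B.\<close>

lemma unit_one_minus:
  assumes "c \<in> B"
  shows "1 - t * c \<noteq> 0" "inverse (1 - t * c) \<in> B"
proof -
  define u where "u = 1 - t * c"
  have uB: "u \<in> B" unfolding u_def by (intro subring_setD[OF B] t assms)
  show nz: "1 - t * c \<noteq> 0"
  proof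
    assume "1 - t * c = 0"
    hence "t * c = t * x" using t by simp
    moreover have "t \<noteq> 0" using t by auto
    ultimately have "c = x" by simp
    thus False using x assms by simp
  qed
  show "inverse (1 - t * c) \<in> B"
  proof (rule ccontr)
    assume "inverse (1 - t * c) \<notin> B"
    hence "x \<in> adjoin B (inverse u)" using max by (simp add: u_def)
    then obtain h where h: "h \<in> polys_over B" "x = poly h (inverse u)" by (auto simp: adjoin_def)
    define n where "n = degree h"
    have b: "x * u ^ n \<in> B"
      unfolding h(2) by (rule poly_times_power_in[OF B h(1) uB]) (use nz in \<open>auto simp: n_def u_def\<close>)
    have "\<exists>c'\<in>B. u ^ k = 1 - t * c'" for k
    proof (induction k)
      case 0
      show ?case by (rule bexI[of _ 0]) (simp_all add: subring_setD[OF B])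
    next
      case (Suc k)
      then obtain c' where "c' \<in> B" "u ^ k = 1 - t * c'" by blast
      moreover from this have "u ^ Suc k = u * (1 - t * c')" by simp
      hence "u ^ Suc k = 1 - t * (c + c' - t * c * c')" by (simp add: u_def algebra_simps)
      ultimately show ?case using assms t by (metis subring_setD[OF B])
    qed
    then obtain c' where c': "c' \<in> B" "u ^ n = 1 - t * c'" by blast
    have "x * u ^ n + c' = x" unfolding c'(2) using t(2) by (simp add: algebra_simps)
    moreover have "x * u ^ n + c' \<in> B" by (intro subring_setD[OF B] b c')
    ultimately show False using x by simp
  qed
qed

text \<open>Multiplied by t, the relation for \<open>inverse y\<close> says that the unit
  \<open>1 - t * g0\<close> is a combination of the negative powers of y down to exponent -(m + 1).
  Multiplying by \<open>y ^ Suc m\<close> expresses that power over B through lower powers of y, and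
  these replace the top term of h.\<close>

lemma degree_reduction_step:
  assumes h: "h \<in> polys_over B" and g: "g \<in> polys_over B" and "poly h y = x" "poly g (inverse y) = x"
    and y: "y \<noteq> 0" and deg: "degree g \<le> degree h"
  shows "\<exists>h'\<in>polys_over B. poly h' y = x \<and> degree h' < degree h"
proof -
  note P = subring_setD[OF polys_over_subring[OF B]]
  obtain g0 g' where gg: "g = pCons g0 g'" by (cases g)
  have g0: "g0 \<in> B" and g': "g' \<in> polys_over B" using g by (simp_all add: gg)
  have "g' \<noteq> 0" using assms(4) x g0 by (auto simp: gg)
  define m where "m = degree g'"
  have dg: "degree g = Suc m" using \<open>g' \<noteq> 0\<close> by (simp add: gg m_def)
  define n where "n = degree h"
  have n: "Suc m \<le> n" using deg dg by (simp add: n_def)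
  define r where "r = reflect_poly g'"
  have r: "r \<in> polys_over B"
    using g' subring_setD(1)[OF B] by (auto simp: r_def polys_over_def coeff_reflect_poly)
  have pr: "poly r y = y ^ m * poly g' (inverse y)"
    unfolding r_def m_def by (rule poly_reflect_poly_nz[OF y])
  define w where "w = inverse (1 - t * g0)"
  have w: "w \<in> B" "w * (1 - t * g0) = 1"
    using unit_one_minus[OF g0] by (simp_all add: w_def)
  have eq: "inverse y * poly g' (inverse y) = x - g0" using assms(4) by (simp add: gg algebra_simps)
  have "t * (inverse y * poly g' (inverse y)) = 1 - t * g0"
    unfolding eq using t(2) by (simp add: right_diff_distrib)
  hence "y ^ Suc m * (1 - t * g0) = y ^ Suc m * (t * (inverse y * poly g' (inverse y)))" by simp
  also have "\<dots> = y * inverse y * t * poly r y" by (simp add: pr mult_ac)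
  finally have "y ^ Suc m * (1 - t * g0) = y * inverse y * t * poly r y" .
  hence "w * (y ^ Suc m * (1 - t * g0)) = w * t * poly r y" using y by simp
  moreover have "y ^ Suc m = (w * (1 - t * g0)) * y ^ Suc m" unfolding w(2) by simp
  ultimately have ym: "y ^ Suc m = w * t * poly r y" by (simp only: mult_ac)
  obtain b h1 where hb: "h = h1 + Polynomial.monom b n" "b \<in> B" "h1 \<in> polys_over B"
    "degree h1 < n"
  proof
    let ?b = "poly.coeff h n"
    show "h = (h - Polynomial.monom ?b n) + Polynomial.monom ?b n" by simp
    show b: "?b \<in> B" using h by (auto simp: polys_over_def)
    show "h - Polynomial.monom ?b n \<in> polys_over B" by (intro P h polys_over_monom B b)
    show "degree (h - Polynomial.monom ?b n) < n"
      using n by (intro degree_lessI) (auto simp: n_def coeff_eq_0)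
  qed
  define h' where "h' = h1 + Polynomial.monom (b * w * t) (n - Suc m) * r"
  have "h' \<in> polys_over B"
    unfolding h'_def by (intro P hb r polys_over_monom B subring_setD[OF B] w t)
  moreover have "poly h' y = x"
  proof -
    have "y ^ n = y ^ (n - Suc m) * y ^ Suc m" using n by (simp only: flip: power_add) simp
    hence "b * y ^ n = b * w * t * y ^ (n - Suc m) * poly r y" by (simp only: ym mult_ac)
    hence "poly h' y = poly h y" by (auto simp: hb(1) h'_def poly_monom)
    thus ?thesis using assms by simp
  qed
  moreover have "degree h' < n"
    unfolding h'_def
  proof (rule degree_add_less[OF hb(4)])
    have "degree (Polynomial.monom (b * w * t) (n - Suc m) * r) \<le> (n - Suc m) + m"
      by (intro order.trans[OF degree_mult_le] add_mono degree_monom_le)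
        (simp add: r_def m_def degree_reflect_poly_le)
    thus "degree (Polynomial.monom (b * w * t) (n - Suc m) * r) < n" using n by simp
  qed
  ultimately show ?thesis unfolding n_def by blast
qed

text \<open>The hypotheses are symmetric in y and its inverse, so the relation of larger degree can
  always be shortened: descent on the sum of the degrees.\<close>

lemma degree_reduction:
  assumes "h \<in> polys_over B" "g \<in> polys_over B" "poly h y = x" "poly g (inverse y) = x" "y \<noteq> 0"
  shows False
  using assms
proof (induction "degree h + degree g" arbitrary: h g y rule: less_induct)
  case less
  show False
  proof (cases "degree g \<le> degree h")
    case True
    obtain h' where "h' \<in> polys_over B" "poly h' y = x" "degree h' < degree h"
      using degree_reduction_step[OF less.prems True] by blast
    thus False using less.hyps[of h' g y] less.prems by simp
  next
    case False
    obtain g' where "g' \<in> polys_over B" "poly g' (inverse y) = x" "degree g' < degree g"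
      using degree_reduction_step[of g h "inverse y"] less.prems False by auto
    thus False using less.hyps[of h g' y] less.prems by simp
  qed
qed

lemma valuation_set: "valuation_set B"
  unfolding valuation_set_def
proof (intro conjI allI B)
  fix y
  show "y \<in> B \<or> inverse y \<in> B"
  proof (rule ccontr)
    assume *: "\<not> (y \<in> B \<or> inverse y \<in> B)"
    hence "y \<noteq> 0" using subring_setD(1)[OF B] by auto
    moreover obtain h where "h \<in> polys_over B" "poly h y = x"
      using max[of y] * by (auto simp: adjoin_def)
    moreover obtain g where "g \<in> polys_over B" "poly g (inverse y) = x"
      using max[of "inverse y"] * by (auto simp: adjoin_def)
    ultimately show False using degree_reduction by blast
  qed
qed

end

lemma subring_set_chain_Union:
  assumes "\<C> \<noteq> {}" "\<And>B. B \<in> \<C> \<Longrightarrow> subring_set B" "\<And>B C. B \<in> \<C> \<Longrightarrow> C \<in> \<C> \<Longrightarrow> B \<subseteq> C \<or> C \<subseteq> B"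
  shows "subring_set (\<Union>\<C>)"
proof -
  have "x + y \<in> \<Union>\<C> \<and> x * y \<in> \<Union>\<C>" if xy: "x \<in> \<Union>\<C>" "y \<in> \<Union>\<C>" for x y
  proof -
    obtain B C where "B \<in> \<C>" "x \<in> B" "C \<in> \<C>" "y \<in> C" using xy by blast
    then obtain D where "D \<in> \<C>" "x \<in> D" "y \<in> D" using assms(3)[of B C] by blast
    thus ?thesis using assms(2) subring_setD by blast
  qed
  moreover have "- x \<in> \<Union>\<C>" if "x \<in> \<Union>\<C>" for x
    using that assms(2) subring_setD(5) by blast
  moreover have "0 \<in> \<Union>\<C>" "1 \<in> \<Union>\<C>"
    using assms(1,2) subring_setD(1,2) by blast+
  ultimately show ?thesis unfolding subring_set_def by blast
qed

text \<open>For a subring B that is maximal by Zorn's lemma, adjoining any missing y must bring in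
  x, since \<open>adjoin B y\<close> would otherwise be a larger candidate. The inverse of x plays
  the part of t.\<close>

lemma exists_valuation_set_avoiding:
  fixes x :: "'k::field"
  assumes A: "subring_set A" "inverse x \<in> A" "x \<notin> A"
  shows "\<exists>B. A \<subseteq> B \<and> valuation_set B \<and> x \<notin> B"
proof -
  define \<A> where "\<A> = {B. subring_set B \<and> A \<subseteq> B \<and> x \<notin> B}"
  have "\<A> \<noteq> {}" using A by (auto simp: \<A>_def)
  moreover have "\<Union>\<C> \<in> \<A>" if "\<C> \<noteq> {}" "subset.chain \<A> \<C>" for \<C>
  proof -
    have "subring_set (\<Union>\<C>)"
      by (rule subring_set_chain_Union) (use that in \<open>auto simp: subset_chain_def \<A>_def\<close>)
    moreover have "A \<subseteq> \<Union>\<C>" "x \<notin> \<Union>\<C>"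
      using that unfolding subset_chain_def \<A>_def by blast+
    ultimately show ?thesis by (simp add: \<A>_def)
  qed
  ultimately obtain B where B: "B \<in> \<A>" "\<And>C. C \<in> \<A> \<Longrightarrow> B \<subseteq> C \<Longrightarrow> C = B"
    using subset_Zorn_nonempty[of \<A>] by blast
  note BA = this
  have x0: "x \<noteq> 0" using A subring_setD(1) by auto
  interpret maximal_avoiding B "inverse x" x
  proof
    fix y assume y: "y \<notin> B"
    show "x \<in> adjoin B y"
    proof (rule ccontr)
      assume "x \<notin> adjoin B y"
      moreover have "subring_set B" "A \<subseteq> B" using B(1) by (auto simp: \<A>_def)
      ultimately have "adjoin B y \<in> \<A>"
        using adjoin_subring[of B y] adjoin_superset[of B y] unfolding \<A>_def by blast
      hence "adjoin B y = B" using B(2) adjoin_superset[OF \<open>subring_set B\<close>] by blast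
      thus False using y adjoin_generator B(1) by (auto simp: \<A>_def)
    qed
  qed (use B A x0 in \<open>auto simp: \<A>_def\<close>)
  show ?thesis using valuation_set BA(1) by (auto simp: \<A>_def)
qed

section \<open>Integral closedness of valuation rings\<close>

lemma monic_root_degree:
  fixes P :: "'a::comm_ring_1 poly"
  assumes "lead_coeff P = 1" "poly P z = 0"
  shows "degree P > 0"
proof (rule ccontr)
  assume "\<not> degree P > 0"
  hence "degree P = 0" by simp
  then obtain c where "P = [:c:]" by (rule degree_eq_zeroE)
  thus False using assms by simp
qed

text \<open>If x is missing, its inverse belongs to B, and the equation divided by
  \<open>x ^ (n - 1)\<close> writes -x as a polynomial in that inverse over B.\<close>

lemma valuation_set_int_closed:
  fixes B :: "'k::field set"
  assumes "valuation_set B" "h \<in> polys_over B" "lead_coeff h = 1" "poly h x = 0"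
  shows "x \<in> B"
proof (rule ccontr)
  assume x: "x \<notin> B"
  have B: "subring_set B" and ix: "inverse x \<in> B" using assms x by (auto simp: valuation_set_def)
  have x0: "x \<noteq> 0" using x subring_setD[OF B] by auto
  define n where "n = degree h"
  have n: "n > 0" unfolding n_def by (rule monic_root_degree) fact+
  define h1 where "h1 = h - Polynomial.monom 1 n"
  have "degree h1 < n"
    using n assms(3) by (intro degree_lessI) (auto simp: n_def h1_def coeff_eq_0)
  moreover have "h1 \<in> polys_over B" unfolding h1_def
    by (intro subring_setD[OF polys_over_subring] polys_over_monom assms B) (rule subring_setD[OF B])
  ultimately have "poly h1 x * inverse x ^ (n - 1) \<in> B"
    by (intro poly_times_power_in[OF B _ ix]) (use x0 in auto)
  moreover have "poly h1 x * inverse x ^ (n - 1) = - x"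
    using assms(4) n x0 by (cases n) (simp_all add: h1_def poly_monom field_simps)
  ultimately show False using x subring_setD(5)[OF B] by fastforce
qed

section \<open>The absolute value attached to a valuation ring of a number field\<close>

locale number_field_valuation =
  fixes B :: "'k::field_char_0 set" and x :: 'k
  assumes K: "number_field TYPE('k)" and VB: "valuation_set B" and x: "x \<notin> B"
begin

lemma B: "subring_set B" using VB by (simp add: valuation_set_def)

text \<open>The maximal ideal of B: \<open>inverse a \<notin> B\<close> already forces a into B,
  because B is a valuation ring.\<close>

definition nonunits :: "'k set" where "nonunits = {a. a = 0 \<or> inverse a \<notin> B}"

definition is_unit_B :: "'k \<Rightarrow> bool" where "is_unit_B a \<longleftrightarrow> a \<noteq> 0 \<and> a \<in> B \<and> inverse a \<in> B"

lemma nonunits_B: "a \<in> nonunits \<Longrightarrow> a \<in> B"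
  using VB subring_setD(1)[OF B] by (auto simp: nonunits_def valuation_set_def)

lemma nonunits_mult:
  assumes "a \<in> nonunits" "b \<in> B"
  shows "a * b \<in> nonunits"
proof (rule ccontr)
  assume "a * b \<notin> nonunits"
  hence "a \<noteq> 0" "b \<noteq> 0" "inverse (a * b) * b \<in> B"
    using assms subring_setD(4)[OF B] by (auto simp: nonunits_def)
  moreover from this have "inverse (a * b) * b = inverse a" by (simp add: field_simps)
  ultimately have "inverse a \<in> B" by metis
  thus False using assms(1) \<open>a \<noteq> 0\<close> by (auto simp: nonunits_def)
qed

text \<open>One of a / b and b / a lies in B, so the sum is a multiple of one of the
  summands.\<close>

lemma nonunits_add:
  assumes "a \<in> nonunits" "b \<in> nonunits"
  shows "a + b \<in> nonunits"
proof (cases "a = 0 \<or> b = 0")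
  case True
  thus ?thesis using assms by auto
next
  case False
  have one: "1 \<in> B" by (rule subring_setD[OF B])
  have "inverse (a / b) = b / a" by simp
  then consider "a / b \<in> B" | "b / a \<in> B" using VB unfolding valuation_set_def by metis
  thus ?thesis
  proof cases
    case 1
    hence "b * (a / b + 1) \<in> nonunits" by (intro nonunits_mult assms subring_setD[OF B] one)
    thus ?thesis using False by (simp add: algebra_simps)
  next
    case 2
    hence "a * (b / a + 1) \<in> nonunits" by (intro nonunits_mult assms subring_setD[OF B] one)
    thus ?thesis using False by (simp add: algebra_simps)
  qed
qed

lemma zero_nonunit: "0 \<in> nonunits"
  by (simp add: nonunits_def)

lemma nonunits_sum: "(\<And>i. i \<in> I \<Longrightarrow> f i \<in> nonunits) \<Longrightarrow> sum f I \<in> nonunits"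
  by (induction I rule: infinite_finite_induct) (auto intro: nonunits_add zero_nonunit)

lemma one_unit: "1 \<notin> nonunits"
  using subring_setD(2)[OF B] by (auto simp: nonunits_def)

lemma unit_mult: "is_unit_B a \<Longrightarrow> is_unit_B b \<Longrightarrow> is_unit_B (a * b)"
  by (auto simp: is_unit_B_def intro: subring_setD[OF B])

lemma unit_inverse: "is_unit_B a \<Longrightarrow> is_unit_B (inverse a)"
  by (auto simp: is_unit_B_def)

lemma unit_power: "is_unit_B a \<Longrightarrow> is_unit_B (a ^ n)"
  by (induction n) (auto intro: unit_mult simp: is_unit_B_def subring_setD[OF B])

lemma unit_iff: "is_unit_B a \<longleftrightarrow> a \<in> B \<and> a \<notin> nonunits"
  by (auto simp: is_unit_B_def nonunits_def)

text \<open>Otherwise every nonzero integer would be a unit of B, an integer equation for x could be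
  made monic over B, and integral closedness would put x into B.\<close>

lemma exists_nat_nonunit: "\<exists>n::nat. n > 0 \<and> inverse (of_nat n) \<notin> B"
proof (rule ccontr)
  assume "\<not> ?thesis"
  hence n: "inverse (of_nat n) \<in> B" if "n > 0" for n using that by blast
  have int: "inverse (of_int c) \<in> B" for c :: int
  proof (cases c rule: int_cases2)
    case (nonneg m)
    thus ?thesis using n[of m] subring_setD(1)[OF B] by (cases "m = 0") auto
  next
    case (nonpos m)
    hence "inverse (of_int c) = - inverse (of_nat m :: 'k)" by simp
    thus ?thesis using n[of m] subring_setD(1,5)[OF B] by (cases "m = 0") auto
  qed
  obtain P :: "int poly" where P: "P \<noteq> 0" "ipoly P x = 0"
    using number_field_int_poly[OF K] by blast
  define l :: 'k where "l = of_int (lead_coeff P)"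
  have l: "l \<noteq> 0" "inverse l \<in> B" using P by (auto simp: l_def int)
  define h where "h = Polynomial.smult (inverse l) (map_poly of_int P)"
  have "h \<in> polys_over B"
    by (auto simp: h_def polys_over_def coeff_map_poly intro!: subring_setD(4)[OF B] l subring_set_of_int B)
  moreover have "lead_coeff h = 1"
    using l by (simp add: h_def degree_map_poly coeff_map_poly l_def)
  moreover have "poly h x = 0" by (simp add: h_def P)
  ultimately show False using valuation_set_int_closed[OF VB] x by blast
qed

definition p :: nat where "p = (LEAST n::nat. n > 0 \<and> inverse (of_nat n) \<notin> B)"

abbreviation \<pi> :: 'k where "\<pi> \<equiv> of_nat p"

lemma p: "p > 0" "inverse \<pi> \<notin> B" "\<And>n. 0 < n \<Longrightarrow> n < p \<Longrightarrow> inverse (of_nat n) \<in> B"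
  using LeastI_ex[OF exists_nat_nonunit] not_less_Least[of _ "\<lambda>n. n > 0 \<and> inverse (of_nat n) \<notin> B"]
  unfolding p_def by blast+

lemma p_gt_1: "p > 1"
proof (rule ccontr)
  assume "\<not> p > 1"
  hence "p = 1" using p(1) by simp
  thus False using p(2) subring_setD(2)[OF B] by simp
qed

lemma pi_nonunit: "\<pi> \<in> nonunits" "\<pi> \<noteq> 0"
  using p by (auto simp: nonunits_def)

text \<open>Leastness of the residue characteristic p makes the remainder r of c, with 0 < r < p, a
  unit; c differs from r by a multiple of the nonunit p, so it is a unit too.\<close>

lemma unit_of_int:
  assumes "\<not> int p dvd c"
  shows "is_unit_B (of_int c)"
proof -
  define r where "r = c mod int p"
  have r: "0 < r" "r < int p" "c = c div int p * int p + r"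
    using assms p(1) by (auto simp: r_def dvd_eq_mod_eq_0 order.not_eq_order_implies_strict)
  have "inverse (of_nat (nat r)) \<in> B" by (rule p) (use r in auto)
  hence "of_int r \<notin> nonunits" using r by (simp add: nonunits_def)
  moreover have "of_int r = of_int c + \<pi> * (- of_int (c div int p))"
    by (subst r(3)) simp
  ultimately have "of_int c \<notin> nonunits"
    using nonunits_add nonunits_mult[OF pi_nonunit(1)] subring_set_of_int[OF B] subring_setD(5)[OF B]
    by metis
  thus ?thesis using unit_iff subring_set_of_int[OF B] by blast
qed

lemma int_valuation:
  fixes c :: int
  assumes "c \<noteq> 0"
  shows "\<exists>s::nat. is_unit_B (of_int c * inverse \<pi> ^ s)"
  using assms
proof (induction "nat \<bar>c\<bar>" arbitrary: c rule: less_induct)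
  case less
  show ?case
  proof (cases "int p dvd c")
    case True
    then obtain c' where c': "c = int p * c'" by (auto elim: dvdE)
    have "nat \<bar>c'\<bar> < nat \<bar>c\<bar>" using less.prems p_gt_1 by (auto simp: c' abs_mult)
    moreover have "c' \<noteq> 0" using less.prems c' by auto
    ultimately obtain s where "is_unit_B (of_int c' * inverse \<pi> ^ s)" using less.hyps by blast
    hence "is_unit_B (of_int c * inverse \<pi> ^ Suc s)" using pi_nonunit by (simp add: c' field_simps)
    thus ?thesis by blast
  next
    case False
    thus ?thesis using unit_of_int by (intro exI[of _ 0]) simp
  qed
qed

text \<open>Expresses that y has value r / k in the normalization where p has value 1: the k-th
  power of y and the r-th power of p differ by a unit.\<close>

definition val :: "'k \<Rightarrow> nat \<Rightarrow> int \<Rightarrow> bool" where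
  "val y k r \<longleftrightarrow> k > 0 \<and> is_unit_B (y ^ k * \<pi> powi (- r))"

text \<open>Divisibility in a valuation ring is total, so one of finitely many nonzero elements
  divides all the others; it is the term of least value.\<close>

lemma exists_dominant:
  assumes "finite J" "J \<noteq> {}" "\<And>i. i \<in> J \<Longrightarrow> \<tau> i \<noteq> 0"
  shows "\<exists>j\<in>J. \<forall>i\<in>J. \<tau> i / \<tau> j \<in> B"
  using assms
proof (induction rule: finite_ne_induct)
  case (singleton i)
  thus ?case using subring_setD(2)[OF B] by simp
next
  case (insert a J)
  then obtain j where j: "j \<in> J" "\<forall>i\<in>J. \<tau> i / \<tau> j \<in> B" by auto
  show ?case
  proof (cases "\<tau> a / \<tau> j \<in> B")
    case True
    thus ?thesis using j by auto
  next
    case False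
    have "inverse (\<tau> a / \<tau> j) = \<tau> j / \<tau> a" by simp
    hence ja: "\<tau> j / \<tau> a \<in> B" using False VB unfolding valuation_set_def by metis
    have "\<tau> i / \<tau> a \<in> B" if "i \<in> insert a J" for i
    proof (cases "i = a")
      case True
      thus ?thesis using insert.prems subring_setD(2)[OF B] by simp
    next
      case False
      hence "\<tau> i / \<tau> j * (\<tau> j / \<tau> a) \<in> B" using that j ja by (intro subring_setD[OF B]) auto
      thus ?thesis using j insert.prems by simp
    qed
    thus ?thesis by blast
  qed
qed

text \<open>
  In an integral equation for \<open>y\<close> two terms must have the same value; this makes some power of \<open>y\<close>
  equal to a power of \<open>p\<close> times a unit.
\<close>

lemma exists_val:
  assumes "y \<noteq> 0"
  shows "\<exists>k r. val y k r"
proof -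
  obtain P :: "int poly" where P: "P \<noteq> 0" "ipoly P y = 0"
    using number_field_int_poly[OF K] by blast
  define c where "c i = poly.coeff P i" for i
  define J where "J = {i. i \<le> degree P \<and> c i \<noteq> 0}"
  define \<tau> where "\<tau> i = of_int (c i) * y ^ i" for i
  have "J \<noteq> {}" using P by (auto simp: J_def c_def intro!: exI[of _ "degree P"])
  moreover have \<tau>: "\<tau> i \<noteq> 0" if "i \<in> J" for i using that assms by (auto simp: J_def \<tau>_def)
  moreover have fin: "finite J" by (simp add: J_def)
  ultimately obtain j where j: "j \<in> J" "\<forall>i\<in>J. \<tau> i / \<tau> j \<in> B"
    using exists_dominant[of J \<tau>] by blast
  have "(\<Sum>i\<in>J. \<tau> i) = (\<Sum>i\<le>degree P. \<tau> i)"
    by (rule sum.mono_neutral_left) (auto simp: J_def \<tau>_def)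
  also have "\<dots> = ipoly P y"
    by (simp add: poly_altdef degree_map_poly coeff_map_poly \<tau>_def c_def)
  finally have "(\<Sum>i\<in>J. \<tau> i) = 0" using P by simp
  hence "0 = (\<Sum>i\<in>J. \<tau> i / \<tau> j)" by (simp flip: sum_divide_distrib)
  also have "\<dots> = 1 + (\<Sum>i\<in>J - {j}. \<tau> i / \<tau> j)" using fin j \<tau> by (subst sum.remove[of _ j]) auto
  finally have s1: "(\<Sum>i\<in>J - {j}. \<tau> i / \<tau> j) = - 1" by (simp add: add_eq_0_iff)
  \<comment> \<open>The other quotients add up to the unit -1, so one of them is a unit: a second
    term has the same value as the dominant one.\<close>
  have "\<exists>i\<in>J - {j}. \<tau> i / \<tau> j \<notin> nonunits"
  proof (rule ccontr)
    assume "\<not> ?thesis"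
    hence "(\<Sum>i\<in>J - {j}. \<tau> i / \<tau> j) \<in> nonunits" by (intro nonunits_sum) auto
    hence "- 1 * - 1 \<in> nonunits" unfolding s1 by (rule nonunits_mult) (intro subring_setD[OF B])
    thus False using one_unit by simp
  qed
  then obtain i where i: "i \<in> J" "i \<noteq> j" "is_unit_B (\<tau> i / \<tau> j)"
    using j unit_iff by blast
  \<comment> \<open>Taking i > j makes the exponent i - j positive. The coefficients have values s
    and s', which leaves the value s' - s for \<open>y ^ (i - j)\<close>.\<close>
  have *: "\<exists>k r. val y k r" if ij: "i > j" "i \<in> J" "j \<in> J" "is_unit_B (\<tau> i / \<tau> j)" for i j
  proof -
    obtain s where s: "is_unit_B (of_int (c i) * inverse \<pi> ^ s)" using int_valuation ij by (auto simp: J_def)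
    obtain s' where s': "is_unit_B (of_int (c j) * inverse \<pi> ^ s')" using int_valuation ij by (auto simp: J_def)
    have nz: "c i \<noteq> 0" "c j \<noteq> 0" using ij by (auto simp: J_def)
    have "is_unit_B (\<tau> i / \<tau> j * (of_int (c j) * inverse \<pi> ^ s') * inverse (of_int (c i) * inverse \<pi> ^ s))"
      by (intro unit_mult unit_inverse s s' ij)
    also have "\<tau> i / \<tau> j * (of_int (c j) * inverse \<pi> ^ s') * inverse (of_int (c i) * inverse \<pi> ^ s)
        = y ^ i / y ^ j * (\<pi> ^ s / \<pi> ^ s')"
      using nz pi_nonunit assms by (simp add: \<tau>_def field_simps)
    also have "y ^ i / y ^ j = y ^ (i - j)" using ij assms by (simp add: power_diff)
    also have "\<pi> ^ s / \<pi> ^ s' = \<pi> powi (- (int s' - int s))"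
      using pi_nonunit by (simp add: power_int_diff)
    finally have "val y (i - j) (int s' - int s)" using ij by (simp add: val_def)
    thus ?thesis by blast
  qed
  show ?thesis
  proof (cases "i > j")
    case True
    thus ?thesis using * i j by blast
  next
    case False
    hence "j > i" using i by simp
    moreover have "is_unit_B (\<tau> j / \<tau> i)" using unit_inverse[OF i(3)] by simp
    ultimately show ?thesis using *[of i j] i j by blast
  qed
qed

lemma val_mult:
  assumes "val y k r" "val z l s"
  shows "val (y * z) (k * l) (r * int l + s * int k)"
proof -
  have "is_unit_B ((y ^ k * \<pi> powi (- r)) ^ l * (z ^ l * \<pi> powi (- s)) ^ k)"
    by (rule unit_mult[OF unit_power unit_power]) (use assms in \<open>auto simp: val_def\<close>)
  also have "(y ^ k * \<pi> powi (- r)) ^ l * (z ^ l * \<pi> powi (- s)) ^ k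
      = (y * z) ^ (k * l) * (\<pi> powi (- r * int l) * \<pi> powi (- s * int k))"
    unfolding power_int_mult power_int_of_nat
    by (simp add: power_mult_distrib mult_ac flip: power_mult)
  also have "\<pi> powi (- r * int l) * \<pi> powi (- s * int k) = \<pi> powi (- (r * int l + s * int k))"
    using pi_nonunit by (subst power_int_add[symmetric]) auto
  finally show ?thesis using assms by (simp add: val_def)
qed

lemma val_inverse: "val y k r \<Longrightarrow> val (inverse y) k (- r)"
  using unit_inverse[of "y ^ k * \<pi> powi (- r)"] by (auto simp: val_def power_inverse power_int_minus)

lemma pi_power_nonunit: "n > 0 \<Longrightarrow> \<pi> ^ n \<in> nonunits"
  using nonunits_mult[OF pi_nonunit(1) subring_set_power[OF B nonunits_B[OF pi_nonunit(1)]], of "n - 1"]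
  by (cases n) auto

lemma val_one:
  assumes "val 1 k r"
  shows "r = 0"
proof (rule ccontr)
  assume "r \<noteq> 0"
  have u: "is_unit_B (\<pi> powi (- r))" using assms by (simp add: val_def)
  have "is_unit_B (\<pi> ^ nat \<bar>r\<bar>)"
  proof (cases "r > 0")
    case True
    thus ?thesis using unit_inverse[OF u] by (simp add: power_int_minus power_int_def power_inverse)
  next
    case False
    thus ?thesis using u by (simp add: power_int_def)
  qed
  moreover have "\<pi> ^ nat \<bar>r\<bar> \<in> nonunits" using \<open>r \<noteq> 0\<close> by (intro pi_power_nonunit) simp
  ultimately show False by (simp add: unit_iff)
qed

lemma val_nonzero: "val y k r \<Longrightarrow> y \<noteq> 0"
  by (auto simp: val_def is_unit_B_def power_0_left)

lemma val_unique:
  assumes "val y k r" "val y l s"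
  shows "real_of_int r / real k = real_of_int s / real l"
proof -
  have "val (y * inverse y) (k * l) (r * int l + (- s) * int k)"
    by (rule val_mult[OF assms(1) val_inverse[OF assms(2)]])
  hence "r * int l + (- s) * int k = 0" 
    using val_one[of "k * l" "r * int l + (- s) * int k"] val_nonzero[OF assms(1)] by simp
  hence "real_of_int (r * int l) = real_of_int (s * int k)" by simp
  thus ?thesis using assms by (simp add: val_def field_simps)
qed

lemma val_nonneg_iff:
  assumes "val y k r"
  shows "y \<in> B \<longleftrightarrow> 0 \<le> r"
proof
  assume y: "y \<in> B"
  show "0 \<le> r"
  proof (rule ccontr)
    assume r: "\<not> 0 \<le> r"
    hence "y ^ k * \<pi> powi (- r) = \<pi> ^ nat (- r) * y ^ k" by (simp add: power_int_def)
    also have "\<dots> \<in> nonunits" using r by (intro nonunits_mult pi_power_nonunit subring_set_power B y) simp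
    finally show False using assms by (simp add: val_def unit_iff)
  qed
next
  assume r: "0 \<le> r"
  have k: "k > 0" and u: "is_unit_B (y ^ k * \<pi> powi (- r))" using assms by (auto simp: val_def)
  show "y \<in> B"
  proof (rule ccontr)
    assume y: "y \<notin> B"
    hence iy: "inverse y \<in> B" and y0: "y \<noteq> 0"
      using VB subring_setD(1)[OF B] by (auto simp: valuation_set_def)
    have "y ^ k = (y ^ k * \<pi> powi (- r)) * \<pi> ^ nat r"
      using r pi_nonunit by (simp add: power_int_minus power_int_def power_inverse)
    also have "\<dots> \<in> B"
      by (rule subring_setD(4)[OF B _ subring_set_power[OF B nonunits_B[OF pi_nonunit(1)]]])
        (use u in \<open>simp add: unit_iff\<close>)
    \<comment> \<open>Once \<open>y ^ k\<close> is in B, k - 1 factors 1 / y bring y itself back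
      into B.\<close>
    finally have "y ^ k * inverse y ^ (k - 1) \<in> B"
      by (rule subring_setD(4)[OF B _ subring_set_power[OF B iy]])
    moreover have "y ^ k * inverse y ^ (k - 1) = y" using k y0 by (cases k) (simp_all add: field_simps)
    ultimately show False using y by simp
  qed
qed

definition ord_B :: "'k \<Rightarrow> real" where
  "ord_B y = (case (SOME (k, r). val y k r) of (k, r) \<Rightarrow> real_of_int r / real k)"

lemma ord_B_eq:
  assumes "val y k r"
  shows "ord_B y = real_of_int r / real k"
proof -
  have "case (SOME (k, r). val y k r) of (k, r) \<Rightarrow> val y k r"
    by (rule someI[of "\<lambda>(k, r). val y k r" "(k, r)"]) (use assms in simp)
  thus ?thesis unfolding ord_B_def using val_unique[OF assms] by (auto split: prod.splits)
qed

lemma ord_B_mult: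
  assumes "y \<noteq> 0" "z \<noteq> 0"
  shows "ord_B (y * z) = ord_B y + ord_B z"
proof -
  obtain k r l s where *: "val y k r" "val z l s" using exists_val assms by blast
  moreover from * have "k > 0" "l > 0" by (auto simp: val_def)
  ultimately show ?thesis by (simp add: ord_B_eq[OF *(1)] ord_B_eq[OF *(2)] ord_B_eq[OF val_mult[OF *]] add_divide_distrib)
qed

lemma ord_B_nonneg_iff: "y \<noteq> 0 \<Longrightarrow> 0 \<le> ord_B y \<longleftrightarrow> y \<in> B"
proof -
  assume "y \<noteq> 0"
  then obtain k r where v: "val y k r" using exists_val by blast
  hence "k > 0" by (simp add: val_def)
  thus ?thesis using val_nonneg_iff[OF v] by (simp add: ord_B_eq[OF v] zero_le_divide_iff)
qed

text \<open>Any base above 1 would define the same place as the base 2.\<close>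

definition absval_B :: "'k \<Rightarrow> real" where
  "absval_B y = (if y = 0 then 0 else 2 powr (- ord_B y))"

lemma absval_B_mult: "absval_B (y * z) = absval_B y * absval_B z"
  by (simp add: absval_B_def ord_B_mult powr_add powr_diff powr_minus field_simps)

lemma absval_B_le_1_iff: "absval_B y \<le> 1 \<longleftrightarrow> y \<in> B"
proof (cases "y = 0")
  case True
  thus ?thesis using subring_setD(1)[OF B] by (simp add: absval_B_def)
next
  case False
  have "absval_B y \<le> 2 powr 0 \<longleftrightarrow> 0 \<le> ord_B y"
    using False by (simp only: absval_B_def if_False powr_le_cancel_iff) simp
  thus ?thesis using ord_B_nonneg_iff[OF False] by simp
qed

text \<open>Division by z reduces the ultrametric inequality to the fact that y / z + 1 stays in the
  ring B.\<close>

lemma absval_B_add_le: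
  assumes "absval_B y \<le> absval_B z" "z \<noteq> 0"
  shows "absval_B (y + z) \<le> absval_B z"
proof -
  have z: "absval_B z > 0" using assms by (simp add: absval_B_def)
  have "absval_B (y / z) * absval_B z = absval_B y"
    using assms(2) by (simp flip: absval_B_mult)
  hence "absval_B (y / z) * absval_B z \<le> 1 * absval_B z" using assms(1) by simp
  hence "absval_B (y / z) \<le> 1" using z by (rule mult_right_le_imp_le)
  hence "absval_B (y / z + 1) \<le> 1"
    unfolding absval_B_le_1_iff by (intro subring_setD[OF B])
  hence "absval_B (y / z + 1) * absval_B z \<le> 1 * absval_B z" by (rule mult_right_mono) (use z in simp)
  also have "absval_B (y / z + 1) * absval_B z = absval_B (y + z)"
    using assms(2) by (simp add: distrib_right flip: absval_B_mult)
  finally show ?thesis by simp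
qed

lemma nonarch_B: "nonarch_absval absval_B"
proof -
  have "absval_B (y + z) \<le> max (absval_B y) (absval_B z)" for y z
  proof (cases "y = 0 \<or> z = 0")
    case True
    thus ?thesis by auto
  next
    case False
    show ?thesis
    proof (cases "absval_B y \<le> absval_B z")
      case True
      thus ?thesis using absval_B_add_le[of y z] False by auto
    next
      case F: False
      thus ?thesis using absval_B_add_le[of z y] False by (auto simp: add.commute)
    qed
  qed
  moreover have "\<exists>x. x \<noteq> 0 \<and> absval_B x \<noteq> 1"
    using x absval_B_le_1_iff[of x] subring_setD(1)[OF B] by (metis order.refl)
  ultimately show ?thesis
    unfolding nonarch_absval_def using absval_B_mult by (simp add: absval_B_def)
qed

end

text \<open>A relation x = h(1 / x) over the integers, multiplied by \<open>x ^ n\<close>, would be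
  a monic integer equation for x. So x is missing from Z[1/x], and a valuation ring that contains
  Z[1/x] but not x yields the absolute value.\<close>

lemma exists_absval_gt_1:
  fixes x :: "'k::field_char_0"
  assumes "number_field TYPE('k)" "\<not> algebraic_int x"
  shows "\<exists>v. nonarch_absval v \<and> v x > 1"
proof -
  let ?Z = "range of_int :: 'k set"
  have Z: "subring_set ?Z"
    unfolding subring_set_def
    by (auto simp flip: of_int_add of_int_mult of_int_minus)
  have x0: "x \<noteq> 0" using assms by auto
  have "x \<notin> adjoin ?Z (inverse x)"
  proof
    assume "x \<in> adjoin ?Z (inverse x)"
    then obtain h where h: "h \<in> polys_over ?Z" "x = poly h (inverse x)" by (auto simp: adjoin_def)
    define n where "n = degree h"
    define g where "g = Polynomial.monom 1 (Suc n) - reflect_poly h"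
    have dr: "degree (reflect_poly h) < Suc n"
      using degree_reflect_poly_le[of h] by (simp add: n_def)
    have "poly (reflect_poly h) x = x ^ n * poly h (inverse x)"
      unfolding n_def by (rule poly_reflect_poly_nz[OF x0])
    hence "poly g x = 0" using h(2) by (simp add: g_def poly_monom)
    moreover have "degree g = Suc n"
      unfolding g_def diff_conv_add_uminus
      by (subst degree_add_eq_left) (use dr in \<open>simp_all add: degree_monom_eq\<close>)
    moreover from this have "lead_coeff g = 1"
      using dr by (simp add: g_def coeff_eq_0)
    moreover have "poly.coeff g i \<in> \<int>" for i
      using h(1) by (auto simp: g_def coeff_reflect_poly polys_over_def Ints_def[symmetric] intro!: Ints_diff)
    ultimately have "algebraic_int x" by (intro algebraic_int.intros[of g]) simp_all
    thus False using assms(2) by simp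
  qed
  then obtain B where "valuation_set B" "x \<notin> B"
    using exists_valuation_set_avoiding[OF adjoin_subring[OF Z] adjoin_generator[OF Z]] by blast
  then interpret number_field_valuation B x using assms by unfold_locales
  show ?thesis using nonarch_B absval_B_le_1_iff[of x] \<open>x \<notin> B\<close> by (metis not_le)
qed

section \<open>Places of a number field\<close>

lemma nonarchD:
  assumes "nonarch_absval v"
  shows "0 \<le> v x" "v x = 0 \<longleftrightarrow> x = 0" "v (x * y) = v x * v y" "v (x + y) \<le> max (v x) (v y)" "v 0 = 0"
  using assms by (auto simp: nonarch_absval_def)

lemma nonarch_pos: "nonarch_absval v \<Longrightarrow> x \<noteq> 0 \<Longrightarrow> 0 < v x"
  using nonarchD(1,2)[of v x] by simp

lemma nonarch_one:
  assumes "nonarch_absval v"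
  shows "v 1 = 1"
proof -
  have "v 1 * v 1 = 1 * v 1" using nonarchD(3)[OF assms, of 1 1] by simp
  thus ?thesis using nonarchD(2)[OF assms, of 1] by simp
qed

lemma nonarch_power: "nonarch_absval v \<Longrightarrow> v (x ^ n) = v x ^ n"
  by (induction n) (simp_all add: nonarch_one nonarchD)

lemma nonarch_minus:
  assumes "nonarch_absval v"
  shows "v (- x) = v x"
proof -
  have "v (-1) ^ 2 = 1" using nonarch_power[OF assms, of "-1" 2] assms by (simp add: nonarch_one)
  hence "v (-1) = 1" using nonarchD(1)[OF assms, of "-1"] by (simp add: power2_eq_1_iff)
  thus ?thesis using nonarchD(3)[OF assms, of "-1" x] by simp
qed

lemma nonarch_inverse:
  assumes "nonarch_absval v"
  shows "v (inverse x) = inverse (v x)"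
proof (cases "x = 0")
  case False
  hence "v x * v (inverse x) = 1"
    using assms by (simp flip: nonarchD(3) add: nonarch_one)
  thus ?thesis by (metis inverse_unique)
qed (use assms in \<open>simp add: nonarchD\<close>)

lemma nonarch_divide: "nonarch_absval v \<Longrightarrow> v (x / y) = v x / v y"
  by (simp add: divide_inverse nonarchD nonarch_inverse)

lemma nonarch_powi: "nonarch_absval v \<Longrightarrow> v (x powi r) = v x powi r"
  by (simp add: power_int_def nonarch_power nonarch_inverse)

lemma nonarch_diff: "nonarch_absval v \<Longrightarrow> v (x - y) \<le> max (v x) (v y)"
  using nonarchD(4)[of v x "- y"] nonarch_minus[of v y] by simp

lemma nonarch_add_eq:
  assumes "nonarch_absval v" "v x < v y"
  shows "v (x + y) = v y"
proof (rule antisym)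
  show "v (x + y) \<le> v y" using nonarchD(4)[OF assms(1), of x y] assms(2) by simp
  have "v (x + y - x) \<le> max (v (x + y)) (v x)" by (rule nonarch_diff[OF assms(1)])
  thus "v y \<le> v (x + y)" using assms(2) by auto
qed

lemma nonarch_sum_le:
  assumes "nonarch_absval v" "C \<ge> 0" "\<And>i. i \<in> I \<Longrightarrow> v (f i) \<le> C"
  shows "v (sum f I) \<le> C"
  using assms(3)
proof (induction I rule: infinite_finite_induct)
  case (insert i I)
  hence "v (f i) \<le> C" "v (sum f I) \<le> C" by auto
  hence "v (f i + sum f I) \<le> C"
    using nonarchD(4)[OF assms(1), of "f i" "sum f I"] by (simp add: max_def split: if_splits)
  thus ?case using insert.hyps by simp
qed (use assms in \<open>simp_all add: nonarchD\<close>)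

lemma nonarch_sum_less:
  assumes "nonarch_absval v" "C > 0" "\<And>i. i \<in> I \<Longrightarrow> v (f i) < C"
  shows "v (sum f I) < C"
  using assms(3)
proof (induction I rule: infinite_finite_induct)
  case (insert i I)
  hence "v (f i) < C" "v (sum f I) < C" by auto
  hence "v (f i + sum f I) < C"
    using nonarchD(4)[OF assms(1), of "f i" "sum f I"] by (simp add: max_def split: if_splits)
  thus ?case using insert.hyps by simp
qed (use assms in \<open>simp_all add: nonarchD\<close>)

lemma nonarch_of_nat: "nonarch_absval v \<Longrightarrow> v (of_nat n) \<le> 1"
proof (induction n)
  case (Suc n)
  thus ?case
    using nonarchD(4)[OF Suc.prems, of 1 "of_nat n"]
    by (simp add: nonarch_one max_def split: if_splits)
qed (simp add: nonarchD)

lemma nonarch_of_int: "nonarch_absval v \<Longrightarrow> v (of_int n) \<le> 1"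
  by (cases n rule: int_cases2) (simp_all add: nonarch_of_nat nonarch_minus)

section \<open>Independence and finiteness of the absolute values above a prime\<close>

lemma nonarch_int_unit:
  assumes v: "nonarch_absval v" "v (of_nat p) < 1" and p: "prime p" "\<not> int p dvd n"
  shows "v (of_int n) = 1"
proof -
  have "coprime n (int p)"
    using p by (metis coprime_commute prime_imp_coprime prime_nat_int_transfer)
  then obtain a b where "a * n + b * int p = 1" using bezout_int[of n "int p"] by auto
  hence "(of_int (a * n + b * int p) :: 'a) = 1" by simp
  hence e: "(of_int a * of_int n + of_int b * of_nat p :: 'a) = 1" by simp
  have "1 \<le> max (v (of_int a) * v (of_int n)) (v (of_int b) * v (of_nat p))"
    using nonarchD(4)[OF v(1), of "of_int a * of_int n" "of_int b * of_nat p"] v(1)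
    unfolding e by (simp add: nonarchD nonarch_one)
  moreover have "v (of_int b) * v (of_nat p) \<le> 1 * v (of_nat p)"
    by (intro mult_right_mono nonarch_of_int nonarchD v)
  moreover have "v (of_int a) * v (of_int n) \<le> 1 * v (of_int n)"
    by (intro mult_right_mono nonarch_of_int nonarchD v)
  ultimately have "1 \<le> v (of_int n)" using v(2) by auto
  thus ?thesis using nonarch_of_int[OF v(1), of n] by simp
qed

text \<open>Both restrict to the p-adic absolute value on Q: an integer is a power of p times a
  factor prime to p, and that factor is a unit.\<close>

lemma nonarch_agree_rat:
  fixes v w :: "'k::field_char_0 \<Rightarrow> real"
  assumes v: "nonarch_absval v" "v (of_nat p) = 1 / real p" and w: "nonarch_absval w" "w (of_nat p) = 1 / real p"
    and p: "prime p"
  shows "v (of_rat c) = w (of_rat c)"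
proof -
  have p1: "1 / real p < 1" using prime_gt_1_nat[OF p] by simp
  have int: "v (of_int n) = w (of_int n)" for n
  proof (cases "n = 0")
    case True
    thus ?thesis using v w by (simp add: nonarchD)
  next
    case False
    obtain m where m: "n = int p ^ multiplicity (int p) n * m" "\<not> int p dvd m"
      using multiplicity_decompose'[of n "int p"] False p prime_gt_1_nat[OF p] by auto
    have u: "u (of_int n) = (1 / real p) ^ multiplicity (int p) n"
      if "nonarch_absval u" "u (of_nat p) = 1 / real p" for u :: "'k \<Rightarrow> real"
    proof -
      have "u (of_int m) = 1" by (rule nonarch_int_unit[OF that(1) _ p m(2)]) (use that p1 in simp)
      moreover have "(of_int n :: 'k) = of_nat p ^ multiplicity (int p) n * of_int m"
        by (subst m(1)) simp
      ultimately show ?thesis using that by (simp add: nonarchD nonarch_power)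
    qed
    show ?thesis using u[OF v] u[OF w] by simp
  qed
  obtain a b where "c = of_int a / of_int b" by (cases c) (auto simp: Fract_of_int_quotient)
  thus ?thesis using int v(1) w(1) by (simp add: of_rat_divide nonarch_divide)
qed

lemma powi_between:
  fixes P c :: real
  assumes "P > 1" "c > 0"
  shows "\<exists>r::int. c < P powi r \<and> P powi r \<le> P * c"
proof -
  define r where "r = \<lfloor>log P c\<rfloor> + 1"
  have e: "P powi r = P powr real_of_int r" using assms by (simp add: powr_real_of_int')
  have "log P c < real_of_int r" "real_of_int r \<le> log P c + 1" unfolding r_def by linarith+
  hence "c < P powr real_of_int r" "P powr real_of_int r \<le> P * c"
    using assms by (simp_all add: log_less_iff[symmetric] le_log_iff[symmetric] log_mult)
  thus ?thesis unfolding e[symmetric] by blast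
qed

text \<open>If \<open>w y < v y\<close>, a high power of y makes the quotient of the two values
  exceed p. Powers of p have the same size under v and w, so multiplying by a suitable one moves the
  value 1 between the two.\<close>

lemma separating_pair:
  assumes v: "nonarch_absval v" "v (of_nat p) = 1 / real p" and w: "nonarch_absval w" "w (of_nat p) = 1 / real p"
    and p: "prime p" and "v \<noteq> w"
  shows "\<exists>z. v z > 1 \<and> w z < 1"
proof -
  obtain y0 where y0: "v y0 \<noteq> w y0" using \<open>v \<noteq> w\<close> by blast
  hence y00: "y0 \<noteq> 0" using v w by (auto simp: nonarchD)
  obtain y where y: "y \<noteq> 0" "w y < v y"
  proof (cases "w y0 < v y0")
    case True
    thus ?thesis using that y00 by blast
  next
    case False
    hence "w (inverse y0) < v (inverse y0)"
      using y0 y00 v w by (auto simp: nonarch_inverse nonarch_pos)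
    thus ?thesis using that[of "inverse y0"] y00 by simp
  qed
  define P where "P = real p"
  have P: "P > 1" using prime_gt_1_nat[OF p] by (simp add: P_def)
  have pos: "w y > 0" "v y > 0" using y v w nonarch_pos by blast+
  obtain k where "P < (v y / w y) ^ k" using real_arch_pow[of "v y / w y" P] y pos by (auto simp: field_simps)
  hence k: "P * w y ^ k < v y ^ k" using pos by (simp add: power_divide field_simps)
  obtain r where r: "w y ^ k < P powi r" "P powi r \<le> P * w y ^ k"
    using powi_between[OF P, of "w y ^ k"] pos by auto
  define z where "z = y ^ k * of_nat p powi r"
  have e: "u z = u y ^ k / P powi r" if "nonarch_absval u" "u (of_nat p) = 1 / real p" for u
    using that by (simp add: z_def nonarchD nonarch_power nonarch_powi P_def
        power_int_divide_distrib)
  have "P powi r > 0" using P by simp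
  thus ?thesis using e[OF v] e[OF w] r k by (intro exI[of _ z]) (simp add: field_simps)
qed

text \<open>Weak approximation by induction: z works for W and y for the new u. If
  \<open>u z \<le> 1\<close>, then \<open>z ^ n * y\<close> works for large n; otherwise
  \<open>z ^ n\<close> would spoil u and is replaced by a factor that tends to 1 there.\<close>

lemma separating_element:
  assumes "finite W" "nonarch_absval v" "\<And>w. w \<in> W \<Longrightarrow> nonarch_absval w"
    and "\<And>w. w \<in> W \<Longrightarrow> \<exists>z. v z > 1 \<and> w z < 1"
  shows "\<exists>z. v z > 1 \<and> (\<forall>w\<in>W. w z < 1)"
  using assms
proof (induction W rule: finite_induct)
  case empty
  obtain x where x: "x \<noteq> 0" "v x \<noteq> 1" using empty(1) by (auto simp: nonarch_absval_def)
  show ?case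
  proof (cases "v x > 1")
    case False
    hence "v (inverse x) > 1"
      using x nonarch_pos[OF empty(1) x(1)] empty(1) by (simp add: nonarch_inverse one_less_inverse)
    thus ?thesis by auto
  qed auto
next
  case (insert u W)
  note v = insert.prems(1)
  obtain z where z: "v z > 1" "\<forall>w\<in>W. w z < 1" using insert by auto
  obtain y where y: "v y > 1" "u y < 1" using insert.prems(3)[of u] by auto
  have "\<forall>\<^sub>F n in sequentially. \<forall>w\<in>W. w z ^ n * w y < 1"
  proof (rule eventually_ball_finite[OF insert.hyps(1)], rule ballI)
    fix w assume w: "w \<in> W"
    hence "(\<lambda>n. w z ^ n) \<longlonglongrightarrow> 0"
      using z insert.prems(2)[of w] by (intro LIMSEQ_power_zero) (auto simp: nonarchD)
    hence "(\<lambda>n. w z ^ n * w y) \<longlonglongrightarrow> 0" by (rule tendsto_mult_left_zero)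
    thus "\<forall>\<^sub>F n in sequentially. w z ^ n * w y < 1" by (rule order_tendstoD) simp
  qed
  moreover have "\<forall>\<^sub>F n in sequentially. n \<ge> (1::nat)" by (rule eventually_ge_at_top)
  ultimately have "\<forall>\<^sub>F n in sequentially. n \<ge> 1 \<and> (\<forall>w\<in>W. w z ^ n * w y < 1)"
    by (rule eventually_conj[rotated])
  then obtain n where n: "n \<ge> 1" "\<forall>w\<in>W. w z ^ n * w y < 1"
    using eventually_happens trivial_limit_sequentially by blast
  have nu: "nonarch_absval u" and nw: "\<And>w. w \<in> W \<Longrightarrow> nonarch_absval w" using insert.prems by auto
  have vz: "1 < v z ^ n" using z n by (intro one_less_power) auto
  show ?case
  proof (cases "u z \<le> 1")
    case True
    have "v (z ^ n * y) > 1"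
      using vz y v by (simp add: nonarchD nonarch_power less_1_mult)
    moreover have "u (z ^ n * y) < 1"
    proof -
      have "u z ^ n \<le> 1" using True nu by (simp add: power_le_one nonarchD)
      hence "u z ^ n * u y \<le> 1 * u y" using nu by (intro mult_right_mono) (auto simp: nonarchD)
      thus ?thesis using y nu by (simp add: nonarchD nonarch_power)
    qed
    moreover have "\<forall>w\<in>W. w (z ^ n * y) < 1"
      using n nw by (simp add: nonarchD nonarch_power)
    ultimately show ?thesis by blast
  next
    case False
    text \<open>\<open>z\<^sup>n / (1 + z\<^sup>n)\<close> has value 1 where \<open>z\<close> is large and is as small as \<open>z\<^sup>n\<close> where \<open>z\<close> is small.\<close>
    define s where "s = z ^ n / (1 + z ^ n) * y"
    have large: "t s = t y" if t: "nonarch_absval t" "t z > 1" for t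
    proof -
      have g: "1 < t z ^ n" using t n by (intro one_less_power) auto
      hence "t (1 + z ^ n) = t z ^ n"
        using t by (subst nonarch_add_eq) (simp_all add: nonarch_one nonarch_power)
      moreover have "z \<noteq> 0" using t by (auto simp: nonarchD)
      ultimately show ?thesis
        using t by (simp add: s_def nonarchD nonarch_divide nonarch_power)
    qed
    have z0: "z \<noteq> 0" using z(1) v by (auto simp: nonarchD)
    have "\<forall>w\<in>W. w s < 1"
    proof
      fix w assume w: "w \<in> W"
      have "w z ^ n < 1"
        using z n w nw[OF w] power_Suc_less_one[of "w z" "n - 1"] z0 nonarch_pos[OF nw[OF w] z0]
        by simp
      hence "w (z ^ n + 1) = 1"
        using nw[OF w] by (subst nonarch_add_eq) (simp_all add: nonarch_one nonarch_power)
      hence "w s = w z ^ n * w y"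
        using nw[OF w] by (simp add: s_def nonarchD nonarch_divide nonarch_power add.commute)
      thus "w s < 1" using n w by simp
    qed
    thus ?thesis using large[OF v z(1)] large[OF nu] False y by (intro exI[of _ s]) auto
  qed
qed

text \<open>Elements \<open>z v\<close> that are large at v and small at all other members of W are
  independent over Q. In a relation, choose u so that the coefficient of \<open>z u\<close> is of
  largest absolute value, which is measured equally by all members; under u the term of
  \<open>z u\<close> then exceeds all the others.\<close>

lemma card_absvals_le:
  fixes W :: "('k::field_char_0 \<Rightarrow> real) set"
  assumes K: "number_field TYPE('k)" and W: "finite W" "\<And>v. v \<in> W \<Longrightarrow> nonarch_absval v"
    and agree: "\<And>v w c. v \<in> W \<Longrightarrow> w \<in> W \<Longrightarrow> v (of_rat c) = w (of_rat c)"
    and sep: "\<And>v w. v \<in> W \<Longrightarrow> w \<in> W \<Longrightarrow> v \<noteq> w \<Longrightarrow> \<exists>z. v z > 1 \<and> w z < 1"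
  shows "card W \<le> card (rat_basis TYPE('k))"
proof (rule ccontr)
  assume contra: "\<not> ?thesis"
  have "\<exists>z. v z > 1 \<and> (\<forall>w\<in>W - {v}. w z < 1)" if "v \<in> W" for v
    by (rule separating_element) (use that W sep in auto)
  then obtain z where z: "\<And>v. v \<in> W \<Longrightarrow> v (z v) > 1" "\<And>v w. v \<in> W \<Longrightarrow> w \<in> W \<Longrightarrow> v \<noteq> w \<Longrightarrow> w (z v) < 1"
    by (metis DiffI singletonD)
  obtain c :: "('k \<Rightarrow> real) \<Rightarrow> rat" where c: "\<exists>v\<in>W. c v \<noteq> 0" "(\<Sum>v\<in>W. of_rat (c v) * z v) = 0"
    using number_field_dependent[OF K W(1), of z] contra by auto
  define J where "J = {v\<in>W. c v \<noteq> 0}"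
  have J: "finite J" "J \<noteq> {}" using c W by (auto simp: J_def)
  define \<mu> where "\<mu> v = v (of_rat (c v))" for v
  obtain u where u: "u \<in> J" "\<And>v. v \<in> J \<Longrightarrow> \<mu> v \<le> \<mu> u"
  proof -
    have "Max (\<mu> ` J) \<in> \<mu> ` J" using J by simp
    then obtain u where "u \<in> J" "\<mu> u = Max (\<mu> ` J)" by auto
    thus ?thesis using that J Max_ge[of "\<mu> ` J"] by simp
  qed
  have uW: "u \<in> W" "nonarch_absval u" using u W by (auto simp: J_def)
  have \<mu>pos: "\<mu> u > 0"
    unfolding \<mu>_def by (rule nonarch_pos[OF uW(2)]) (use u in \<open>simp add: J_def\<close>)
  have "u (\<Sum>v\<in>J - {u}. of_rat (c v) * z v) < \<mu> u"
  proof (rule nonarch_sum_less[OF uW(2) \<mu>pos])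
    fix v assume v: "v \<in> J - {u}"
    hence vW: "v \<in> W" "v \<noteq> u" by (auto simp: J_def)
    have e: "u (of_rat (c v)) = \<mu> v" using agree[OF uW(1) vW(1)] by (simp add: \<mu>_def)
    have "\<mu> v > 0"
      unfolding \<mu>_def by (rule nonarch_pos[OF W(2)[OF vW(1)]]) (use v in \<open>simp add: J_def\<close>)
    hence "\<mu> v * u (z v) < \<mu> v * 1" using z(2)[OF vW(1) uW(1) vW(2)] by (intro mult_strict_left_mono)
    also have "\<dots> \<le> \<mu> u" using u v by simp
    finally show "u (of_rat (c v) * z v) < \<mu> u" using uW e by (simp add: nonarchD)
  qed
  moreover have "(\<Sum>v\<in>J - {u}. of_rat (c v) * z v) = - (of_rat (c u) * z u)"
  proof -
    have "(\<Sum>v\<in>W. of_rat (c v) * z v) = (\<Sum>v\<in>J. of_rat (c v) * z v)"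
      by (rule sum.mono_neutral_right) (auto simp: J_def W)
    also have "\<dots> = of_rat (c u) * z u + (\<Sum>v\<in>J - {u}. of_rat (c v) * z v)"
      by (rule sum.remove) (use J u in auto)
    finally show ?thesis using c(2) by (simp add: eq_neg_iff_add_eq_0 add.commute)
  qed
  ultimately have "\<mu> u * u (z u) < \<mu> u * 1"
    using uW by (simp add: nonarch_minus nonarchD \<mu>_def)
  thus False using \<mu>pos z(1)[OF uW(1)] by (simp add: mult_less_cancel_left)
qed

section \<open>Places as equivalence classes, and how many there are above a prime\<close>

lemma equiv_absval_equiv: "equiv {v :: 'k::field \<Rightarrow> real. nonarch_absval v} absval_equiv"
proof (rule equivI)
  show "absval_equiv \<subseteq> {v :: 'k \<Rightarrow> real. nonarch_absval v} \<times> {v. nonarch_absval v}"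
    by (auto simp: absval_equiv_def)
  show "refl_on {v :: 'k \<Rightarrow> real. nonarch_absval v} absval_equiv"
    by (rule refl_onI) (auto simp: absval_equiv_def nonarchD intro!: exI[of _ 1])
  show "sym (absval_equiv :: (('k \<Rightarrow> real) \<times> _) set)"
  proof (rule symI)
    fix v w :: "'k \<Rightarrow> real" assume "(v, w) \<in> absval_equiv"
    then obtain s where s: "nonarch_absval v" "nonarch_absval w" "s > 0" "\<forall>x. w x = v x powr s"
      by (auto simp: absval_equiv_def)
    hence "\<forall>x. v x = w x powr (1 / s)" by (simp add: powr_powr nonarchD)
    thus "(w, v) \<in> absval_equiv" using s by (auto simp: absval_equiv_def intro!: exI[of _ "1 / s"])
  qed
  show "trans (absval_equiv :: (('k \<Rightarrow> real) \<times> _) set)"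
  proof (rule transI)
    fix u v w :: "'k \<Rightarrow> real" assume "(u, v) \<in> absval_equiv" "(v, w) \<in> absval_equiv"
    then obtain s t where s: "nonarch_absval u" "nonarch_absval w" "s > 0" "t > 0"
      "\<forall>x. v x = u x powr s" "\<forall>x. w x = v x powr t"
      by (auto simp: absval_equiv_def)
    hence "\<forall>x. w x = u x powr (s * t)" by (simp add: powr_powr)
    thus "(u, w) \<in> absval_equiv" using s by (auto simp: absval_equiv_def intro!: exI[of _ "s * t"])
  qed
qed

lemma nonarch_powr:
  assumes v: "nonarch_absval v" and s: "s > 0"
  shows "nonarch_absval (\<lambda>x. v x powr s)"
  unfolding nonarch_absval_def
proof (intro conjI allI)
  fix x y
  show "v x powr s = 0 \<longleftrightarrow> x = 0" using v by (simp add: nonarchD)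
  show "v (x * y) powr s = v x powr s * v y powr s" using v by (simp add: nonarchD powr_mult)
  have "v (x + y) powr s \<le> max (v x) (v y) powr s"
    using v s by (intro powr_mono2) (auto simp: nonarchD)
  also have "\<dots> \<le> max (v x powr s) (v y powr s)" by (auto simp: max_def)
  finally show "v (x + y) powr s \<le> max (v x powr s) (v y powr s)" .
next
  obtain x where "x \<noteq> 0" "v x \<noteq> 1" using v by (auto simp: nonarch_absval_def)
  moreover from this have "v x powr s \<noteq> 1"
    using s nonarch_pos[OF v, of x] by (simp add: powr_eq_one_iff_gen)
  ultimately show "\<exists>x. x \<noteq> 0 \<and> v x powr s \<noteq> 1" by blast
qed auto

lemma nonarch_placeD:
  assumes "V \<in> nonarch_places" "v \<in> V"
  shows "nonarch_absval v" "V = absval_equiv `` {v}"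
proof -
  obtain u where u: "nonarch_absval u" "V = absval_equiv `` {u}"
    using assms(1) by (auto simp: nonarch_places_def quotient_def)
  hence uv: "(u, v) \<in> absval_equiv" using assms by auto
  thus "nonarch_absval v" by (auto simp: absval_equiv_def)
  show "V = absval_equiv `` {v}" unfolding u(2) by (rule equiv_class_eq[OF equiv_absval_equiv uv])
qed

lemma nonarch_placeI:
  assumes "nonarch_absval v"
  shows "absval_equiv `` {v} \<in> nonarch_places" "v \<in> absval_equiv `` {v}"
  using assms equiv_class_self[OF equiv_absval_equiv] by (auto simp: nonarch_places_def intro: quotientI)

text \<open>Each such place has a representative with v(p) = 1 / p, obtained by raising to the power
  s with v(p)^s = 1 / p. Normalized in this way the representatives agree on Q, so
  \<open>card_absvals_le\<close> bounds their number by the dimension.\<close>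

lemma finite_places_over_prime:
  assumes K: "number_field TYPE('k::field_char_0)" and p: "prime p"
  shows "finite {V \<in> nonarch_places. \<exists>v\<in>V. v (of_nat p :: 'k) < 1}"
proof -
  define W :: "('k \<Rightarrow> real) set" where "W = {v. nonarch_absval v \<and> v (of_nat p) = 1 / real p}"
  have "finite W"
  proof (rule ccontr)
    assume "infinite W"
    then obtain W' where W': "W' \<subseteq> W" "finite W'" "card W' = Suc (card (rat_basis TYPE('k)))"
      using infinite_arbitrarily_large by blast
    have "card W' \<le> card (rat_basis TYPE('k))"
    proof (rule card_absvals_le[OF K W'(2)])
      fix v w c assume "v \<in> W'" "w \<in> W'"
      thus "v (of_rat c) = w (of_rat c)"
        using W' p by (intro nonarch_agree_rat) (auto simp: W_def)
    next
      fix v w assume "v \<in> W'" "w \<in> W'" "v \<noteq> w"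
      thus "\<exists>z. v z > 1 \<and> w z < 1"
        using W' p by (intro separating_pair) (auto simp: W_def)
    qed (use W' in \<open>auto simp: W_def\<close>)
    thus False using W' by simp
  qed
  moreover have "{V \<in> nonarch_places. \<exists>v\<in>V. v (of_nat p :: 'k) < 1} \<subseteq> (\<lambda>v. absval_equiv `` {v}) ` W"
  proof
    fix V assume "V \<in> {V \<in> nonarch_places. \<exists>v\<in>V. v (of_nat p :: 'k) < 1}"
    then obtain v where v: "V \<in> nonarch_places" "v \<in> V" "v (of_nat p) < 1" by blast
    note nv = nonarch_placeD[OF v(1,2)]
    have p1: "real p > 1" using prime_gt_1_nat[OF p] by simp
    have vp: "v (of_nat p) > 0" using p1 by (intro nonarch_pos nv) auto
    define s where "s = log (v (of_nat p)) (1 / real p)"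
    have s: "s > 0" unfolding s_def using vp v(3) p1 by (simp add: log_def ln_div divide_pos_neg)
    define w where "w x = v x powr s" for x
    have "w (of_nat p) = 1 / real p" unfolding w_def s_def using vp v(3) p1 by simp
    moreover have w: "nonarch_absval w" unfolding w_def by (rule nonarch_powr[OF nv(1) s])
    ultimately have "w \<in> W" by (simp add: W_def)
    moreover have "(v, w) \<in> absval_equiv" using nv(1) w s by (auto simp: absval_equiv_def w_def)
    hence "V = absval_equiv `` {w}" using nv(2) equiv_class_eq[OF equiv_absval_equiv] by blast
    ultimately show "V \<in> (\<lambda>v. absval_equiv `` {v}) ` W" by blast
  qed
  ultimately show ?thesis using finite_surj by blast
qed

text \<open>If \<open>v z > 1\<close>, the top term of the equation would strictly exceed all the
  others and could not be cancelled.\<close>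

lemma nonarch_le_1_if_lead_unit:
  fixes P :: "int poly" and z :: "'k::field_char_0"
  assumes v: "nonarch_absval v" and P: "P \<noteq> 0" "ipoly P z = 0"
    and lead: "v (of_int (lead_coeff P)) = 1"
  shows "v z \<le> 1"
proof (rule ccontr)
  assume "\<not> v z \<le> 1"
  hence z: "v z > 1" by simp
  define n where "n = degree P"
  define a :: "nat \<Rightarrow> 'k" where "a i = of_int (poly.coeff P i)" for i
  have "0 = (\<Sum>i\<le>n. a i * z ^ i)"
    using P(2) by (simp add: poly_altdef degree_map_poly coeff_map_poly n_def a_def)
  also have "\<dots> = (\<Sum>i<n. a i * z ^ i) + a n * z ^ n" by (simp flip: lessThan_Suc_atMost)
  finally have "(\<Sum>i<n. a i * z ^ i) = - (a n * z ^ n)" by (simp add: eq_neg_iff_add_eq_0)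
  moreover have "v (\<Sum>i<n. a i * z ^ i) < v z ^ n"
  proof (rule nonarch_sum_less[OF v])
    show "v z ^ n > 0" using z by simp
  next
    fix i assume i: "i \<in> {..<n}"
    have "v (a i) * v z ^ i \<le> 1 * v z ^ i"
      using v z by (intro mult_right_mono) (auto simp: a_def nonarch_of_int)
    also have "\<dots> < v z ^ n" using z i by (simp add: power_strict_increasing)
    finally show "v (a i * z ^ i) < v z ^ n" using v by (simp add: nonarchD nonarch_power)
  qed
  ultimately show False
    using v lead by (simp add: nonarch_minus nonarchD nonarch_power a_def n_def)
qed

text \<open>N is the product, up to sign, of the leading coefficients of integer equations for z and
  for 1 / z. Where N is a unit, neither z nor 1 / z can exceed 1.\<close>

lemma number_field_bad_int:
  fixes z :: "'k::field_char_0"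
  assumes K: "number_field TYPE('k)" and z: "z \<noteq> 0"
  shows "\<exists>N::nat. N > 0 \<and> (\<forall>v. nonarch_absval v \<longrightarrow> v z \<noteq> 1 \<longrightarrow> v (of_nat N) < 1)"
proof -
  obtain P :: "int poly" where P: "P \<noteq> 0" "ipoly P z = 0"
    using number_field_int_poly[OF K] by blast
  obtain Q :: "int poly" where Q: "Q \<noteq> 0" "ipoly Q (inverse z) = 0"
    using number_field_int_poly[OF K] by blast
  define N where "N = nat \<bar>lead_coeff P * lead_coeff Q\<bar>"
  have "v (of_nat N) < 1" if v: "nonarch_absval v" "v z \<noteq> 1" for v
  proof (rule ccontr)
    assume "\<not> v (of_nat N) < 1"
    hence N1: "v (of_nat N) = 1" using nonarch_of_nat[OF v(1), of N] by simp
    have "(of_nat N :: 'k) = of_int (int N)" by simp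
    also have "\<dots> = of_int \<bar>lead_coeff P * lead_coeff Q\<bar>" by (simp add: N_def)
    finally have "v (of_nat N) = v (of_int (lead_coeff P * lead_coeff Q))"
      using nonarch_minus[OF v(1), of "of_int (lead_coeff P * lead_coeff Q)"]
      by (cases "lead_coeff P * lead_coeff Q \<ge> 0") simp_all
    hence m: "v (of_int (lead_coeff P)) * v (of_int (lead_coeff Q)) = 1"
      using N1 v by (simp add: nonarchD)
    have le: "0 \<le> v (of_int (lead_coeff P))" "v (of_int (lead_coeff P)) \<le> 1"
      "0 \<le> v (of_int (lead_coeff Q))" "v (of_int (lead_coeff Q)) \<le> 1"
      using v by (auto simp: nonarchD nonarch_of_int)
    have "v (of_int (lead_coeff P)) = 1"
      using m le mult_left_le[of "v (of_int (lead_coeff Q))" "v (of_int (lead_coeff P))"] by simp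
    moreover have "v (of_int (lead_coeff Q)) = 1" using m calculation by simp
    ultimately have "v z \<le> 1" "v (inverse z) \<le> 1"
      using nonarch_le_1_if_lead_unit[OF v(1) P] nonarch_le_1_if_lead_unit[OF v(1) Q] by auto
    moreover have "v z > 0" using nonarch_pos[OF v(1) z] .
    ultimately have "v z = 1" using v(1) by (simp add: nonarch_inverse inverse_le_1_iff)
    thus False using v by simp
  qed
  thus ?thesis using P Q by (intro exI[of _ N]) (auto simp: N_def)
qed

lemma nonarch_prime:
  assumes v: "nonarch_absval v" and "n > 0" "v (of_nat n) < 1"
  shows "\<exists>p. prime p \<and> p dvd n \<and> v (of_nat p) < 1"
  using assms(2,3)
proof (induction n rule: less_induct)
  case (less n)
  have "n \<noteq> 1" using less.prems v by (auto simp: nonarch_one)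
  then obtain p where p: "prime p" "p dvd n" using prime_factor_nat by blast
  then obtain m where m: "n = p * m" by (auto elim: dvdE)
  show ?case
  proof (cases "v (of_nat p) < 1")
    case True
    thus ?thesis using p by blast
  next
    case False
    hence "v (of_nat p) = 1" using nonarch_of_nat[OF v, of p] by simp
    hence "v (of_nat m) < 1" using less.prems v by (simp add: m nonarchD)
    moreover have "m < n" "m > 0" using less.prems m prime_gt_1_nat[OF p(1)] by auto
    ultimately obtain q where "prime q" "q dvd m" "v (of_nat q) < 1" using less.IH by blast
    thus ?thesis using m by auto
  qed
qed

text \<open>Applied to the coefficients that decide good reduction. Every such place lies above one
  of the prime divisors of N.\<close>

lemma finite_places_not_unit:
  fixes z :: "'k::field_char_0"
  assumes K: "number_field TYPE('k)" and z: "z \<noteq> 0"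
  shows "finite {V \<in> nonarch_places. \<exists>v\<in>V. v z \<noteq> 1}"
proof -
  obtain N where N: "N > 0" "\<And>v. nonarch_absval v \<Longrightarrow> v z \<noteq> 1 \<Longrightarrow> v (of_nat N) < 1"
    using number_field_bad_int[OF K z] by blast
  have "{V \<in> nonarch_places. \<exists>v\<in>V. v z \<noteq> 1} \<subseteq>
      (\<Union>p\<in>{p. p dvd N \<and> prime p}. {V \<in> nonarch_places. \<exists>v\<in>V. v (of_nat p :: 'k) < 1})"
  proof
    fix V assume "V \<in> {V \<in> nonarch_places. \<exists>v\<in>V. v z \<noteq> 1}"
    then obtain v where v: "V \<in> nonarch_places" "v \<in> V" "v z \<noteq> 1" by blast
    have nv: "nonarch_absval v" by (rule nonarch_placeD[OF v(1,2)])
    obtain p where "prime p" "p dvd N" "v (of_nat p) < 1"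
      using nonarch_prime[OF nv N(1) N(2)[OF nv v(3)]] by blast
    thus "V \<in> (\<Union>p\<in>{p. p dvd N \<and> prime p}. {V \<in> nonarch_places. \<exists>v\<in>V. v (of_nat p :: 'k) < 1})"
      using v by blast
  qed
  moreover have "finite {p. p dvd N \<and> prime p}" using N(1) by simp
  ultimately show ?thesis using finite_places_over_prime[OF K] by (rule_tac finite_subset) auto
qed

text \<open>1 / p is rational but no integer, hence no algebraic integer, so some place makes p
  small. Different primes give different places, since a prime q \<noteq> p is a unit wherever p is
  small.\<close>

lemma infinite_nonarch_places:
  assumes K: "number_field TYPE('k::field_char_0)"
  shows "infinite (nonarch_places :: ('k \<Rightarrow> real) set set)"
proof -
  have "\<exists>v. nonarch_absval v \<and> v (of_nat p :: 'k) < 1" if p: "prime p" for p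
  proof -
    have "inverse (of_nat p :: 'k) \<in> \<rat>" by simp
    moreover have "inverse (of_nat p :: 'k) \<notin> \<int>"
    proof
      assume "inverse (of_nat p :: 'k) \<in> \<int>"
      then obtain c where "inverse (of_nat p :: 'k) = of_int c" by (auto elim: Ints_cases)
      hence "(of_int (c * int p) :: 'k) = of_int 1" using prime_gt_0_nat[OF p] by (simp add: field_simps)
      hence "c * int p = 1" by (simp only: of_int_eq_iff)
      thus False using prime_gt_1_nat[OF p] by (simp add: zmult_eq_1_iff)
    qed
    ultimately have "\<not> algebraic_int (inverse (of_nat p :: 'k))" using rational_algebraic_int_is_int by blast
    then obtain v where v: "nonarch_absval v" "v (inverse (of_nat p :: 'k)) > 1" using exists_absval_gt_1[OF K] by blast
    moreover have "v (of_nat p) > 0" using v(1) prime_gt_0_nat[OF p] by (intro nonarch_pos) auto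
    ultimately show ?thesis by (auto simp: nonarch_inverse one_less_inverse_iff)
  qed
  then obtain v where v: "\<And>p. prime p \<Longrightarrow> nonarch_absval (v p)" "\<And>p. prime p \<Longrightarrow> v p (of_nat p :: 'k) < 1"
    by metis
  have inj: "inj_on (\<lambda>p. absval_equiv `` {v p}) {p::nat. prime p}"
  proof (rule inj_onI, simp)
    fix p q :: nat assume pq: "prime p" "prime q" "absval_equiv `` {v p} = absval_equiv `` {v q}"
    show "p = q"
    proof (rule ccontr)
      assume "p \<noteq> q"
      have "v p \<in> absval_equiv `` {v q}" unfolding pq(3)[symmetric] by (rule nonarch_placeI) (rule v pq)+
      then obtain s where s: "s > 0" "\<And>x. v p x = v q x powr s" by (auto simp: absval_equiv_def)
      have "\<not> int p dvd int q" using pq \<open>p \<noteq> q\<close> by (simp add: primes_dvd_imp_eq) (metis primes_dvd_imp_eq)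
      hence "v p (of_int (int q)) = 1" using v pq by (intro nonarch_int_unit) auto
      hence "v q (of_nat q) powr s = 1" using s by simp
      moreover have "v q (of_nat q) > 0" using v pq prime_gt_0_nat by (intro nonarch_pos) auto
      ultimately show False using v(2)[OF pq(2)] s by (simp add: powr_eq_one_iff_gen)
    qed
  qed
  have "infinite ((\<lambda>p. absval_equiv `` {v p}) ` {p::nat. prime p})"
    using inj primes_infinite by (simp add: finite_image_iff)
  moreover have "(\<lambda>p. absval_equiv `` {v p}) ` {p::nat. prime p} \<subseteq> nonarch_places"
    using v nonarch_placeI by blast
  ultimately show ?thesis using infinite_super by blast
qed

section \<open>Complex embeddings\<close>

text \<open>The map stays a total function and is constrained on F alone (and at 0 and 1), so that
  an embedding can be extended through a growing chain of subrings.\<close>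

definition hom_on :: "'k::field set \<Rightarrow> ('k \<Rightarrow> complex) \<Rightarrow> bool" where
  "hom_on F \<sigma> \<longleftrightarrow> \<sigma> 0 = 0 \<and> \<sigma> 1 = 1 \<and> (\<forall>a\<in>F. \<forall>b\<in>F. \<sigma> (a + b) = \<sigma> a + \<sigma> b \<and> \<sigma> (a * b) = \<sigma> a * \<sigma> b)"

lemma hom_onD:
  assumes "hom_on F \<sigma>"
  shows "\<sigma> 0 = 0" "\<sigma> 1 = 1" "a \<in> F \<Longrightarrow> b \<in> F \<Longrightarrow> \<sigma> (a + b) = \<sigma> a + \<sigma> b"
    "a \<in> F \<Longrightarrow> b \<in> F \<Longrightarrow> \<sigma> (a * b) = \<sigma> a * \<sigma> b"
  using assms by (auto simp: hom_on_def)

lemma hom_on_minus: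
  assumes "subring_set F" "hom_on F \<sigma>" "a \<in> F"
  shows "\<sigma> (- a) = - \<sigma> a"
proof -
  have "\<sigma> (a + - a) = \<sigma> a + \<sigma> (- a)"
    by (rule hom_onD[OF assms(2)]) (use assms in \<open>auto intro: subring_setD\<close>)
  thus ?thesis using hom_onD(1)[OF assms(2)] by (simp add: eq_neg_iff_add_eq_0 add.commute)
qed

lemma hom_on_sum:
  assumes "subring_set F" "hom_on F \<sigma>" "\<And>i. i \<in> I \<Longrightarrow> f i \<in> F"
  shows "\<sigma> (sum f I) = (\<Sum>i\<in>I. \<sigma> (f i))"
  using assms(3)
proof (induction I rule: infinite_finite_induct)
  case (insert i I)
  have "sum f I \<in> F" by (rule subring_set_sum[OF assms(1)]) (use insert.prems in auto)
  thus ?case using insert by (simp add: hom_onD(3)[OF assms(2)])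
qed (simp_all add: hom_onD[OF assms(2)])

section \<open>Extension of embeddings to larger subrings\<close>

lemma map_poly_hom_add:
  assumes "hom_on F \<sigma>" "g \<in> polys_over F" "h \<in> polys_over F"
  shows "map_poly \<sigma> (g + h) = map_poly \<sigma> g + map_poly \<sigma> h"
  using assms by (intro poly_eqI) (auto simp: coeff_map_poly hom_onD polys_over_def)

lemma map_poly_hom_mult:
  assumes "subring_set F" "hom_on F \<sigma>" "g \<in> polys_over F" "h \<in> polys_over F"
  shows "map_poly \<sigma> (g * h) = map_poly \<sigma> g * map_poly \<sigma> h"
proof (rule poly_eqI)
  fix n
  have "\<sigma> (\<Sum>i\<le>n. poly.coeff g i * poly.coeff h (n - i)) = (\<Sum>i\<le>n. \<sigma> (poly.coeff g i * poly.coeff h (n - i)))"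
    using assms by (intro hom_on_sum[of F]) (auto simp: polys_over_def intro: subring_setD)
  also have "\<dots> = (\<Sum>i\<le>n. \<sigma> (poly.coeff g i) * \<sigma> (poly.coeff h (n - i)))"
    using assms by (intro sum.cong hom_onD(4)[of F]) (auto simp: polys_over_def)
  finally show "poly.coeff (map_poly \<sigma> (g * h)) n = poly.coeff (map_poly \<sigma> g * map_poly \<sigma> h) n"
    by (simp add: coeff_map_poly hom_onD[OF assms(2)] coeff_mult)
qed

text \<open>Division by the monic minimal polynomial P: subtracting a multiple of P from h keeps the
  zero at z and, after applying \<sigma>, does not change the value at r. By minimality the process
  ends only at 0.\<close>

lemma hom_extend_vanish:
  assumes F: "subring_set F" and \<sigma>: "hom_on F \<sigma>"
    and P: "P \<in> polys_over F" "lead_coeff P = 1" "poly P z = 0"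
    and min: "\<And>h. h \<in> polys_over F \<Longrightarrow> h \<noteq> 0 \<Longrightarrow> poly h z = 0 \<Longrightarrow> degree P \<le> degree h"
    and r: "poly (map_poly \<sigma> P) r = 0"
    and h: "h \<in> polys_over F" "poly h z = 0"
  shows "poly (map_poly \<sigma> h) r = 0"
  using h
proof (induction "degree h" arbitrary: h rule: less_induct)
  case less
  note PF = subring_setD[OF polys_over_subring[OF F]]
  show ?case
  proof (cases "h = 0")
    case False
    define n where "n = degree h"
    have le: "degree P \<le> n" using min less.prems False by (simp add: n_def)
    have P0: "degree P \<noteq> 0" using monic_root_degree[OF P(2,3)] by simp
    define t where "t = Polynomial.monom (lead_coeff h) (n - degree P)"
    have t: "t \<in> polys_over F" unfolding t_def
      using less.prems by (intro polys_over_monom F) (auto simp: polys_over_def)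
    define g where "g = h - t * P"
    have g: "g \<in> polys_over F" unfolding g_def by (intro PF less.prems t P)
    have dt: "degree (t * P) \<le> n"
      using le degree_mult_le[of t P] degree_monom_le[of "lead_coeff h" "n - degree P"]
      unfolding t_def by linarith
    have "poly.coeff (t * P) n = lead_coeff h"
      using le P(2) by (simp add: t_def coeff_monom_mult)
    hence "degree g < n"
      using P0 le dt unfolding g_def
      by (intro degree_lessI) (auto simp: n_def coeff_eq_0 le_less)
    moreover have "poly g z = 0" using less.prems P by (simp add: g_def)
    ultimately have "poly (map_poly \<sigma> g) r = 0" using less.hyps g by (simp add: n_def)
    moreover have "map_poly \<sigma> (g + t * P) = map_poly \<sigma> g + map_poly \<sigma> t * map_poly \<sigma> P"
      using map_poly_hom_add[OF \<sigma> g PF(4)[OF t P(1)]] map_poly_hom_mult[OF F \<sigma> t P(1)] by simp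
    ultimately show ?thesis using r by (simp add: g_def)
  qed simp
qed

text \<open>The extension sends g(z) to the value at r of the polynomial transported by \<sigma>.
  Two polynomials with the same value at z differ by one that vanishes there, so
  \<open>hom_extend_vanish\<close> makes this well defined.\<close>

lemma hom_extend:
  assumes F: "subring_set F" and \<sigma>: "hom_on F \<sigma>"
    and P: "P \<in> polys_over F" "lead_coeff P = 1" "poly P z = 0"
    and min: "\<And>h. h \<in> polys_over F \<Longrightarrow> h \<noteq> 0 \<Longrightarrow> poly h z = 0 \<Longrightarrow> degree P \<le> degree h"
    and r: "poly (map_poly \<sigma> P) r = 0"
  shows "\<exists>\<sigma>'. hom_on (adjoin F z) \<sigma>' \<and> \<sigma>' z = r \<and> (\<forall>a\<in>F. \<sigma>' a = \<sigma> a)"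
proof -
  note PF = subring_setD[OF polys_over_subring[OF F]]
  define \<sigma>' where "\<sigma>' a = poly (map_poly \<sigma> (SOME h. h \<in> polys_over F \<and> poly h z = a)) r" for a
  have eq: "\<sigma>' (poly h z) = poly (map_poly \<sigma> h) r" if h: "h \<in> polys_over F" for h
  proof -
    define g where "g = (SOME g. g \<in> polys_over F \<and> poly g z = poly h z)"
    have g: "g \<in> polys_over F" "poly g z = poly h z"
      using someI[of "\<lambda>g. g \<in> polys_over F \<and> poly g z = poly h z" h] h by (auto simp: g_def)
    have "poly (map_poly \<sigma> (g - h)) r = 0"
      by (rule hom_extend_vanish[OF F \<sigma> P min r]) (use g h in \<open>auto intro: PF\<close>)
    moreover have "map_poly \<sigma> g = map_poly \<sigma> (g - h) + map_poly \<sigma> h"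
      using map_poly_hom_add[OF \<sigma> PF(6)[OF g(1) h] h] by simp
    ultimately show ?thesis by (simp add: \<sigma>'_def g_def)
  qed
  have const: "[:a:] \<in> polys_over F" if "a \<in> F" for a
    using that PF(1) by simp
  have agree: "\<sigma>' a = \<sigma> a" if "a \<in> F" for a
    using eq[OF const[OF that]] by (simp add: map_poly_pCons hom_onD[OF \<sigma>])
  have X: "[:0, 1:] \<in> polys_over F" using PF(1) subring_setD[OF F] by simp
  have "\<sigma>' z = r" using eq[OF X] by (simp add: map_poly_pCons hom_onD[OF \<sigma>])
  moreover have "hom_on (adjoin F z) \<sigma>'"
    unfolding hom_on_def
  proof (intro conjI ballI)
    show "\<sigma>' 0 = 0" "\<sigma>' 1 = 1" using agree subring_setD[OF F] hom_onD[OF \<sigma>] by auto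
    fix a b assume "a \<in> adjoin F z" "b \<in> adjoin F z"
    then obtain g h where gh: "g \<in> polys_over F" "h \<in> polys_over F" "a = poly g z" "b = poly h z"
      by (auto simp: adjoin_def)
    show "\<sigma>' (a + b) = \<sigma>' a + \<sigma>' b"
      using eq[OF PF(3)[OF gh(1,2)]] by (simp add: gh eq map_poly_hom_add[OF \<sigma>])
    show "\<sigma>' (a * b) = \<sigma>' a * \<sigma>' b"
      using eq[OF PF(4)[OF gh(1,2)]] by (simp add: gh eq map_poly_hom_mult[OF F \<sigma>])
  qed
  ultimately show ?thesis using agree by blast
qed

lemma of_int_poly_eq_0: "(map_poly of_int Q :: 'a::ring_char_0 poly) = 0 \<longleftrightarrow> Q = 0"
  by (simp add: poly_eq_iff coeff_map_poly)

lemma minimal_int_poly: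
  fixes y :: "'k::field_char_0"
  assumes K: "number_field TYPE('k)"
  shows "\<exists>A::int poly. A \<noteq> 0 \<and> ipoly A y = 0 \<and>
    (\<forall>Q::int poly. Q \<noteq> 0 \<longrightarrow> ipoly Q y = 0 \<longrightarrow> degree A \<le> degree Q)"
proof -
  obtain P :: "int poly" where "P \<noteq> 0 \<and> ipoly P y = 0"
    using number_field_int_poly[OF K] by blast
  from ex_has_least_nat[of "\<lambda>P::int poly. P \<noteq> 0 \<and> ipoly P y = 0", OF this, of degree]
  show ?thesis by blast
qed

text \<open>An integer equation of least degree for a nonzero a has a nonzero constant term; solving
  for 1 / a writes it as a polynomial in a with rational coefficients.\<close>

lemma subring_set_inverse:
  fixes F :: "'k::field_char_0 set"
  assumes K: "number_field TYPE('k)" and F: "subring_set F" "range of_rat \<subseteq> F" and a: "a \<in> F"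
  shows "inverse a \<in> F"
proof (cases "a = 0")
  case True
  thus ?thesis using subring_setD(1)[OF F(1)] by simp
next
  case False
  obtain A :: "int poly" where A: "A \<noteq> 0" "ipoly A a = 0"
    "\<And>Q::int poly. Q \<noteq> 0 \<Longrightarrow> ipoly Q a = 0 \<Longrightarrow> degree A \<le> degree Q"
    using minimal_int_poly[OF K] by blast
  obtain c A' where AA: "A = pCons c A'" by (cases A)
  have e: "of_int c + a * ipoly A' a = 0" using A(2) by (simp add: AA map_poly_pCons)
  have c: "c \<noteq> 0"
  proof
    assume c: "c = 0"
    hence "A' \<noteq> 0" using A(1) AA by simp
    moreover have "ipoly A' a = 0" using e c False by simp
    ultimately show False using A(3)[of A'] AA by simp
  qed
  have "a * (- ipoly A' a * of_rat (1 / of_int c)) = 1"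
    using e c by (simp add: of_rat_divide field_simps add_eq_0_iff)
  hence "inverse a = - ipoly A' a * of_rat (1 / of_int c)" by (rule inverse_unique)
  also have "\<dots> \<in> F"
    using F by (intro subring_setD[OF F(1)] polys_over_eval a)
      (auto simp: polys_over_def coeff_map_poly subring_set_of_int)
  finally show ?thesis .
qed

lemma minimal_poly_over:
  fixes F :: "'k::field_char_0 set"
  assumes K: "number_field TYPE('k)" and F: "subring_set F" "range of_rat \<subseteq> F"
  shows "\<exists>P\<in>polys_over F. lead_coeff P = 1 \<and> poly P z = 0 \<and>
    (\<forall>h\<in>polys_over F. h \<noteq> 0 \<longrightarrow> poly h z = 0 \<longrightarrow> degree P \<le> degree h)"
proof -
  obtain Q :: "int poly" where Q: "Q \<noteq> 0" "ipoly Q z = 0"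
    using number_field_int_poly[OF K] by blast
  have "map_poly of_int Q \<in> polys_over F \<and> (map_poly of_int Q :: 'k poly) \<noteq> 0 \<and> ipoly Q z = 0"
    using Q F by (auto simp: polys_over_def coeff_map_poly subring_set_of_int of_int_poly_eq_0)
  from ex_has_least_nat[of "\<lambda>h. h \<in> polys_over F \<and> h \<noteq> 0 \<and> poly h z = 0", OF this, of degree]
  obtain h where h: "h \<in> polys_over F" "h \<noteq> 0" "poly h z = 0"
    "\<And>g. g \<in> polys_over F \<Longrightarrow> g \<noteq> 0 \<Longrightarrow> poly g z = 0 \<Longrightarrow> degree h \<le> degree g"
    by blast
  define l where "l = lead_coeff h"
  have l: "l \<noteq> 0" "inverse l \<in> F"
    using h by (auto simp: l_def polys_over_def intro!: subring_set_inverse[OF K F])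
  have "Polynomial.smult (inverse l) h \<in> polys_over F"
    using h(1) l by (auto simp: polys_over_def intro: subring_setD[OF F(1)])
  thus ?thesis using h l by (intro bexI[of _ "Polynomial.smult (inverse l) h"]) (auto simp: l_def)
qed

text \<open>One element is adjoined at a time: its monic minimal polynomial keeps its degree under
  the embedding and therefore has a complex root to which the element can be sent.\<close>

lemma hom_extend_finite:
  fixes F :: "'k::field_char_0 set"
  assumes K: "number_field TYPE('k)" and "finite S" and F: "subring_set F" "range of_rat \<subseteq> F" and \<sigma>: "hom_on F \<sigma>"
  shows "\<exists>F' \<sigma>'. subring_set F' \<and> F \<subseteq> F' \<and> S \<subseteq> F' \<and> hom_on F' \<sigma>' \<and> (\<forall>a\<in>F. \<sigma>' a = \<sigma> a)"
  using assms(2)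
proof (induction S rule: finite_induct)
  case empty
  thus ?case using F \<sigma> by blast
next
  case (insert z S)
  then obtain F' \<sigma>' where F': "subring_set F'" "F \<subseteq> F'" "S \<subseteq> F'" "hom_on F' \<sigma>'" "\<forall>a\<in>F. \<sigma>' a = \<sigma> a" by blast
  obtain P where P: "P \<in> polys_over F'" "lead_coeff P = 1" "poly P z = 0"
    "\<And>h. h \<in> polys_over F' \<Longrightarrow> h \<noteq> 0 \<Longrightarrow> poly h z = 0 \<Longrightarrow> degree P \<le> degree h"
    using minimal_poly_over[OF K F'(1)] F F' by blast
  have "degree P \<noteq> 0" using monic_root_degree[OF P(2,3)] by simp
  moreover have "degree (map_poly \<sigma>' P) = degree P"
    using P(2) hom_onD(1,2)[OF F'(4)] by (intro antisym map_poly_degree_leq le_degree) (auto simp: coeff_map_poly)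
  ultimately have "\<not> constant (poly (map_poly \<sigma>' P))" by (simp add: constant_degree)
  then obtain r where r: "poly (map_poly \<sigma>' P) r = 0" using fundamental_theorem_of_algebra by blast
  obtain \<sigma>'' where s: "hom_on (adjoin F' z) \<sigma>''" "\<forall>a\<in>F'. \<sigma>'' a = \<sigma>' a"
    using hom_extend[OF F'(1,4) P r] by blast
  have "subring_set (adjoin F' z)" "F' \<subseteq> adjoin F' z" "z \<in> adjoin F' z"
    using F' adjoin_subring adjoin_superset adjoin_generator by blast+
  moreover have "\<forall>a\<in>F. \<sigma>'' a = \<sigma> a" using s(2) F'(2,5) by auto
  ultimately show ?case using s F' by (intro exI[of _ "adjoin F' z"] exI[of _ \<sigma>'']) auto
qed

lemma subring_set_contains_basis:
  fixes F :: "'k::field_char_0 set"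
  assumes K: "number_field TYPE('k)" and F: "subring_set F" "range of_rat \<subseteq> F" "rat_basis TYPE('k) \<subseteq> F"
  shows "F = UNIV"
proof -
  interpret finite_dimensional_vector_space "\<lambda>(r::rat) (x::'k). of_rat r * x" "rat_basis TYPE('k)"
    by (rule rat_basis[OF K])
  have "subspace F" unfolding subspace_def using F by (auto intro: subring_setD)
  hence "span (rat_basis TYPE('k)) \<subseteq> F" using F by (intro span_minimal)
  thus ?thesis using span_Basis by auto
qed

lemma hom_of_nat: "hom_on UNIV \<sigma> \<Longrightarrow> \<sigma> (of_nat n) = of_nat n"
  by (induction n) (simp_all add: hom_onD)

lemma subring_UNIV: "subring_set UNIV"
  by (simp add: subring_set_def)

lemma hom_of_int: "hom_on UNIV \<sigma> \<Longrightarrow> \<sigma> (of_int n) = of_int n"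
  by (cases n rule: int_cases2) (simp_all add: hom_of_nat hom_on_minus[OF subring_UNIV])

lemma hom_inverse:
  assumes "hom_on UNIV \<sigma>"
  shows "\<sigma> (inverse a) = inverse (\<sigma> a)"
proof (cases "a = 0")
  case False
  hence "\<sigma> a * \<sigma> (inverse a) = 1" using hom_onD(4)[OF assms, of a "inverse a"] hom_onD(2)[OF assms] by simp
  thus ?thesis by (metis inverse_unique)
qed (simp add: hom_onD[OF assms])

lemma hom_of_rat:
  fixes \<sigma> :: "'k::field_char_0 \<Rightarrow> complex"
  assumes "hom_on UNIV \<sigma>"
  shows "\<sigma> (of_rat q) = of_rat q"
proof -
  obtain a b where "q = of_int a / of_int b" by (cases q) (auto simp: Fract_of_int_quotient)
  thus ?thesis
    by (simp add: of_rat_divide divide_inverse hom_onD[OF assms] hom_inverse[OF assms] hom_of_int[OF assms] of_rat_mult of_rat_inverse)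
qed

text \<open>Turns a bound on all \<open>\<sigma> y\<close> into a bound on all complex roots of the
  minimal polynomial. The map from Q[y] that sends y to r is extended over a basis, which exhausts
  the field.\<close>

lemma embedding_exists:
  fixes y :: "'k::field_char_0" and A :: "int poly"
  assumes K: "number_field TYPE('k)" and A: "A \<noteq> 0" "ipoly A y = 0"
    "\<And>Q::int poly. Q \<noteq> 0 \<Longrightarrow> ipoly Q y = 0 \<Longrightarrow> degree A \<le> degree Q"
    and r: "ipoly A (r :: complex) = 0"
  shows "\<exists>\<sigma>. hom_on UNIV \<sigma> \<and> \<sigma> y = r"
proof -
  let ?Q = "range of_rat :: 'k set"
  have Q: "subring_set ?Q"
    unfolding subring_set_def
  proof (intro conjI ballI)
    show "0 \<in> ?Q" by (metis of_rat_0 rangeI)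
    show "1 \<in> ?Q" by (metis of_rat_1 rangeI)
  qed (auto simp flip: of_rat_add of_rat_mult of_rat_minus)
  define \<sigma>0 :: "'k \<Rightarrow> complex" where "\<sigma>0 a = of_rat (inv_into UNIV of_rat a)" for a
  have \<sigma>0: "\<sigma>0 (of_rat q) = of_rat q" for q
    by (simp add: \<sigma>0_def inv_f_f inj_def)
  have \<sigma>01: "\<sigma>0 0 = 0" "\<sigma>0 1 = 1" using \<sigma>0[of 0] \<sigma>0[of 1] by simp_all
  have hom: "hom_on ?Q \<sigma>0"
    unfolding hom_on_def using \<sigma>01 \<sigma>0 by (auto simp flip: of_rat_add of_rat_mult)
  define l where "l = lead_coeff A"
  have l: "l \<noteq> 0" using A by (simp add: l_def)
  define P :: "'k poly" where "P = Polynomial.smult (of_rat (1 / of_int l)) (map_poly of_int A)"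
  have cP: "poly.coeff P i = of_rat (of_int (poly.coeff A i) / of_int l)" for i
    by (simp add: P_def coeff_map_poly of_rat_divide of_rat_mult)
  have dP: "degree P = degree A"
    using l by (simp add: P_def degree_map_poly)
  have P: "P \<in> polys_over ?Q" "lead_coeff P = 1" "poly P y = 0"
    unfolding dP cP using l A by (auto simp: polys_over_def cP l_def[symmetric]) (simp add: P_def)
  \<comment> \<open>Clearing denominators makes of h an integer polynomial H of the same degree, so
    minimality of A among integer polynomials carries over to rational ones.\<close>
  have min: "degree P \<le> degree h"
    if h: "h \<in> polys_over ?Q" "h \<noteq> 0" "poly h y = 0" for h
  proof -
    have "\<forall>i. \<exists>c. poly.coeff h i = of_rat c" using h by (auto simp: polys_over_def)
    then obtain c where c: "\<And>i. poly.coeff h i = of_rat (c i)" by metis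
    obtain D where D: "D > 0" "\<forall>i\<in>{..degree h}. of_int D * c i \<in> \<int>"
      using rat_common_denominator[of "{..degree h}" c] by auto
    define H where "H = (\<Sum>i\<le>degree h. Polynomial.monom \<lfloor>of_int D * c i\<rfloor> i)"
    have cH: "of_int (poly.coeff H i) = of_int D * c i" for i
    proof (cases "i \<le> degree h")
      case True
      hence "of_int \<lfloor>of_int D * c i\<rfloor> = of_int D * c i" using D by simp
      thus ?thesis using True by (simp add: H_def coeff_sum)
    next
      case False
      hence "(of_rat (c i) :: 'k) = 0" using c[of i] by (simp add: coeff_eq_0)
      thus ?thesis using False by (simp add: H_def coeff_sum)
    qed
    have HH: "map_poly of_int H = Polynomial.smult (of_int D) h"
    proof (rule poly_eqI)
      fix i
      have "(of_int (poly.coeff H i) :: 'k) = of_rat (of_int (poly.coeff H i))" by simp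
      also have "\<dots> = of_int D * of_rat (c i)" unfolding cH by (simp add: of_rat_mult)
      finally show "poly.coeff (map_poly of_int H) i = poly.coeff (Polynomial.smult (of_int D) h) i"
        by (simp add: coeff_map_poly c)
    qed
    hence "H \<noteq> 0" using h D by auto
    moreover have "ipoly H y = 0" using h HH by simp
    ultimately have "degree A \<le> degree H" by (rule A)
    also have "degree H = degree (map_poly of_int H :: 'k poly)" by (simp add: degree_map_poly)
    also have "\<dots> = degree h" using D by (simp add: HH)
    finally show ?thesis by (simp add: dP)
  qed
  have "map_poly \<sigma>0 P = Polynomial.smult (of_rat (1 / of_int l)) (map_poly of_int A)"
  proof (rule poly_eqI)
    fix i
    have "\<sigma>0 (poly.coeff P i) = of_rat (of_int (poly.coeff A i) / of_int l)" by (simp only: cP \<sigma>0)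
    thus "poly.coeff (map_poly \<sigma>0 P) i = poly.coeff (Polynomial.smult (of_rat (1 / of_int l)) (map_poly of_int A)) i"
      by (simp add: coeff_map_poly \<sigma>01 of_rat_divide)
  qed
  hence "poly (map_poly \<sigma>0 P) r = 0" using r by simp
  then obtain \<sigma>1 where \<sigma>1: "hom_on (adjoin ?Q y) \<sigma>1" "\<sigma>1 y = r"
    using hom_extend[OF Q hom P min] by blast
  have "?Q \<subseteq> adjoin ?Q y" by (rule adjoin_superset[OF Q])
  moreover have "finite (rat_basis TYPE('k))"
    using rat_basis[OF K] by (simp add: finite_dimensional_vector_space_def finite_dimensional_vector_space_axioms_def)
  ultimately obtain F' \<sigma>' where F': "subring_set F'" "adjoin ?Q y \<subseteq> F'" "rat_basis TYPE('k) \<subseteq> F'"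
     "hom_on F' \<sigma>'" "\<forall>a\<in>adjoin ?Q y. \<sigma>' a = \<sigma>1 a"
    using hom_extend_finite[OF K _ adjoin_subring[OF Q] _ \<sigma>1(1)] by blast
  have "F' = UNIV" by (rule subring_set_contains_basis[OF K F'(1) _ F'(3)]) (use F' \<open>?Q \<subseteq> _\<close> in blast)
  moreover have "\<sigma>' y = r" using F'(5) \<sigma>1 adjoin_generator[OF Q] by auto
  ultimately show ?thesis using F'(4) by blast
qed

text \<open>An embedding is determined by its values on a basis, and each basis element can only go
  to a root of an integer equation that it satisfies.\<close>

lemma finite_embeddings:
  assumes K: "number_field TYPE('k::field_char_0)"
  shows "finite {\<sigma> :: 'k \<Rightarrow> complex. hom_on UNIV \<sigma>}"
proof -
  let ?B = "rat_basis TYPE('k)"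
  interpret finite_dimensional_vector_space "\<lambda>(r::rat) (x::'k). of_rat r * x" ?B
    by (rule rat_basis[OF K])
  have "\<forall>b::'k. \<exists>P::int poly. P \<noteq> 0 \<and> ipoly P b = 0"
    using number_field_int_poly[OF K] by blast
  then obtain P :: "'k \<Rightarrow> int poly" where P: "\<And>b. P b \<noteq> 0" "\<And>b. ipoly (P b) b = 0" by metis
  define R where "R b = {r::complex. ipoly (P b) r = 0}" for b
  have "finite (R b)" for b unfolding R_def using P by (intro poly_roots_finite) (simp add: of_int_poly_eq_0)
  hence "finite (PiE ?B R)" by (intro finite_PiE finite_Basis)
  moreover have "(\<lambda>\<sigma>. restrict \<sigma> ?B) ` {\<sigma>. hom_on UNIV \<sigma>} \<subseteq> PiE ?B R"
  proof
    fix f assume "f \<in> (\<lambda>\<sigma>. restrict \<sigma> ?B) ` {\<sigma>. hom_on UNIV \<sigma>}"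
    then obtain \<sigma> where \<sigma>: "hom_on UNIV \<sigma>" "f = restrict \<sigma> ?B" by blast
    have "\<sigma> b \<in> R b" for b
    proof -
      have pw: "\<sigma> (b ^ n) = \<sigma> b ^ n" for n by (induction n) (simp_all add: hom_onD[OF \<sigma>(1)])
      have "ipoly (P b) (\<sigma> b) = (\<Sum>i\<le>degree (P b). of_int (poly.coeff (P b) i) * \<sigma> b ^ i)"
        by (simp add: poly_altdef degree_map_poly coeff_map_poly)
      also have "\<dots> = \<sigma> (\<Sum>i\<le>degree (P b). of_int (poly.coeff (P b) i) * b ^ i)"
        by (simp add: hom_on_sum[OF subring_UNIV \<sigma>(1)] hom_onD[OF \<sigma>(1)] hom_of_int[OF \<sigma>(1)] pw)
      also have "(\<Sum>i\<le>degree (P b). of_int (poly.coeff (P b) i) * b ^ i) = ipoly (P b) b"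
        by (simp add: poly_altdef degree_map_poly coeff_map_poly)
      finally show ?thesis using P hom_onD(1)[OF \<sigma>(1)] by (simp add: R_def)
    qed
    thus "f \<in> PiE ?B R" using \<sigma> by auto
  qed
  moreover have "inj_on (\<lambda>\<sigma>. restrict \<sigma> ?B) {\<sigma>. hom_on UNIV \<sigma>}"
  proof (rule inj_onI, clarsimp)
    fix \<sigma> \<tau> :: "'k \<Rightarrow> complex" assume s: "hom_on UNIV \<sigma>" "hom_on UNIV \<tau>" "restrict \<sigma> ?B = restrict \<tau> ?B"
    have "subspace {x. \<sigma> x = \<tau> x}"
      unfolding subspace_def by (simp add: hom_onD[OF s(1)] hom_onD[OF s(2)] hom_of_rat[OF s(1)] hom_of_rat[OF s(2)])
    moreover have "?B \<subseteq> {x. \<sigma> x = \<tau> x}" using s(3) by (metis (mono_tags, lifting) mem_Collect_eq restrict_apply' subsetI)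
    ultimately have "span ?B \<subseteq> {x. \<sigma> x = \<tau> x}" by (rule span_minimal[rotated])
    thus "\<sigma> = \<tau>" using span_Basis by auto
  qed
  ultimately show ?thesis using finite_imageD finite_subset by blast
qed

section \<open>Finiteness of algebraic integers with bounded conjugates (Northcott)\<close>

lemma monic_coeff_bound:
  fixes p :: "complex poly"
  assumes "lead_coeff p = 1" "C \<ge> 0" "\<And>r. poly p r = 0 \<Longrightarrow> cmod r \<le> C"
  shows "cmod (poly.coeff p i) \<le> (1 + C) ^ degree p"
  using assms
proof (induction "degree p" arbitrary: p i)
  case 0
  then obtain c where "p = [:c:]" by (metis degree_eq_zeroE)
  thus ?case using 0 by (cases i) auto
next
  case (Suc n)
  hence "\<not> constant (poly p)" by (simp add: constant_degree)
  then obtain r where r: "poly p r = 0" using fundamental_theorem_of_algebra by blast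
  then obtain q where q: "p = [:- r, 1:] * q" by (auto simp: poly_eq_0_iff_dvd elim: dvdE)
  have q0: "q \<noteq> 0" using Suc q by auto
  have dq: "degree q = n" using Suc(2) q0 by (simp add: q degree_mult_eq del: mult_pCons_left)
  have "lead_coeff q = 1" using Suc.prems(1) unfolding q lead_coeff_mult by simp
  moreover have "cmod s \<le> C" if "poly q s = 0" for s by (rule Suc.prems) (simp add: q that)
  ultimately have IH: "cmod (poly.coeff q j) \<le> (1 + C) ^ n" for j using Suc.hyps(1)[of q j] dq assms(2) by simp
  have r': "cmod r \<le> C" using Suc.prems r by blast
  \<comment> \<open>Multiplying q by X - r turns each coefficient into a difference of a coefficient
    of q and r times the next one, so every root costs at most a factor 1 + C.\<close>
  have "cmod (poly.coeff p i) \<le> C * (1 + C) ^ n + (1 + C) ^ n"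
  proof (cases i)
    case 0
    have "cmod (poly.coeff p i) = cmod r * cmod (poly.coeff q 0)" by (simp add: q 0 norm_mult)
    also have "\<dots> \<le> C * (1 + C) ^ n" using IH r' assms(2) by (intro mult_mono) auto
    finally show ?thesis using assms(2) by (simp add: add_increasing2)
  next
    case (Suc k)
    have "cmod (poly.coeff p i) \<le> cmod r * cmod (poly.coeff q i) + cmod (poly.coeff q k)"
      using norm_triangle_ineq4[of "poly.coeff q k" "r * poly.coeff q i"]
      by (simp add: q Suc norm_mult algebra_simps)
    also have "\<dots> \<le> C * (1 + C) ^ n + (1 + C) ^ n"
      using IH r' assms(2) by (intro add_mono mult_mono) auto
    finally show ?thesis .
  qed
  thus ?case using Suc(2)[symmetric] by (simp add: algebra_simps)
qed

text \<open>Gauss's lemma. For a primitive A of least degree, pseudo-division of a monic equation P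
  leaves no remainder: e P = A q. Taking contents gives content q = |e|, so the factor e cancels up
  to sign and the leading coefficient of A divides 1.\<close>

lemma monic_minimal_int_poly:
  fixes y :: "'k::field_char_0"
  assumes K: "number_field TYPE('k)" and y: "algebraic_int y"
  shows "\<exists>A::int poly. lead_coeff A = 1 \<and> ipoly A y = 0 \<and>
    (\<forall>Q::int poly. Q \<noteq> 0 \<longrightarrow> ipoly Q y = 0 \<longrightarrow> degree A \<le> degree Q)"
proof -
  have pm: "ipoly (f * g) y = ipoly f y * ipoly g y"
    and pa: "ipoly (f + g) y = ipoly f y + ipoly g y"
    and ps: "ipoly (Polynomial.smult c f) y = of_int c * ipoly f y" for f g c
  proof -
    have "(map_poly of_int (f * g) :: 'k poly) = map_poly of_int f * map_poly of_int g"
      by (rule poly_eqI) (simp add: coeff_map_poly coeff_mult)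
    thus "ipoly (f * g) y = ipoly f y * ipoly g y" by simp
    have "(map_poly of_int (f + g) :: 'k poly) = map_poly of_int f + map_poly of_int g"
      by (rule poly_eqI) (simp add: coeff_map_poly)
    thus "ipoly (f + g) y = ipoly f y + ipoly g y" by simp
    have "(map_poly of_int (Polynomial.smult c f) :: 'k poly) = Polynomial.smult (of_int c) (map_poly of_int f)"
      by (rule poly_eqI) (simp add: coeff_map_poly)
    thus "ipoly (Polynomial.smult c f) y = of_int c * ipoly f y" by simp
  qed
  obtain A0 :: "int poly" where A0: "A0 \<noteq> 0" "ipoly A0 y = 0"
    "\<And>Q::int poly. Q \<noteq> 0 \<Longrightarrow> ipoly Q y = 0 \<Longrightarrow> degree A0 \<le> degree Q"
    using minimal_int_poly[OF K] by blast
  define A where "A = primitive_part A0"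
  have A0A: "A0 = Polynomial.smult (content A0) A" by (simp add: A_def)
  have A: "A \<noteq> 0" "content A = 1" using A0(1) by (auto simp: A_def)
  have "content A0 \<noteq> 0" using A0(1) by simp
  hence Ay: "ipoly A y = 0"
    and min: "\<And>Q::int poly. Q \<noteq> 0 \<Longrightarrow> ipoly Q y = 0 \<Longrightarrow> degree A \<le> degree Q"
    using A0(2,3) ps[of "content A0" A] by (simp_all flip: A0A add: A_def)
  obtain P :: "int poly" where P: "ipoly P y = 0" "lead_coeff P = 1"
    using y algebraic_int_altdef_ipoly by blast
  obtain q r where qr: "pseudo_divmod P A = (q, r)" by force
  define e where "e = lead_coeff A ^ (Suc (degree P) - degree A)"
  have e0: "e \<noteq> 0" using A by (simp add: e_def)
  have eq: "Polynomial.smult e P = A * q + r" and r: "r = 0 \<or> degree r < degree A"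
    using pseudo_divmod[OF A(1) qr] by (auto simp: e_def)
  have "ipoly (A * q + r) y = 0" using P(1) by (simp flip: eq add: ps)
  hence "ipoly r y = 0" by (simp add: pa pm Ay)
  hence "r = 0" using min[of r] r by (metis leD)
  hence eq: "Polynomial.smult e P = A * q" using eq by simp
  have "content P dvd 1" using content_dvd_coeff[of P "degree P"] P(2) by simp
  hence "content P = 1" by (metis is_unit_normalize normalize_content)
  hence "content q = \<bar>e\<bar>" using arg_cong[OF eq, of content] A by (simp add: content_mult)
  hence "q = Polynomial.smult \<bar>e\<bar> (primitive_part q)" using content_times_primitive_part[of q] by simp
  hence "Polynomial.smult e P = Polynomial.smult \<bar>e\<bar> (A * primitive_part q)"
    using eq by (metis mult_smult_right)
  hence "e * 1 = \<bar>e\<bar> * (lead_coeff A * lead_coeff (primitive_part q))"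
    using P(2) by (metis lead_coeff_smult lead_coeff_mult)
  hence "\<bar>e * 1\<bar> = \<bar>e\<bar> * \<bar>lead_coeff A * lead_coeff (primitive_part q)\<bar>"
    by (metis abs_mult abs_abs)
  hence "\<bar>lead_coeff A * lead_coeff (primitive_part q)\<bar> = 1" using e0 by simp
  hence "\<bar>lead_coeff A\<bar> = 1" by (auto simp: abs_mult zmult_eq_1_iff)
  then consider "lead_coeff A = 1" | "lead_coeff (- A) = 1" by (auto simp: abs_if split: if_splits)
  thus ?thesis
  proof cases
    case 1
    thus ?thesis using Ay min by blast
  next
    case 2
    moreover have "ipoly (- A) y = 0" using Ay ps[of "-1" A] by simp
    ultimately show ?thesis using min by (intro exI[of _ "- A"]) simp
  qed
qed

lemma finite_int_polys_bounded: "finite {A :: int poly. degree A \<le> m \<and> (\<forall>i. \<bar>poly.coeff A i\<bar> \<le> M)}"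
proof -
  have "{A :: int poly. degree A \<le> m \<and> (\<forall>i. \<bar>poly.coeff A i\<bar> \<le> M)} \<subseteq>
      (\<lambda>f. \<Sum>i\<le>m. Polynomial.monom (f i) i) ` PiE {..m} (\<lambda>_. {- M..M})"
  proof
    fix A :: "int poly" assume "A \<in> {A. degree A \<le> m \<and> (\<forall>i. \<bar>poly.coeff A i\<bar> \<le> M)}"
    hence A: "degree A \<le> m" "\<And>i. \<bar>poly.coeff A i\<bar> \<le> M" by auto
    have "A = (\<Sum>i\<le>m. Polynomial.monom (restrict (poly.coeff A) {..m} i) i)"
      using poly_as_sum_of_monoms'[OF A(1)] by simp
    moreover have "restrict (poly.coeff A) {..m} \<in> PiE {..m} (\<lambda>_. {- M..M})"
      using A(2) by (auto simp: abs_le_iff minus_le_iff)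
    ultimately show "A \<in> (\<lambda>f. \<Sum>i\<le>m. Polynomial.monom (f i) i) ` PiE {..m} (\<lambda>_. {- M..M})" by blast
  qed
  thus ?thesis by (rule finite_subset) (intro finite_imageI finite_PiE finite_atMost finite_atLeastAtMost_int)
qed

text \<open>The conjugates fill the roots of the monic minimal polynomial, so its integer
  coefficients are bounded as well as its degree; finitely many polynomials have finitely many
  roots.\<close>

lemma northcott_integral:
  assumes K: "number_field TYPE('k::field_char_0)"
  shows "finite {y::'k. algebraic_int y \<and> (\<forall>\<sigma>. hom_on UNIV \<sigma> \<longrightarrow> cmod (\<sigma> y) \<le> C)}"
proof -
  define m where "m = card (rat_basis TYPE('k))"
  \<comment> \<open>C may be negative, whereas the coefficient bound asks for a nonnegative
    one.\<close>
  define C' where "C' = max C 0"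
  define M where "M = \<lceil>(1 + C') ^ m\<rceil>"
  define \<A> where "\<A> = {A :: int poly. degree A \<le> m \<and> (\<forall>i. \<bar>poly.coeff A i\<bar> \<le> M)} - {0}"
  have "{y::'k. algebraic_int y \<and> (\<forall>\<sigma>. hom_on UNIV \<sigma> \<longrightarrow> cmod (\<sigma> y) \<le> C)}
      \<subseteq> (\<Union>A\<in>\<A>. {y. ipoly A y = 0})"
  proof
    fix y :: 'k assume "y \<in> {y. algebraic_int y \<and> (\<forall>\<sigma>. hom_on UNIV \<sigma> \<longrightarrow> cmod (\<sigma> y) \<le> C)}"
    hence y: "algebraic_int y" "\<And>\<sigma>. hom_on UNIV \<sigma> \<Longrightarrow> cmod (\<sigma> y) \<le> C" by auto
    obtain A :: "int poly" where A: "lead_coeff A = 1" "ipoly A y = 0"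
      "\<And>Q::int poly. Q \<noteq> 0 \<Longrightarrow> ipoly Q y = 0 \<Longrightarrow> degree A \<le> degree Q"
      using monic_minimal_int_poly[OF K y(1)] by blast
    have A0: "A \<noteq> 0" using A(1) by auto
    have deg: "degree A \<le> m"
      using number_field_int_poly[OF K, of y] A(3) order.trans unfolding m_def by blast
    have "\<bar>poly.coeff A i\<bar> \<le> M" for i
    proof -
      let ?A = "map_poly of_int A :: complex poly"
      have dA: "degree ?A = degree A" by (simp add: degree_map_poly)
      have "cmod (poly.coeff ?A i) \<le> (1 + C') ^ degree ?A"
      proof (rule monic_coeff_bound)
        show "lead_coeff ?A = 1" using A(1) unfolding dA by (simp add: coeff_map_poly)
        show "C' \<ge> 0" by (simp add: C'_def)
        fix r assume r: "poly ?A r = 0"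
        obtain \<sigma> where "hom_on UNIV \<sigma>" "\<sigma> y = r"
          using embedding_exists[OF K A0 A(2,3) r] by blast
        thus "cmod r \<le> C'" using y(2)[of \<sigma>] by (auto simp: C'_def)
      qed
      also have "\<dots> \<le> (1 + C') ^ m" using deg by (intro power_increasing) (auto simp: dA C'_def)
      finally have "\<bar>real_of_int (poly.coeff A i)\<bar> \<le> (1 + C') ^ m" by (simp add: coeff_map_poly)
      hence "real_of_int \<bar>poly.coeff A i\<bar> \<le> (1 + C') ^ m" by simp
      thus ?thesis unfolding M_def by linarith
    qed
    thus "y \<in> (\<Union>A\<in>\<A>. {y. ipoly A y = 0})" using A deg A0 by (auto simp: \<A>_def)
  qed
  moreover have "finite (\<Union>A\<in>\<A>. {y::'k. ipoly A y = 0})"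
  proof (intro finite_UN_I)
    show "finite \<A>" unfolding \<A>_def using finite_int_polys_bounded by (rule finite_Diff)
    fix A assume "A \<in> \<A>"
    thus "finite {y::'k. ipoly A y = 0}"
      by (intro poly_roots_finite) (simp add: \<A>_def of_int_poly_eq_0)
  qed
  ultimately show ?thesis by (rule finite_subset)
qed

section \<open>Homogeneous iteration\<close>

definition homog :: "nat \<Rightarrow> 'a::comm_ring_1 poly \<Rightarrow> 'a \<Rightarrow> 'a \<Rightarrow> 'a" where
  "homog d p x y = (\<Sum>i\<le>d. poly.coeff p i * x ^ i * y ^ (d - i))"

definition hstep :: "nat \<Rightarrow> 'a::comm_ring_1 poly \<Rightarrow> 'a poly \<Rightarrow> 'a \<times> 'a \<Rightarrow> 'a \<times> 'a" where
  "hstep d p q z = (homog d p (fst z) (snd z), homog d q (fst z) (snd z))"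

lemma homog_scale: "homog d p (c * x) (c * y) = c ^ d * homog d p x y"
  unfolding homog_def sum_distrib_left
proof (rule sum.cong)
  fix i assume "i \<in> {..d}"
  hence "c ^ d = c ^ i * c ^ (d - i)" by (simp flip: power_add)
  thus "poly.coeff p i * (c * x) ^ i * (c * y) ^ (d - i) = c ^ d * (poly.coeff p i * x ^ i * y ^ (d - i))"
    by (simp add: power_mult_distrib mult_ac)
qed simp

lemma homog_smult: "homog d (Polynomial.smult c p) x y = c * homog d p x y"
  by (simp add: homog_def sum_distrib_left mult.assoc)

lemma hstep_scale:
  "hstep d p q (c * x, c * y) = (c ^ d * fst (hstep d p q (x, y)), c ^ d * snd (hstep d p q (x, y)))"
  by (simp add: hstep_def homog_scale)

lemma hstep_iterate_scale:
  "(hstep d p q ^^ n) (c * x, c * y) =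
     (c ^ (d ^ n) * fst ((hstep d p q ^^ n) (x, y)), c ^ (d ^ n) * snd ((hstep d p q ^^ n) (x, y)))"
proof (induction n)
  case (Suc n)
  let ?z = "(hstep d p q ^^ n) (x, y)"
  have "(hstep d p q ^^ Suc n) (c * x, c * y) = hstep d p q (c ^ (d ^ n) * fst ?z, c ^ (d ^ n) * snd ?z)"
    using Suc by simp
  also have "\<dots> = ((c ^ d ^ n) ^ d * fst (hstep d p q ?z), (c ^ d ^ n) ^ d * snd (hstep d p q ?z))"
    unfolding hstep_scale by simp
  finally show ?case by (simp flip: power_mult add: mult.commute)
qed simp

lemma homog_eq_poly:
  fixes p :: "'a::field poly"
  assumes "degree p \<le> d" "y \<noteq> 0"
  shows "homog d p x y = y ^ d * poly p (x / y)"
  unfolding homog_def poly_sum_bound[OF assms(1)] sum_distrib_left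
proof (rule sum.cong)
  fix i assume "i \<in> {..d}"
  hence "y ^ d = y ^ i * y ^ (d - i)" by (simp flip: power_add)
  thus "poly.coeff p i * x ^ i * y ^ (d - i) = y ^ d * (poly.coeff p i * (x / y) ^ i)"
    using assms by (simp add: power_divide)
qed simp

lemma homog_zero_right: "homog d p x 0 = poly.coeff p d * x ^ d"
proof -
  have "homog d p x 0 = (\<Sum>i\<in>{d}. poly.coeff p i * x ^ i * 0 ^ (d - i))"
    unfolding homog_def by (rule sum.mono_neutral_right) (auto simp: power_0_left)
  thus ?thesis by simp
qed

text \<open>A common zero with y = 0 would make both coefficients of degree d vanish, against the
  choice of d; any other would be a common root x / y, which a Bezout relation excludes.\<close>

lemma hstep_nonzero:
  fixes p q :: "'a::field poly"
  assumes "coprime p q" and d: "d = max (degree p) (degree q)" and "d > 0"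
    and z: "z \<noteq> (0, 0)"
  shows "hstep d p q z \<noteq> (0, 0)"
proof
  assume "hstep d p q z = (0, 0)"
  hence h: "homog d p (fst z) (snd z) = 0" "homog d q (fst z) (snd z) = 0" by (auto simp: hstep_def)
  show False
  proof (cases "snd z = 0")
    case True
    hence "fst z \<noteq> 0" using z by (cases z) auto
    hence "poly.coeff p d = 0" "poly.coeff q d = 0" using h True by (simp_all add: homog_zero_right)
    thus False using d \<open>d > 0\<close> by (auto simp: max_def split: if_splits)
  next
    case False
    hence "poly p (fst z / snd z) = 0" "poly q (fst z / snd z) = 0"
      using h d by (simp_all add: homog_eq_poly)
    moreover obtain u w where "u * p + w * q = 1" using coprime_poly_bezout assms(1) by blast
    hence "poly (u * p + w * q) (fst z / snd z) = 1" by simp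
    ultimately show False by simp
  qed
qed

lemma hstep_iterate_nonzero:
  fixes p q :: "'a::field poly"
  assumes "coprime p q" "d = max (degree p) (degree q)" "d > 0" "z \<noteq> (0, 0)"
  shows "(hstep d p q ^^ n) z \<noteq> (0, 0)"
  by (induction n) (simp_all add: assms(4) hstep_nonzero[OF assms(1-3)])

lemma poly_homog:
  "poly (homog d (map_poly (\<lambda>c. [:c:]) p) U V) e = homog d p (poly U e) (poly V e)"
  by (simp add: homog_def poly_sum coeff_map_poly mult.assoc)

text \<open>Evaluation at e is a ring homomorphism and commutes with the iteration. So the iterates
  of a point that moves polynomially with e are polynomial in e, and continuity in e becomes a
  statement about polynomials.\<close>

lemma poly_hstep_iterate:
  defines "C \<equiv> map_poly (\<lambda>c. [:c:])"
  shows "(poly (fst ((hstep d (C p) (C q) ^^ n) (U, V))) e, poly (snd ((hstep d (C p) (C q) ^^ n) (U, V))) e)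
    = (hstep d p q ^^ n) (poly U e, poly V e)"
proof (induction n)
  case (Suc n)
  define W where "W = (hstep d (C p) (C q) ^^ n) (U, V)"
  have IH: "(hstep d p q ^^ n) (poly U e, poly V e) = (poly (fst W) e, poly (snd W) e)"
    using Suc by (simp add: W_def)
  show ?case
    by (simp only: funpow.simps comp_apply W_def[symmetric] IH) (simp add: hstep_def C_def poly_homog)
qed simp

section \<open>Returns to the starting point are rare\<close>

text \<open>The triangle inequality in place of the ultrametric one admits the non-Archimedean
  places and the complex absolute values of embeddings at once.\<close>

definition absval :: "('k::field \<Rightarrow> real) \<Rightarrow> bool" where
  "absval w \<longleftrightarrow> (\<forall>x. 0 \<le> w x) \<and> (\<forall>x. w x = 0 \<longleftrightarrow> x = 0) \<and> (\<forall>x y. w (x * y) = w x * w y) \<and>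
     (\<forall>x y. w (x + y) \<le> w x + w y)"

lemma absvalD:
  assumes "absval w"
  shows "0 \<le> w x" "w x = 0 \<longleftrightarrow> x = 0" "w (x * y) = w x * w y" "w (x + y) \<le> w x + w y" "w 0 = 0"
  using assms by (auto simp: absval_def)

lemma nonarch_imp_absval: "nonarch_absval v \<Longrightarrow> absval v"
proof -
  assume v: "nonarch_absval v"
  have "v (x + y) \<le> v x + v y" for x y
    using nonarchD(4)[OF v, of x y] nonarchD(1)[OF v, of x] nonarchD(1)[OF v, of y]
    by linarith
  thus ?thesis using v by (auto simp: absval_def nonarchD)
qed

lemma embedding_absval:
  assumes "hom_on UNIV \<sigma>"
  shows "absval (\<lambda>x. cmod (\<sigma> x))"
proof -
  have "\<sigma> x = 0 \<longleftrightarrow> x = 0" for x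
  proof
    assume "\<sigma> x = 0"
    show "x = 0"
    proof (rule ccontr)
      assume "x \<noteq> 0"
      hence "\<sigma> x * \<sigma> (inverse x) = 1"
        using hom_onD(4)[OF assms, of x "inverse x"] hom_onD(2)[OF assms] by simp
      thus False using \<open>\<sigma> x = 0\<close> by simp
    qed
  qed (simp add: hom_onD[OF assms])
  thus ?thesis
    unfolding absval_def by (auto simp: hom_onD[OF assms] norm_mult intro: norm_triangle_ineq)
qed

lemma absval_minus:
  assumes "absval w"
  shows "w (- x) = w x"
proof -
  have "w 1 * w 1 = w 1 * 1" using absvalD(3)[OF assms, of 1 1] by simp
  hence "w 1 = 1" using absvalD(2)[OF assms, of 1] by simp
  moreover have "w (-1) * w (-1) = w 1" using absvalD(3)[OF assms, of "-1" "-1"] by simp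
  ultimately have "w (-1) ^ 2 = 1" by (simp add: power2_eq_square)
  hence "w (-1) = 1" using absvalD(1)[OF assms, of "-1"] by (simp add: power2_eq_1_iff)
  thus ?thesis using absvalD(3)[OF assms, of "-1" x] by simp
qed

lemma absval_poly_bound:
  assumes w: "absval w"
  shows "\<exists>C\<ge>0. \<forall>e. w e \<le> 1 \<longrightarrow> w (poly h e) \<le> C"
proof (induction h)
  case 0
  show ?case by (auto simp: absvalD[OF w])
next
  case (pCons a h)
  then obtain C where C: "C \<ge> 0" "\<forall>e. w e \<le> 1 \<longrightarrow> w (poly h e) \<le> C" by blast
  have "w (poly (pCons a h) e) \<le> w a + C" if "w e \<le> 1" for e
  proof -
    have "w e * w (poly h e) \<le> 1 * C" using that C by (intro mult_mono) (auto simp: absvalD[OF w])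
    thus ?thesis using absvalD(4)[OF w, of a "e * poly h e"] by (simp add: absvalD(3)[OF w])
  qed
  thus ?case using C absvalD(1)[OF w, of a] by (intro exI[of _ "w a + C"]) auto
qed

text \<open>A Lipschitz bound at 0: h(e) = h(0) + e g(e), with g bounded on the unit ball.\<close>

lemma absval_poly_continuous:
  assumes w: "absval w"
  shows "\<exists>C\<ge>0. \<forall>e. w e \<le> 1 \<longrightarrow> w (poly h 0) - C * w e \<le> w (poly h e)"
proof -
  obtain a g where h: "h = pCons a g" by (cases h)
  obtain C where C: "C \<ge> 0" "\<forall>e. w e \<le> 1 \<longrightarrow> w (poly g e) \<le> C" using absval_poly_bound[OF w] by blast
  have "w a - C * w e \<le> w (a + e * poly g e)" if "w e \<le> 1" for e
  proof -
    have "w (a + e * poly g e + - (e * poly g e)) \<le> w (a + e * poly g e) + w (e * poly g e)"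
      using absvalD(4)[OF w, of "a + e * poly g e" "- (e * poly g e)"] by (simp only: absval_minus[OF w])
    moreover have "w e * w (poly g e) \<le> w e * C" using that C by (intro mult_left_mono) (auto simp: absvalD[OF w])
    ultimately show ?thesis by (simp add: absvalD(3)[OF w] mult.commute)
  qed
  thus ?thesis using C h by (intro exI[of _ C]) simp
qed

text \<open>
  A point close to \<open>[a : b]\<close> is \<open>[a + t e : b - s e]\<close> with \<open>e\<close> small, so its \<open>i\<close>-th iterate is close to
  that of \<open>[a : b]\<close>, which is different from \<open>[a : b]\<close>.
\<close>

lemma no_quick_return:
  fixes a b s t :: "'k::field"
  assumes w: "absval w" and st: "s * a + t * b = 1"
    and bi: "fst ((hstep d p q ^^ i) (a, b)) * b - snd ((hstep d p q ^^ i) (a, b)) * a \<noteq> 0"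
  shows "\<exists>\<epsilon>>0. \<forall>x y. (x, y) \<noteq> (0, 0) \<longrightarrow> w (x * b - y * a) < \<epsilon> * max (w x) (w y) \<longrightarrow>
    \<epsilon> * max (w (fst ((hstep d p q ^^ i) (x, y)))) (w (snd ((hstep d p q ^^ i) (x, y)))) \<le>
      w (fst ((hstep d p q ^^ i) (x, y)) * b - snd ((hstep d p q ^^ i) (x, y)) * a)"
proof -
  \<comment> \<open>Since \<open>s * a + t * b = 1\<close>, the point (a + t e, b - s e) satisfies
    (a + t e) b - (b - s e) a = e: the parameter measures exactly the distance from [a : b].\<close>
  define Z where "Z = (hstep d (map_poly (\<lambda>c. [:c:]) p) (map_poly (\<lambda>c. [:c:]) q) ^^ i) ([:a, t:], [:b, - s:])"
  have Z: "(poly (fst Z) e, poly (snd Z) e) = (hstep d p q ^^ i) (a + t * e, b - s * e)" for e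
    unfolding Z_def poly_hstep_iterate by (simp add: mult.commute)
  define \<beta> where "\<beta> = fst Z * [:b:] - snd Z * [:a:]"
  define L where "L = w (poly \<beta> 0)"
  have "poly \<beta> 0 \<noteq> 0" using bi Z[of 0] by (auto simp: \<beta>_def prod_eq_iff mult.commute)
  hence L: "L > 0" using absvalD(1,2)[OF w, of "poly \<beta> 0"] by (simp add: L_def)
  obtain C1 C2 C3 where C0: "C1 \<ge> 0" "\<forall>e. w e \<le> 1 \<longrightarrow> w (poly (fst Z) e) \<le> C1"
    "C2 \<ge> 0" "\<forall>e. w e \<le> 1 \<longrightarrow> w (poly (snd Z) e) \<le> C2"
    "C3 \<ge> 0" "\<forall>e. w e \<le> 1 \<longrightarrow> w (poly \<beta> 0) - C3 * w e \<le> w (poly \<beta> e)"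
    using absval_poly_bound[OF w] absval_poly_continuous[OF w] by metis
  define C where "C = C1 + C2 + C3 + 1"
  have C: "C \<ge> 1" "\<And>e. w e \<le> 1 \<Longrightarrow> w (poly (fst Z) e) \<le> C" "\<And>e. w e \<le> 1 \<Longrightarrow> w (poly (snd Z) e) \<le> C"
    using C0 by (force simp: C_def)+
  have C4: "L - C * w e \<le> w (poly \<beta> e)" if "w e \<le> 1" for e
  proof -
    have "C3 * w e \<le> C * w e" using C0 by (intro mult_right_mono) (auto simp: C_def absvalD[OF w])
    thus ?thesis using C0(6) that by (force simp: L_def)
  qed
  define A where "A = w a + w b + w s + w t + 1"
  have wpos: "w a \<ge> 0" "w b \<ge> 0" "w s \<ge> 0" "w t \<ge> 0" using absvalD(1)[OF w] by auto
  have A: "A \<ge> 1" "w a \<le> A" "w b \<le> A" "w s \<le> A" "w t \<le> A" using wpos by (auto simp: A_def)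
  \<comment> \<open>A near point will have a parameter with \<open>w e < 2 * A * \<epsilon>\<close>.
    The first bound makes this at most 1; the second keeps \<open>w (poly \<beta> e)\<close> at
    least L / 2 and \<epsilon> C at most L / 4.\<close>
  define \<epsilon> where "\<epsilon> = min (1 / (2 * A)) (L / (4 * A * C))"
  have \<epsilon>: "\<epsilon> > 0" using A C L by (simp add: \<epsilon>_def)
  have \<epsilon>1: "2 * A * \<epsilon> \<le> 1"
  proof -
    have "2 * A * \<epsilon> \<le> 2 * A * (1 / (2 * A))" using A by (intro mult_left_mono) (auto simp: \<epsilon>_def)
    thus ?thesis using A by simp
  qed
  have \<epsilon>2: "4 * A * C * \<epsilon> \<le> L"
  proof -
    have "4 * A * C * \<epsilon> \<le> 4 * A * C * (L / (4 * A * C))" using A C by (intro mult_left_mono) (auto simp: \<epsilon>_def)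
    thus ?thesis using A C by simp
  qed
  show ?thesis
  proof (intro exI[of _ \<epsilon>] conjI allI impI \<epsilon>)
    fix x y assume nz: "(x, y) \<noteq> (0, 0)" and close: "w (x * b - y * a) < \<epsilon> * max (w x) (w y)"
    define \<beta>0 where "\<beta>0 = x * b - y * a"
    define M where "M = max (w x) (w y)"
    have wx: "w x \<ge> 0" "w y \<ge> 0" "w \<beta>0 \<ge> 0" using absvalD(1)[OF w] by auto
    have M: "M > 0" using nz wx absvalD(2)[OF w, of x] absvalD(2)[OF w, of y] by (auto simp: M_def less_max_iff_disj less_le)
    \<comment> \<open>(a, b) and (t, -s) form a basis of determinant -1, in which (x, y) has the
      coordinates c and \<beta>0.\<close>
    define c where "c = s * x + t * y"
    have wc: "w c \<ge> 0" using absvalD(1)[OF w] .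
    have "x = x * (s * a + t * b)" "y = y * (s * a + t * b)" by (simp_all add: st)
    hence x: "x = c * a + t * \<beta>0" and y: "y = c * b + (- s) * \<beta>0" by (simp_all add: c_def \<beta>0_def algebra_simps)
    have "w x \<le> w c * w a + w t * w \<beta>0"
      using absvalD(4)[OF w, of "c * a" "t * \<beta>0"] by (simp flip: x add: absvalD(3)[OF w])
    also have "\<dots> \<le> w c * A + A * w \<beta>0" using A wc wx by (intro add_mono mult_left_mono mult_right_mono) auto
    finally have 1: "w x \<le> A * w c + A * w \<beta>0" by (simp add: mult.commute)
    have "w y \<le> w c * w b + w s * w \<beta>0"
      using absvalD(4)[OF w, of "c * b" "(- s) * \<beta>0"] unfolding y[symmetric]
      by (simp only: absvalD(3)[OF w] absval_minus[OF w])
    also have "\<dots> \<le> w c * A + A * w \<beta>0" using A wc wx by (intro add_mono mult_left_mono mult_right_mono) auto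
    finally have 2: "w y \<le> A * w c + A * w \<beta>0" by (simp add: mult.commute)
    have 3: "w \<beta>0 < \<epsilon> * M" using close by (simp add: \<beta>0_def M_def)
    \<comment> \<open>The second basis vector contributes at most M / 2, so the first one carries
      the point: c is nonzero and e = \<beta>0 / c is small.\<close>
    have "M \<le> A * w c + A * w \<beta>0" using 1 2 by (simp add: M_def)
    also have "A * w \<beta>0 \<le> A * (\<epsilon> * M)" using 3 A by (intro mult_left_mono) auto
    also have "A * (\<epsilon> * M) = (2 * A * \<epsilon>) * M / 2" by simp
    also have "\<dots> \<le> 1 * M / 2" using \<epsilon>1 M by (intro divide_right_mono mult_right_mono) auto
    finally have M2: "M \<le> 2 * A * w c" by simp
    hence "w c \<noteq> 0" using M by auto
    hence wc: "w c > 0" and c: "c \<noteq> 0" using wc absvalD(2)[OF w, of c] by auto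
    define e where "e = \<beta>0 / c"
    have ce: "c * e = \<beta>0" using c by (simp add: e_def)
    have "w c * w e = w \<beta>0" using absvalD(3)[OF w, of c e] ce by simp
    also have "\<dots> < \<epsilon> * (2 * A * w c)"
      using 3 mult_left_mono[OF M2, of \<epsilon>] \<epsilon> by linarith
    finally have "w c * w e < w c * (2 * A * \<epsilon>)" by (simp add: mult_ac)
    hence e: "w e < 2 * A * \<epsilon>" using wc by simp
    hence e1: "w e \<le> 1" using \<epsilon>1 by simp
    have xy: "(x, y) = (c * (a + t * e), c * (b - s * e))"
    proof -
      have "c * (a + t * e) = c * a + t * (c * e)" "c * (b - s * e) = c * b + (- s) * (c * e)"
        by (simp_all add: algebra_simps)
      hence "c * (a + t * e) = x" "c * (b - s * e) = y" unfolding ce by (simp_all only: x[symmetric] y[symmetric])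
      thus ?thesis by simp
    qed
    define \<kappa> where "\<kappa> = c ^ (d ^ i)"
    have it: "(hstep d p q ^^ i) (x, y) = (\<kappa> * poly (fst Z) e, \<kappa> * poly (snd Z) e)"
      unfolding xy hstep_iterate_scale Z[symmetric] by (simp add: \<kappa>_def)
    have w\<kappa>: "w \<kappa> \<ge> 0" by (rule absvalD[OF w])
    have "\<epsilon> * max (w (\<kappa> * poly (fst Z) e)) (w (\<kappa> * poly (snd Z) e)) \<le> \<epsilon> * (w \<kappa> * C)"
      using C(2)[OF e1] C(3)[OF e1] w\<kappa> \<epsilon> by (intro mult_left_mono) (auto simp: absvalD(3)[OF w] mult_left_mono)
    also have "\<dots> = w \<kappa> * (\<epsilon> * C)" by simp
    also have "\<epsilon> * C \<le> w (poly \<beta> e)"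
    proof -
      have "C * w e \<le> C * (2 * A * \<epsilon>)" using e C by (intro mult_left_mono) auto
      also have "\<dots> = (4 * A * C * \<epsilon>) / 2" by simp
      finally have "C * w e \<le> L / 2" using \<epsilon>2 by simp
      hence "L / 2 \<le> w (poly \<beta> e)" using C4[OF e1] by simp
      moreover have "1 * (C * \<epsilon>) \<le> A * (C * \<epsilon>)" using A C \<epsilon> by (intro mult_right_mono) auto
      hence "4 * (\<epsilon> * C) \<le> L" using \<epsilon>2 by (simp add: mult_ac)
      ultimately show ?thesis using L by simp
    qed
    hence "w \<kappa> * (\<epsilon> * C) \<le> w \<kappa> * w (poly \<beta> e)" using w\<kappa> by (intro mult_left_mono)
    also have "\<dots> = w (\<kappa> * poly (fst Z) e * b - \<kappa> * poly (snd Z) e * a)"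
      by (simp add: \<beta>_def algebra_simps flip: absvalD(3)[OF w])
    finally show "\<epsilon> * max (w (fst ((hstep d p q ^^ i) (x, y)))) (w (snd ((hstep d p q ^^ i) (x, y)))) \<le>
      w (fst ((hstep d p q ^^ i) (x, y)) * b - snd ((hstep d p q ^^ i) (x, y)) * a)"
      by (simp add: it)
  qed
qed

section \<open>Orbit points far from the start at finitely many absolute values
  simultaneously\<close>

lemma finite_uniform_pos:
  fixes P :: "'i \<Rightarrow> real \<Rightarrow> bool"
  assumes "finite I" "\<And>i. i \<in> I \<Longrightarrow> \<exists>\<epsilon>>0. P i \<epsilon>"
    and mono: "\<And>i \<epsilon> \<delta>. P i \<epsilon> \<Longrightarrow> 0 < \<delta> \<Longrightarrow> \<delta> \<le> \<epsilon> \<Longrightarrow> P i \<delta>"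
  shows "\<exists>\<epsilon>>0. \<forall>i\<in>I. P i \<epsilon>"
  using assms(1,2)
proof (induction I rule: finite_induct)
  case empty
  show ?case by (auto intro: exI[of _ 1])
next
  case (insert i I)
  then obtain \<epsilon> \<delta> where "\<epsilon> > 0" "\<forall>i\<in>I. P i \<epsilon>" "\<delta> > 0" "P i \<delta>" by (metis insertCI)
  thus ?case using mono by (intro exI[of _ "min \<epsilon> \<delta>"]) (auto intro: mono)
qed

lemma infinitely_often_far:
  fixes a b :: "'k::field" and W :: "('k \<Rightarrow> real) set"
  assumes W: "finite W" "\<And>w. w \<in> W \<Longrightarrow> absval w" and ab: "(a, b) \<noteq> (0, 0)"
    and cop: "coprime p q" "d = max (degree p) (degree q)" "d > 0"
  defines "Z \<equiv> \<lambda>n. (hstep d p q ^^ n) (a, b)"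
  assumes nonper: "\<And>n. n > 0 \<Longrightarrow> fst (Z n) * b - snd (Z n) * a \<noteq> 0"
  shows "\<exists>\<epsilon>>0. \<forall>n. \<exists>j\<ge>n. \<forall>w\<in>W. \<epsilon> * max (w (fst (Z j))) (w (snd (Z j))) \<le> w (fst (Z j) * b - snd (Z j) * a)"
proof -
  obtain s t where st: "s * a + t * b = 1"
  proof (cases "a = 0")
    case True
    thus ?thesis using ab that[of 0 "1 / b"] by simp
  next
    case False
    thus ?thesis using that[of "1 / a" 0] by simp
  qed
  define near where "near w \<epsilon> z \<longleftrightarrow> w (fst z * b - snd z * a) < \<epsilon> * max (w (fst z)) (w (snd z))"
    for w :: "'k \<Rightarrow> real" and \<epsilon> z
  have near_mono: "near w \<delta> z \<Longrightarrow> \<delta> \<le> \<epsilon> \<Longrightarrow> absval w \<Longrightarrow> near w \<epsilon> z" for w \<delta> \<epsilon> z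
  proof -
    assume "near w \<delta> z" "\<delta> \<le> \<epsilon>" "absval w"
    moreover have "\<delta> * max (w (fst z)) (w (snd z)) \<le> \<epsilon> * max (w (fst z)) (w (snd z))"
      using calculation absvalD(1)[of w] by (intro mult_right_mono) (auto simp: le_max_iff_disj)
    ultimately show ?thesis by (simp add: near_def)
  qed
  define P where "P = (\<lambda>(w, i) \<epsilon>. absval w \<and> (\<forall>z. z \<noteq> (0, 0) \<longrightarrow> near w \<epsilon> z \<longrightarrow> \<not> near w \<epsilon> ((hstep d p q ^^ i) z)))"
  let ?m = "card W"
  have "\<exists>\<epsilon>>0. \<forall>wi\<in>W \<times> {1..?m}. P wi \<epsilon>"
  proof (rule finite_uniform_pos)
    fix wi assume "wi \<in> W \<times> {1..?m}"
    then obtain w i where wi: "wi = (w, i)" "w \<in> W" "i > 0" by auto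
    show "\<exists>\<epsilon>>0. P wi \<epsilon>"
      using no_quick_return[OF W(2)[OF wi(2)] st nonper[OF wi(3), unfolded Z_def]] W(2)[OF wi(2)]
      unfolding wi(1) P_def near_def by (auto simp: not_less)
  next
    fix wi \<epsilon> \<delta> assume "P wi \<epsilon>" "0 < \<delta>" "\<delta> \<le> \<epsilon>"
    thus "P wi \<delta>" unfolding P_def by (cases wi) (use near_mono in blast)
  qed (use W in simp)
  then obtain \<epsilon> where \<epsilon>: "\<epsilon> > 0" "\<And>w i z. w \<in> W \<Longrightarrow> 1 \<le> i \<Longrightarrow> i \<le> ?m \<Longrightarrow> z \<noteq> (0, 0) \<Longrightarrow> near w \<epsilon> z \<Longrightarrow>
      \<not> near w \<epsilon> ((hstep d p q ^^ i) z)"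
    unfolding P_def by fastforce
  have "\<exists>j\<ge>n. \<forall>w\<in>W. \<not> near w \<epsilon> (Z j)" for n
  proof (rule ccontr)
    assume "\<not> ?thesis"
    \<comment> \<open>The interval has one index more than W has members, and any two of its indices
      differ by at most \<open>card W\<close>, the range of steps for which \<epsilon> was made
      uniform. Two indices sharing the same w give a forbidden quick return.\<close>
    hence "\<forall>j\<in>{n..n + ?m}. \<exists>w\<in>W. near w \<epsilon> (Z j)" by auto
    then obtain g where g: "\<And>j. j \<in> {n..n + ?m} \<Longrightarrow> g j \<in> W \<and> near (g j) \<epsilon> (Z j)" by metis
    have "\<not> inj_on g {n..n + ?m}"
    proof
      assume "inj_on g {n..n + ?m}"
      hence "card {n..n + ?m} \<le> card W" using g W by (intro card_inj_on_le[of g]) auto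
      thus False by simp
    qed
    then obtain j k where "j \<in> {n..n + ?m}" "k \<in> {n..n + ?m}" "j \<noteq> k" "g j = g k" by (auto simp: inj_on_def)
    then obtain j k where jk: "j \<in> {n..n + ?m}" "k \<in> {n..n + ?m}" "j < k" "g j = g k" by (metis linorder_neqE_nat)
    have "Z k = (hstep d p q ^^ (k - j)) (Z j)"
      using jk by (simp add: Z_def flip: funpow_add comp_apply[of "hstep d p q ^^ (k - j)"])
    moreover have "Z j \<noteq> (0, 0)" unfolding Z_def by (rule hstep_iterate_nonzero[OF cop ab])
    moreover have "near (g j) \<epsilon> (Z j)" "g j \<in> W" using g jk(1) by auto
    ultimately have "\<not> near (g j) \<epsilon> (Z k)" using \<epsilon>(2)[of "g j" "k - j" "Z j"] jk by auto
    thus False using g jk by auto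
  qed
  thus ?thesis using \<epsilon>(1) by (auto simp: near_def not_less)
qed

section \<open>Projective lines over abstract fields\<close>

context field
begin

lemma proj_point_scale:
  assumes c: "c \<in> carrier R - {\<zero>}" and x: "x \<in> carrier R" "y \<in> carrier R"
  shows "proj_point R (c \<otimes> x) (c \<otimes> y) = proj_point R x y"
proof -
  have cu: "c \<in> Units R" using c field_Units by blast
  show ?thesis
  proof
    show "proj_point R (c \<otimes> x) (c \<otimes> y) \<subseteq> proj_point R x y"
    proof
      fix z assume "z \<in> proj_point R (c \<otimes> x) (c \<otimes> y)"
      then obtain e where e: "e \<in> carrier R - {\<zero>}" "z = (e \<otimes> (c \<otimes> x), e \<otimes> (c \<otimes> y))"
        by (auto simp: proj_point_def)
      have "z = ((e \<otimes> c) \<otimes> x, (e \<otimes> c) \<otimes> y)" using e c x by (simp add: m_assoc)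
      moreover have "e \<otimes> c \<in> carrier R - {\<zero>}" using e c integral by auto
      ultimately show "z \<in> proj_point R x y" unfolding proj_point_def by blast
    qed
    show "proj_point R x y \<subseteq> proj_point R (c \<otimes> x) (c \<otimes> y)"
    proof
      fix z assume "z \<in> proj_point R x y"
      then obtain e where e: "e \<in> carrier R - {\<zero>}" "z = (e \<otimes> x, e \<otimes> y)" by (auto simp: proj_point_def)
      have i: "inv c \<in> carrier R" "inv c \<otimes> c = \<one>" using cu by auto
      have "inv c \<noteq> \<zero>" using i c by auto
      hence ei: "e \<otimes> inv c \<in> carrier R - {\<zero>}" using e i integral by auto
      have "(e \<otimes> inv c) \<otimes> (c \<otimes> u) = e \<otimes> u" if u: "u \<in> carrier R" for u
      proof -
        have "inv c \<otimes> (c \<otimes> u) = u" using i c u by (simp flip: m_assoc)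
        thus ?thesis using e i c u by (simp add: m_assoc)
      qed
      hence "z = ((e \<otimes> inv c) \<otimes> (c \<otimes> x), (e \<otimes> inv c) \<otimes> (c \<otimes> y))" using e x by simp
      thus "z \<in> proj_point R (c \<otimes> x) (c \<otimes> y)" using ei unfolding proj_point_def by blast
    qed
  qed
qed

lemma proj_point_eqI:
  assumes x: "x \<in> carrier R" "y \<in> carrier R" "x' \<in> carrier R" "y' \<in> carrier R"
    and nz: "(x, y) \<noteq> (\<zero>, \<zero>)" "(x', y') \<noteq> (\<zero>, \<zero>)" and eq: "x \<otimes> y' = x' \<otimes> y"
  shows "proj_point R x y = proj_point R x' y'"
proof (cases "y = \<zero>")
  case True
  hence x0: "x \<noteq> \<zero>" using nz by simp
  hence y0: "y' = \<zero>" using eq True x integral by auto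
  hence x'0: "x' \<noteq> \<zero>" using nz by simp
  have xu: "inv x \<in> carrier R" "x \<otimes> inv x = \<one>" using x0 x field_Units by auto
  have "x' = (x' \<otimes> inv x) \<otimes> x" using xu x by (simp add: m_assoc m_comm[of "inv x" x])
  moreover have "y' = (x' \<otimes> inv x) \<otimes> y" using xu x True y0 by simp
  moreover have "x' \<otimes> inv x \<in> carrier R - {\<zero>}" using calculation x'0 x xu by auto
  ultimately show ?thesis using proj_point_scale[of "x' \<otimes> inv x" x y] x by simp
next
  case False
  have yu: "inv y \<in> carrier R" "y \<otimes> inv y = \<one>" using False x field_Units by auto
  have e1: "(y' \<otimes> inv y) \<otimes> y = y'" using yu x by (simp add: m_assoc m_comm[of "inv y" y])
  have "(y' \<otimes> inv y) \<otimes> x = (x \<otimes> y') \<otimes> inv y" using yu x by (simp add: m_ac)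
  also have "\<dots> = x' \<otimes> (y \<otimes> inv y)" unfolding eq using yu x by (simp add: m_assoc)
  finally have e2: "(y' \<otimes> inv y) \<otimes> x = x'" using yu x by simp
  have "y' \<otimes> inv y \<noteq> \<zero>"
  proof
    assume "y' \<otimes> inv y = \<zero>"
    thus False using e1 e2 nz x by auto
  qed
  thus ?thesis using proj_point_scale[of "y' \<otimes> inv y" x y] x yu e1 e2 by simp
qed

lemma homog_eval_closed:
  assumes "set p \<subseteq> carrier R" "x \<in> carrier R" "y \<in> carrier R"
  shows "homog_eval R d p x y \<in> carrier R"
  unfolding homog_eval_def using assms by (intro finsum_closed) auto

lemma homog_eval_scale:
  assumes p: "set p \<subseteq> carrier R" and c: "c \<in> carrier R" and x: "x \<in> carrier R" "y \<in> carrier R"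
  shows "homog_eval R d p (c \<otimes> x) (c \<otimes> y) = c [^] d \<otimes> homog_eval R d p x y"
proof -
  have "homog_eval R d p (c \<otimes> x) (c \<otimes> y) =
      (\<Oplus>i\<in>{..d}. c [^] d \<otimes> (coeff p i \<otimes> (x [^] i) \<otimes> (y [^] (d - i))))"
    unfolding homog_eval_def
  proof (rule add.finprod_cong')
    fix i assume "i \<in> {..d}"
    hence e: "c [^] d = c [^] i \<otimes> c [^] (d - i)" using c by (simp add: nat_pow_mult)
    show "coeff p i \<otimes> (c \<otimes> x) [^] i \<otimes> (c \<otimes> y) [^] (d - i) =
        c [^] d \<otimes> (coeff p i \<otimes> (x [^] i) \<otimes> (y [^] (d - i)))"
      unfolding e using c x coeff_in_carrier[OF p, of i] by (simp add: nat_pow_distrib m_ac)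
  qed (use c x p in auto)
  also have "\<dots> = c [^] d \<otimes> homog_eval R d p x y"
    unfolding homog_eval_def using c x p by (subst finsum_rdistr) auto
  finally show ?thesis .
qed

lemma proj_map_point:
  assumes p: "set p \<subseteq> carrier R" "set q \<subseteq> carrier R" and x: "x \<in> carrier R" "y \<in> carrier R"
  shows "proj_map R d p q (proj_point R x y) = proj_point R (homog_eval R d p x y) (homog_eval R d q x y)"
proof -
  have *: "proj_point R (homog_eval R d p (c \<otimes> x) (c \<otimes> y)) (homog_eval R d q (c \<otimes> x) (c \<otimes> y))
      = proj_point R (homog_eval R d p x y) (homog_eval R d q x y)"
    if c: "c \<in> carrier R - {\<zero>}" for c
  proof -
    have "c [^] d \<in> carrier R - {\<zero>}" using c by (induction d) (auto simp: integral_iff)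
    thus ?thesis using c x p by (simp add: homog_eval_scale proj_point_scale homog_eval_closed)
  qed
  have "(\<lambda>(x, y). proj_point R (homog_eval R d p x y) (homog_eval R d q x y)) ` proj_point R x y
      = {proj_point R (homog_eval R d p x y) (homog_eval R d q x y)}" (is "?L = {?r}")
  proof
    show "?L \<subseteq> {?r}" using * by (auto simp: proj_point_def)
    have "(\<one> \<otimes> x, \<one> \<otimes> y) \<in> proj_point R x y" unfolding proj_point_def using one_not_zero by blast
    thus "{?r} \<subseteq> ?L" using x by force
  qed
  thus ?thesis by (simp add: proj_map_def)
qed

lemma eval_finsum:
  assumes "set p \<subseteq> carrier R" "x \<in> carrier R" "length p \<le> Suc d"
  shows "eval p x = (\<Oplus>i\<in>{..d}. coeff p i \<otimes> x [^] i)"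
  using assms(1,3)
proof (induction p)
  case Nil
  thus ?case using assms(2) by (simp add: add.finprod_one_eqI)
next
  case (Cons a p)
  let ?n = "length p"
  have c: "a \<in> carrier R" "set p \<subseteq> carrier R" "?n \<le> d" using Cons by auto
  have z: "coeff p ?n = \<zero>" by (rule coeff_length) simp
  have "(\<Oplus>i\<in>{..d}. coeff (a # p) i \<otimes> x [^] i) =
      (\<Oplus>i\<in>{..d}. (if i = ?n then a \<otimes> x [^] i else \<zero>) \<oplus> coeff p i \<otimes> x [^] i)"
    using c assms(2) z by (intro add.finprod_cong') auto
  also have "\<dots> = (\<Oplus>i\<in>{..d}. if i = ?n then a \<otimes> x [^] i else \<zero>) \<oplus> (\<Oplus>i\<in>{..d}. coeff p i \<otimes> x [^] i)"
    using c assms(2) by (intro finsum_addf) auto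
  also have "(\<Oplus>i\<in>{..d}. if i = ?n then a \<otimes> x [^] i else \<zero>) = a \<otimes> x [^] ?n"
    using c assms(2) add.finprod_singleton_swap[of ?n "{..d}" "\<lambda>i. a \<otimes> x [^] i"] by (simp cong: if_cong)
  also have "(\<Oplus>i\<in>{..d}. coeff p i \<otimes> x [^] i) = eval p x" using Cons c by simp
  finally show ?case by simp
qed

end

lemma proj_line_coordinates:
  "\<alpha> \<in> proj_line R \<Longrightarrow> \<exists>x\<in>carrier R. \<exists>y\<in>carrier R. (x, y) \<noteq> (\<zero>\<^bsub>R\<^esub>, \<zero>\<^bsub>R\<^esub>) \<and> \<alpha> = proj_point R x y"
  by (auto simp: proj_line_def)

section \<open>Coordinates over a type-class field\<close>

abbreviation type_ring :: "'a::field ring" where "type_ring \<equiv> ring_of_type_algebra"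

lemma type_ring_simps [simp]:
  "carrier (type_ring :: 'a::field ring) = UNIV" "\<one>\<^bsub>type_ring\<^esub> = (1::'a)" "\<zero>\<^bsub>type_ring\<^esub> = (0::'a)"
  "x \<otimes>\<^bsub>type_ring\<^esub> y = (x * y :: 'a)" "x \<oplus>\<^bsub>type_ring\<^esub> y = (x + y :: 'a)"
  by (simp_all add: ring_of_type_algebra_def)

lemma field_type_ring: "field (type_ring :: 'a::field ring)"
  by (rule field_from_type_algebra)

lemma type_ring_pow [simp]: "x [^]\<^bsub>type_ring\<^esub> (n::nat) = (x ^ n :: 'a::field)"
proof -
  interpret field "type_ring :: 'a ring" by (rule field_type_ring)
  show ?thesis by (induction n) (simp_all add: mult.commute)
qed

lemma type_ring_finsum [simp]:
  "finite A \<Longrightarrow> finsum (type_ring :: 'a::field ring) f A = sum f A"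
proof (induction A rule: finite_induct)
  interpret field "type_ring :: 'a ring" by (rule field_type_ring)
  case empty
  show ?case by simp
next
  interpret field "type_ring :: 'a ring" by (rule field_type_ring)
  case (insert x A)
  thus ?case by (subst finsum_insert) auto
qed

lemma (in ring) coeff_rev_coeffs:
  assumes "h 0 = \<zero>"
  shows "coeff (map h (rev (coeffs p))) i = h (poly.coeff p i)"
proof (cases "i < length (coeffs p)")
  case True
  moreover from this have "coeffs p ! i = poly.coeff p i"
    by (cases "p = 0") (auto simp: coeffs_nth length_coeffs_degree)
  ultimately show ?thesis by (simp add: coeff_nth rev_nth rev_map)
next
  case False
  hence "poly.coeff p i = 0" by (simp add: coeffs_def coeff_eq_0 not_less split: if_splits)
  thus ?thesis using False assms by (simp add: coeff_length)
qed

lemma homog_eval_type_ring: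
  "homog_eval (type_ring :: 'a::field ring) d (rev (coeffs p)) x y = homog d p x y"
proof -
  interpret field "type_ring :: 'a ring" by (rule field_type_ring)
  have "coeff (rev (coeffs p)) i = poly.coeff p i" for i
    using coeff_rev_coeffs[of "\<lambda>x. x" p i] by simp
  thus ?thesis by (simp add: homog_eval_def homog_def)
qed

lemma rat_map_iterate:
  fixes f :: "'k::field poly fract"
  assumes "lowest_terms f = (p, q)"
  shows "(rat_map f ^^ n) (proj_point type_ring a b) =
    proj_point type_ring (fst ((hstep (rat_degree f) p q ^^ n) (a, b))) (snd ((hstep (rat_degree f) p q ^^ n) (a, b)))"
proof (induction n)
  case (Suc n)
  interpret field "type_ring :: 'k ring" by (rule field_type_ring)
  show ?case
    using Suc by (simp add: rat_map_def assms proj_map_point homog_eval_type_ring hstep_def)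
qed simp

text \<open>Translates a return of the orbit to \<alpha> into the vanishing of \<beta>, and a
  coincidence of two orbit points into that of a 2 by 2 determinant.\<close>

lemma proj_point_type_ring_eq_iff:
  fixes a b x y :: "'k::field"
  assumes "(a, b) \<noteq> (0, 0)" "(x, y) \<noteq> (0, 0)"
  shows "proj_point type_ring x y = proj_point type_ring a b \<longleftrightarrow> x * b - y * a = 0"
proof
  interpret field "type_ring :: 'k ring" by (rule field_type_ring)
  assume "proj_point type_ring x y = proj_point type_ring a b"
  moreover have "(1 * x, 1 * y) \<in> proj_point type_ring x y" unfolding proj_point_def by force
  ultimately obtain c where "x = c * a" "y = c * b" by (auto simp: proj_point_def)
  thus "x * b - y * a = 0" by simp
next
  interpret field "type_ring :: 'k ring" by (rule field_type_ring)
  assume "x * b - y * a = 0"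
  thus "proj_point type_ring x y = proj_point type_ring a b"
    using assms by (intro proj_point_eqI) (auto simp: mult.commute)
qed

section \<open>The residue field\<close>

locale nonarch =
  fixes v :: "'k::field \<Rightarrow> real"
  assumes v: "nonarch_absval v"
begin

abbreviation "k \<equiv> residue_field v"
abbreviation "\<rho> \<equiv> residue v"

lemma val_ring_simps [simp]:
  "carrier (val_ring v) = {x. v x \<le> 1}" "\<one>\<^bsub>val_ring v\<^esub> = 1" "\<zero>\<^bsub>val_ring v\<^esub> = 0"
  "x \<otimes>\<^bsub>val_ring v\<^esub> y = x * y" "x \<oplus>\<^bsub>val_ring v\<^esub> y = x + y"
  by (simp_all add: val_ring_def ring_of_type_algebra_def)

lemma le_mult: "v x \<le> 1 \<Longrightarrow> v y \<le> 1 \<Longrightarrow> v (x * y) \<le> 1"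
  by (simp add: nonarchD[OF v] mult_le_one)

lemma le_add: "v x \<le> 1 \<Longrightarrow> v y \<le> 1 \<Longrightarrow> v (x + y) \<le> 1"
  by (rule order.trans[OF nonarchD(4)[OF v]]) simp

lemma less_add: "v x < 1 \<Longrightarrow> v y < 1 \<Longrightarrow> v (x + y) < 1"
  by (rule le_less_trans[OF nonarchD(4)[OF v]]) simp

lemma less_mult: "v x < 1 \<Longrightarrow> v y \<le> 1 \<Longrightarrow> v (x * y) < 1"
  using mult_left_le[of "v y" "v x"] nonarchD(1)[OF v, of x] by (simp add: nonarchD(3)[OF v])

lemma le_sum: "(\<And>i. i \<in> A \<Longrightarrow> v (f i) \<le> 1) \<Longrightarrow> v (sum f A) \<le> 1"
  by (rule nonarch_sum_le[OF v]) auto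

lemma le_power: "v x \<le> 1 \<Longrightarrow> v (x ^ n) \<le> 1"
  by (simp add: nonarch_power[OF v] power_le_one nonarchD[OF v])

lemma val_ring_cring: "cring (val_ring v)"
proof (rule cringI)
  show "abelian_group (val_ring v)"
  proof (rule abelian_groupI)
    fix x assume "x \<in> carrier (val_ring v)"
    thus "\<exists>y\<in>carrier (val_ring v). y \<oplus>\<^bsub>val_ring v\<^esub> x = \<zero>\<^bsub>val_ring v\<^esub>"
      by (intro bexI[of _ "- x"]) (auto simp: nonarch_minus[OF v])
  qed (auto simp: le_add nonarchD(5)[OF v] add_ac)
  show "comm_monoid (val_ring v)"
    by (rule comm_monoidI) (auto simp: le_mult nonarch_one[OF v] mult_ac)
qed (auto simp: distrib_right)

lemma val_ideal_ideal: "ideal (val_ideal v) (val_ring v)"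
proof (rule idealI)
  show "ring (val_ring v)" by (rule cring.axioms(1)[OF val_ring_cring])
  interpret R: cring "val_ring v" by (rule val_ring_cring)
  show "subgroup (val_ideal v) (add_monoid (val_ring v))"
  proof (rule R.add.subgroupI)
    show "val_ideal v \<subseteq> carrier (val_ring v)" by (auto simp: val_ideal_def)
    have "0 \<in> val_ideal v" by (simp add: val_ideal_def nonarchD(5)[OF v])
    thus "val_ideal v \<noteq> {}" by blast
  next
    fix a assume a: "a \<in> val_ideal v"
    hence "\<ominus>\<^bsub>val_ring v\<^esub> a = - a"
      by (intro R.minus_equality) (auto simp: val_ideal_def nonarch_minus[OF v])
    thus "\<ominus>\<^bsub>val_ring v\<^esub> a \<in> val_ideal v" using a by (simp add: val_ideal_def nonarch_minus[OF v])
  qed (auto simp: val_ideal_def less_add)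
qed (auto simp: val_ideal_def less_mult mult.commute)

sublocale I: ideal "val_ideal v" "val_ring v" by (rule val_ideal_ideal)

text \<open>An element of the valuation ring outside the ideal has absolute value 1, so its inverse
  lies in the ring too.\<close>

lemma val_ideal_maximal: "maximalideal (val_ideal v) (val_ring v)"
proof (rule maximalidealI[OF val_ideal_ideal])
  have "1 \<notin> val_ideal v" by (simp add: val_ideal_def nonarch_one[OF v])
  thus "carrier (val_ring v) \<noteq> val_ideal v" by (auto simp: nonarch_one[OF v])
next
  fix J assume J: "ideal J (val_ring v)" "val_ideal v \<subseteq> J" "J \<subseteq> carrier (val_ring v)"
  interpret J: ideal J "val_ring v" by (rule J)
  show "J = val_ideal v \<or> J = carrier (val_ring v)"
  proof (rule disjCI)
    assume "J \<noteq> carrier (val_ring v)"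
    show "J = val_ideal v"
    proof (rule ccontr)
      assume "J \<noteq> val_ideal v"
      then obtain x where x: "x \<in> J" "\<not> v x < 1" using J by (auto simp: val_ideal_def)
      hence x1: "v x = 1" using J by force
      hence "inverse x * x \<in> J"
        using J.I_l_closed[OF x(1), of "inverse x"] by (simp add: nonarch_inverse[OF v])
      moreover have "x \<noteq> 0" using x1 by (auto simp: nonarchD(5)[OF v])
      ultimately have "1 \<in> J" by simp
      hence "carrier (val_ring v) = J" using J.one_imp_carrier by simp
      thus False using \<open>J \<noteq> carrier (val_ring v)\<close> by simp
    qed
  qed
qed

sublocale k: field k
  unfolding residue_field_def by (rule maximalideal.quotient_is_field[OF val_ideal_maximal val_ring_cring])

lemma residue_hom: "\<rho> \<in> ring_hom (val_ring v) k"
proof -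
  have "\<rho> = (+>\<^bsub>val_ring v\<^esub>) (val_ideal v)" by (rule ext) (simp add: residue_def)
  thus ?thesis unfolding residue_field_def using I.rcos_ring_hom by simp
qed

lemma residue_closed [simp]: "v x \<le> 1 \<Longrightarrow> \<rho> x \<in> carrier k"
  using ring_hom_closed[OF residue_hom] by simp

lemma residue_mult: "v x \<le> 1 \<Longrightarrow> v y \<le> 1 \<Longrightarrow> \<rho> (x * y) = \<rho> x \<otimes>\<^bsub>k\<^esub> \<rho> y"
  using ring_hom_mult[OF residue_hom, of x y] by simp

lemma residue_add: "v x \<le> 1 \<Longrightarrow> v y \<le> 1 \<Longrightarrow> \<rho> (x + y) = \<rho> x \<oplus>\<^bsub>k\<^esub> \<rho> y"
  using ring_hom_add[OF residue_hom, of x y] by simp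

lemma residue_one: "\<rho> 1 = \<one>\<^bsub>k\<^esub>"
  using ring_hom_one[OF residue_hom] by simp

lemma residue_eq_zero_iff: "v x \<le> 1 \<Longrightarrow> \<rho> x = \<zero>\<^bsub>k\<^esub> \<longleftrightarrow> v x < 1"
proof -
  assume x: "v x \<le> 1"
  have z: "\<zero>\<^bsub>k\<^esub> = val_ideal v" by (simp add: residue_field_def FactRing_def)
  show ?thesis
    unfolding z residue_def
    using I.a_rcos_self[of x] I.a_rcos_const[of x] x by (auto simp: val_ideal_def)
qed

lemma residue_zero [simp]: "\<rho> 0 = \<zero>\<^bsub>k\<^esub>"
  by (subst residue_eq_zero_iff) (simp_all add: nonarchD(5)[OF v])

lemma residue_power: "v x \<le> 1 \<Longrightarrow> \<rho> (x ^ n) = \<rho> x [^]\<^bsub>k\<^esub> n"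
  by (induction n) (simp_all add: residue_one residue_mult le_power k.m_comm)

lemma residue_sum: "finite A \<Longrightarrow> (\<And>i. i \<in> A \<Longrightarrow> v (f i) \<le> 1) \<Longrightarrow> \<rho> (sum f A) = finsum k (\<lambda>i. \<rho> (f i)) A"
proof (induction A rule: finite_induct)
  case (insert i A)
  thus ?case by (subst k.finsum_insert) (auto simp: residue_add le_sum)
qed simp

lemma residue_eqI:
  assumes "v x \<le> 1" "v y \<le> 1" "v (x - y) < 1"
  shows "\<rho> x = \<rho> y"
proof -
  have "\<rho> (x - y + y) = \<rho> (x - y) \<oplus>\<^bsub>k\<^esub> \<rho> y" using assms by (intro residue_add) auto
  thus ?thesis using assms by (simp add: residue_eq_zero_iff[THEN iffD2])
qed

definition integral_poly :: "'k poly \<Rightarrow> bool" where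
  "integral_poly p \<longleftrightarrow> (\<forall>i. v (poly.coeff p i) \<le> 1)"

lemma coeff_reduce_poly: "k.coeff (reduce_poly v p) i = \<rho> (poly.coeff p i)"
  unfolding reduce_poly_def by (subst k.normalize_coeff[symmetric], subst k.coeff_rev_coeffs) simp_all

lemma set_coeffs_carrier: "integral_poly p \<Longrightarrow> set (map \<rho> (rev (coeffs p))) \<subseteq> carrier k"
  by (auto simp: integral_poly_def coeffs_def)

lemma set_reduce_poly: "integral_poly p \<Longrightarrow> set (reduce_poly v p) \<subseteq> carrier k"
  unfolding reduce_poly_def by (rule k.normalize_in_carrier[OF set_coeffs_carrier])

lemma homog_eval_reduce:
  assumes p: "integral_poly p" and x: "v x \<le> 1" "v y \<le> 1"
  shows "homog_eval k d (reduce_poly v p) (\<rho> x) (\<rho> y) = \<rho> (homog d p x y)"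
    and "v (homog d p x y) \<le> 1"
proof -
  have t: "v (poly.coeff p i * x ^ i * y ^ (d - i)) \<le> 1" for i
    using p x by (intro le_mult le_power) (auto simp: integral_poly_def)
  show "v (homog d p x y) \<le> 1" unfolding homog_def by (rule le_sum[OF t])
  have c: "v (poly.coeff p i) \<le> 1" for i using p by (simp add: integral_poly_def)
  have "\<rho> (homog d p x y) = finsum k (\<lambda>i. \<rho> (poly.coeff p i * x ^ i * y ^ (d - i))) {..d}"
    unfolding homog_def by (rule residue_sum) (use t in auto)
  also have "(\<lambda>i. \<rho> (poly.coeff p i * x ^ i * y ^ (d - i))) =
      (\<lambda>i. k.coeff (reduce_poly v p) i \<otimes>\<^bsub>k\<^esub> \<rho> x [^]\<^bsub>k\<^esub> i \<otimes>\<^bsub>k\<^esub> \<rho> y [^]\<^bsub>k\<^esub> (d - i))"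
    by (rule ext) (simp add: residue_mult residue_power le_mult le_power c x coeff_reduce_poly)
  finally show "homog_eval k d (reduce_poly v p) (\<rho> x) (\<rho> y) = \<rho> (homog d p x y)"
    by (simp add: homog_eval_def)
qed

lemma eval_reduce:
  assumes p: "integral_poly p" and x: "v x \<le> 1"
  shows "k.eval (reduce_poly v p) (\<rho> x) = \<rho> (poly p x)" and "v (poly p x) \<le> 1"
proof -
  let ?d = "degree p"
  have c: "v (poly.coeff p i) \<le> 1" for i using p by (simp add: integral_poly_def)
  have t: "v (poly.coeff p i * x ^ i) \<le> 1" for i
    using c x by (intro le_mult le_power) auto
  show "v (poly p x) \<le> 1" unfolding poly_altdef by (rule le_sum[OF t])
  have "length (reduce_poly v p) \<le> length (map \<rho> (rev (coeffs p)))"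
    unfolding reduce_poly_def by (rule k.normalize_length_le)
  also have "\<dots> \<le> Suc ?d" by (simp add: length_coeffs coeffs_def)
  finally have "k.eval (reduce_poly v p) (\<rho> x) = finsum k (\<lambda>i. k.coeff (reduce_poly v p) i \<otimes>\<^bsub>k\<^esub> \<rho> x [^]\<^bsub>k\<^esub> i) {..?d}"
    by (rule k.eval_finsum[OF set_reduce_poly[OF p] residue_closed[OF x]])
  also have "(\<lambda>i. k.coeff (reduce_poly v p) i \<otimes>\<^bsub>k\<^esub> \<rho> x [^]\<^bsub>k\<^esub> i) = (\<lambda>i. \<rho> (poly.coeff p i * x ^ i))"
    by (rule ext) (simp add: residue_mult residue_power le_power c x coeff_reduce_poly)
  also have "finsum k (\<lambda>i. \<rho> (poly.coeff p i * x ^ i)) {..?d} = \<rho> (poly p x)"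
    unfolding poly_altdef by (rule residue_sum[symmetric]) (use t in auto)
  finally show "k.eval (reduce_poly v p) (\<rho> x) = \<rho> (poly p x)" .
qed

end

context nonarch
begin

section \<open>Good reduction\<close>

abbreviation "L \<equiv> k.alg_closure"

sublocale L: algebraic_closure L "k.indexed_const ` carrier k"
  by (rule k.alg_closureE)

lemma closure_hom: "ring_hom_ring k L k.indexed_const"
  by (rule ring_hom_ringI2[OF k.is_ring L.is_ring k.alg_closureE(2)])

abbreviation "\<eta> x \<equiv> k.indexed_const (\<rho> x)"

lemma eta_closed [simp]: "v x \<le> 1 \<Longrightarrow> \<eta> x \<in> carrier L"
  using ring_hom_closed[OF k.alg_closureE(2)] by simp

lemma eta_mult: "v x \<le> 1 \<Longrightarrow> v y \<le> 1 \<Longrightarrow> \<eta> (x * y) = \<eta> x \<otimes>\<^bsub>L\<^esub> \<eta> y"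
  using ring_hom_mult[OF k.alg_closureE(2)] by (simp add: residue_mult)

lemma eta_add: "v x \<le> 1 \<Longrightarrow> v y \<le> 1 \<Longrightarrow> \<eta> (x + y) = \<eta> x \<oplus>\<^bsub>L\<^esub> \<eta> y"
  using ring_hom_add[OF k.alg_closureE(2)] by (simp add: residue_add)

lemma eta_one: "\<eta> 1 = \<one>\<^bsub>L\<^esub>"
  using ring_hom_one[OF k.alg_closureE(2)] by (simp add: residue_one)

lemma closure_zero [simp]: "k.indexed_const \<zero>\<^bsub>k\<^esub> = \<zero>\<^bsub>L\<^esub>"
  by (rule ring_hom_zero[OF k.alg_closureE(2) k.is_ring L.is_ring])

text \<open>The list of reduced coefficients is deliberately not normalized: this way evaluation
  satisfies Horner's recursion along \<open>pCons\<close>, whether or not leading residues vanish,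
  and is additive and multiplicative in p.\<close>

definition closure_eval :: "'k poly \<Rightarrow> _ \<Rightarrow> _" where
  "closure_eval p x = L.eval (map \<eta> (rev (coeffs p))) x"

lemma integral_poly_pCons [simp]: "integral_poly (pCons a p) \<longleftrightarrow> v a \<le> 1 \<and> integral_poly p"
  unfolding integral_poly_def by (auto simp: coeff_pCons split: nat.splits)

lemma integral_poly_0 [simp]: "integral_poly 0"
  by (simp add: integral_poly_def nonarchD(5)[OF v])

lemma integral_poly_add: "integral_poly p \<Longrightarrow> integral_poly q \<Longrightarrow> integral_poly (p + q)"
  by (auto simp: integral_poly_def intro!: le_add)

lemma integral_poly_mult: "integral_poly p \<Longrightarrow> integral_poly q \<Longrightarrow> integral_poly (p * q)"
  by (auto simp: integral_poly_def coeff_mult intro!: le_sum le_mult)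

lemma integral_poly_smult: "v a \<le> 1 \<Longrightarrow> integral_poly q \<Longrightarrow> integral_poly (Polynomial.smult a q)"
  by (auto simp: integral_poly_def intro!: le_mult)

lemma closure_eval_closed:
  assumes "integral_poly p" "x \<in> carrier L"
  shows "closure_eval p x \<in> carrier L"
  unfolding closure_eval_def
  by (rule L.eval_in_carrier) (use assms in \<open>auto simp: integral_poly_def coeffs_def\<close>)

lemma closure_eval_0: "closure_eval 0 x = \<zero>\<^bsub>L\<^esub>"
  by (simp add: closure_eval_def)

lemma closure_eval_pCons:
  assumes p: "integral_poly p" and a: "v a \<le> 1" and x: "x \<in> carrier L"
  shows "closure_eval (pCons a p) x = closure_eval p x \<otimes>\<^bsub>L\<^esub> x \<oplus>\<^bsub>L\<^esub> \<eta> a"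
proof (cases "a = 0 \<and> p = 0")
  case True
  thus ?thesis using x by (simp add: closure_eval_def)
next
  case False
  hence "coeffs (pCons a p) = a # coeffs p" by (simp add: cCons_def) (auto simp: coeffs_eq_Nil)
  hence "closure_eval (pCons a p) x = L.eval (map \<eta> (rev (coeffs p)) @ [\<eta> a]) x"
    by (simp add: closure_eval_def)
  also have "\<dots> = L.eval (map \<eta> (rev (coeffs p))) x \<otimes>\<^bsub>L\<^esub> x \<oplus>\<^bsub>L\<^esub> \<eta> a"
    by (rule L.eval_append_aux) (use p a x in \<open>auto simp: integral_poly_def coeffs_def\<close>)
  finally show ?thesis by (simp add: closure_eval_def)
qed

lemma closure_eval_add:
  assumes x: "x \<in> carrier L"
  shows "integral_poly p \<Longrightarrow> integral_poly q \<Longrightarrow>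
    closure_eval (p + q) x = closure_eval p x \<oplus>\<^bsub>L\<^esub> closure_eval q x"
proof (induction p q rule: poly_induct2)
  case 0
  show ?case by (simp add: closure_eval_0)
next
  case (pCons a p b q)
  have pq: "integral_poly (p + q)" using pCons.prems by (simp add: integral_poly_add)
  have c: "closure_eval p x \<in> carrier L" "closure_eval q x \<in> carrier L" "\<eta> a \<in> carrier L" "\<eta> b \<in> carrier L"
    using pCons.prems x by (auto intro: closure_eval_closed)
  show ?case
    using pCons x pq c by (simp add: closure_eval_pCons le_add eta_add L.l_distr L.a_ac)
qed

lemma closure_eval_smult:
  assumes x: "x \<in> carrier L" and a: "v a \<le> 1"
  shows "integral_poly q \<Longrightarrow> closure_eval (Polynomial.smult a q) x = \<eta> a \<otimes>\<^bsub>L\<^esub> closure_eval q x"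
proof (induction q)
  case 0
  show ?case using a by (simp add: closure_eval_0)
next
  case (pCons b q)
  have c: "closure_eval q x \<in> carrier L" "\<eta> b \<in> carrier L" "\<eta> a \<in> carrier L"
    using pCons.prems x a by (auto intro: closure_eval_closed)
  show ?case
    using pCons x a c by (simp add: closure_eval_pCons integral_poly_smult le_mult eta_mult L.r_distr L.m_assoc)
qed

lemma closure_eval_mult:
  assumes x: "x \<in> carrier L" and q: "integral_poly q"
  shows "integral_poly p \<Longrightarrow> closure_eval (p * q) x = closure_eval p x \<otimes>\<^bsub>L\<^esub> closure_eval q x"
proof (induction p)
  case 0
  show ?case using closure_eval_closed[OF q x] by (simp add: closure_eval_0)
next
  case (pCons a p)
  hence p: "integral_poly p" "v a \<le> 1" by auto
  have c: "closure_eval p x \<in> carrier L" "closure_eval q x \<in> carrier L" "\<eta> a \<in> carrier L"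
    using p x q by (auto intro: closure_eval_closed)
  have "closure_eval (pCons a p * q) x = closure_eval (Polynomial.smult a q) x \<oplus>\<^bsub>L\<^esub> closure_eval (pCons 0 (p * q)) x"
    using p q x by (simp add: closure_eval_add integral_poly_smult integral_poly_mult nonarchD(5)[OF v])
  also have "\<dots> = \<eta> a \<otimes>\<^bsub>L\<^esub> closure_eval q x \<oplus>\<^bsub>L\<^esub> (closure_eval p x \<otimes>\<^bsub>L\<^esub> closure_eval q x) \<otimes>\<^bsub>L\<^esub> x"
    using pCons p q x c by (simp add: closure_eval_smult closure_eval_pCons integral_poly_mult nonarchD(5)[OF v])
  also have "\<dots> = closure_eval (pCons a p) x \<otimes>\<^bsub>L\<^esub> closure_eval q x"
    using p x c by (simp add: closure_eval_pCons L.l_distr L.r_distr L.m_ac L.a_ac)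
  finally show ?case .
qed

lemma reduce_poly_unit_lead:
  assumes "p = 0 \<or> v (lead_coeff p) = 1"
  shows "reduce_poly v p = map \<rho> (rev (coeffs p))"
proof (cases "p = 0")
  case True
  thus ?thesis by (simp add: reduce_poly_def)
next
  case False
  then obtain l where l: "rev (coeffs p) = lead_coeff p # l"
    by (metis coeffs_eq_Nil hd_rev last_coeffs_eq_coeff_degree list.exhaust_sel rev_is_Nil_conv)
  have "\<rho> (lead_coeff p) \<noteq> \<zero>\<^bsub>k\<^esub>" using assms False by (simp add: residue_eq_zero_iff)
  thus ?thesis unfolding reduce_poly_def l by simp
qed

text \<open>A Bezout relation with integral coefficients survives reduction and excludes a common
  root in the algebraic closure; unit leading coefficients preserve the degrees.\<close>

lemma good_modelI:
  assumes lt: "lowest_terms f = (p, q)" and bez: "u * p + w * q = 1"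
    and int: "integral_poly p" "integral_poly q" "integral_poly u" "integral_poly w"
    and lead: "p = 0 \<or> v (lead_coeff p) = 1" "q = 0 \<or> v (lead_coeff q) = 1"
  shows "good_model v f p q"
proof -
  have d: "Polynomials.degree (reduce_poly v r) = degree r"
    if "r = 0 \<or> v (lead_coeff r) = 1" for r
    using reduce_poly_unit_lead[OF that] by (cases "r = 0") (simp_all add: length_coeffs_degree)
  have "\<not> common_root_in_closure k (reduce_poly v p) (reduce_poly v q)"
  proof
    assume "common_root_in_closure k (reduce_poly v p) (reduce_poly v q)"
    then obtain x where x: "x \<in> carrier L" "closure_eval p x = \<zero>\<^bsub>L\<^esub>" "closure_eval q x = \<zero>\<^bsub>L\<^esub>"
      by (auto simp: common_root_in_closure_def reduce_poly_unit_lead[OF lead(1)] reduce_poly_unit_lead[OF lead(2)]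
          k.\<sigma>_def closure_eval_def comp_def)
    have "closure_eval (u * p + w * q) x = \<zero>\<^bsub>L\<^esub>"
      using x int by (simp add: closure_eval_add closure_eval_mult integral_poly_mult closure_eval_closed)
    moreover have "closure_eval 1 x = \<one>\<^bsub>L\<^esub>"
      using x nonarch_one[OF v] by (simp add: one_pCons closure_eval_pCons closure_eval_0 eta_one)
    ultimately show False unfolding bez by simp
  qed
  moreover have rd: "rat_degree f = max (degree p) (degree q)"
    by (simp add: rat_degree_def lt)
  ultimately show ?thesis
    unfolding good_model_def rd d[OF lead(1)] d[OF lead(2)]
    using lowest_terms[OF lt] int by (simp add: integral_poly_def)
qed

section \<open>Reduction commutes with iteration\<close>

lemma reduce_point:
  assumes ab: "max (v a) (v b) = 1"
  shows "reduce_point v (proj_point type_ring a b) = proj_point k (\<rho> a) (\<rho> b)"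
proof -
  have le: "v a \<le> 1" "v b \<le> 1" using ab by auto
  have "(\<lambda>(x, y). proj_point k (\<rho> x) (\<rho> y)) ` {(x, y) \<in> proj_point type_ring a b. max (v x) (v y) = 1} =
      {proj_point k (\<rho> a) (\<rho> b)}" (is "?f ` ?S = {?r}")
  proof
    show "?f ` ?S \<subseteq> {?r}"
    proof
      fix P assume "P \<in> ?f ` ?S"
      then obtain c where c: "max (v (c * a)) (v (c * b)) = 1" "P = proj_point k (\<rho> (c * a)) (\<rho> (c * b))"
        by (auto simp: proj_point_def)
      have "v c * max (v a) (v b) = max (v c * v a) (v c * v b)"
        using nonarchD(1)[OF v] by (simp add: max_mult_distrib_left)
      hence vc: "v c = 1" using c(1) ab by (simp add: nonarchD(3)[OF v])
      hence "\<rho> c \<in> carrier k - {\<zero>\<^bsub>k\<^esub>}" by (simp add: residue_eq_zero_iff)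
      thus "P \<in> {?r}" using vc le c(2) by (simp add: residue_mult k.proj_point_scale)
    qed
    have "(1 * a, 1 * b) \<in> proj_point type_ring a b" unfolding proj_point_def by force
    hence "(a, b) \<in> ?S" using ab by simp
    thus "{?r} \<subseteq> ?f ` ?S" by force
  qed
  thus ?thesis by (simp add: reduce_point_def)
qed

text \<open>If both values were smaller than 1, the reduced forms would have a common zero. For
  \<open>v y = 1\<close> this is a common root x / y; otherwise it is the point at infinity, and
  both reduced coefficients of degree d vanish, against the degree condition.\<close>

lemma good_model_nonvanishing:
  assumes good: "good_model v f p q" and d: "rat_degree f > 0" and xy: "max (v x) (v y) = 1"
  shows "max (v (homog (rat_degree f) p x y)) (v (homog (rat_degree f) q x y)) = 1"
proof (rule ccontr)
  let ?d = "rat_degree f"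
  assume ne: "\<not> ?thesis"
  have int: "integral_poly p" "integral_poly q" using good by (auto simp: good_model_def integral_poly_def)
  have le: "v x \<le> 1" "v y \<le> 1" using xy by auto
  have deg: "degree p \<le> ?d" "degree q \<le> ?d"
    "max (Polynomials.degree (reduce_poly v p)) (Polynomials.degree (reduce_poly v q)) = ?d"
    using good by (auto simp: good_model_def)
  have "v (homog ?d p x y) \<le> 1" "v (homog ?d q x y) \<le> 1" using homog_eval_reduce(2) int le by auto
  hence small: "v (homog ?d p x y) < 1" "v (homog ?d q x y) < 1" using ne by auto
  show False
  proof (cases "v y = 1")
    case True
    hence y0: "y \<noteq> 0" by (auto simp: nonarchD(5)[OF v])
    define \<xi> where "\<xi> = x / y"
    have \<xi>: "v \<xi> \<le> 1" using le True by (simp add: \<xi>_def nonarch_divide[OF v])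
    have root: "L.eval (k.\<sigma> (reduce_poly v r)) (\<eta> \<xi>) = \<zero>\<^bsub>L\<^esub>"
      if r: "integral_poly r" "degree r \<le> ?d" "v (homog ?d r x y) < 1" for r
    proof -
      have "v (poly r \<xi>) < 1"
        using r(3) homog_eq_poly[OF r(2) y0, of x] True
        by (simp add: \<xi>_def nonarchD(3)[OF v] nonarch_power[OF v])
      hence "k.eval (reduce_poly v r) (\<rho> \<xi>) = \<zero>\<^bsub>k\<^esub>"
        using eval_reduce[OF r(1) \<xi>] by (simp add: residue_eq_zero_iff)
      moreover have "k.indexed_const (k.eval (reduce_poly v r) (\<rho> \<xi>)) = L.eval (map k.indexed_const (reduce_poly v r)) (\<eta> \<xi>)"
        by (rule ring_hom_ring.eval_hom'[OF closure_hom residue_closed[OF \<xi>] set_reduce_poly[OF r(1)]])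
      ultimately show ?thesis
        by (simp add: k.\<sigma>_def)
    qed
    have "common_root_in_closure k (reduce_poly v p) (reduce_poly v q)"
      unfolding common_root_in_closure_def
      using root[OF int(1) deg(1) small(1)] root[OF int(2) deg(2) small(2)] eta_closed[OF \<xi>] by blast
    thus False using good by (simp add: good_model_def)
  next
    case False
    hence y: "v y < 1" and x: "v x = 1" using xy le by (auto simp: max_def split: if_splits)
    have zero: "k.coeff (reduce_poly v r) ?d = \<zero>\<^bsub>k\<^esub>"
      if r: "integral_poly r" "v (homog ?d r x y) < 1" for r
    proof -
      have c: "v (poly.coeff r i) \<le> 1" for i using r by (simp add: integral_poly_def)
      have split: "homog ?d r x y = (\<Sum>i<?d. poly.coeff r i * x ^ i * y ^ (?d - i)) + poly.coeff r ?d * x ^ ?d"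
        unfolding homog_def by (simp flip: lessThan_Suc_atMost)
      have "v (\<Sum>i<?d. poly.coeff r i * x ^ i * y ^ (?d - i)) < 1"
      proof (rule nonarch_sum_less[OF v])
        fix i assume "i \<in> {..<?d}"
        hence "y ^ (?d - i) = y * y ^ (?d - i - 1)" by (cases "?d - i") auto
        moreover have "v (y * (poly.coeff r i * x ^ i * y ^ (?d - i - 1))) < 1"
          by (intro less_mult y le_mult le_power c le)
        ultimately show "v (poly.coeff r i * x ^ i * y ^ (?d - i)) < 1" by (simp add: mult_ac)
      qed simp
      moreover have "poly.coeff r ?d * x ^ ?d = homog ?d r x y - (\<Sum>i<?d. poly.coeff r i * x ^ i * y ^ (?d - i))"
        by (simp add: split)
      ultimately have "v (poly.coeff r ?d * x ^ ?d) < 1"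
        using r(2) nonarch_diff[OF v, of "homog ?d r x y" "\<Sum>i<?d. poly.coeff r i * x ^ i * y ^ (?d - i)"] by simp
      hence "v (poly.coeff r ?d) < 1" using x by (simp add: nonarchD(3)[OF v] nonarch_power[OF v])
      thus ?thesis unfolding coeff_reduce_poly using c by (simp add: residue_eq_zero_iff)
    qed
    have lead: "k.coeff (reduce_poly v r) ?d \<noteq> \<zero>\<^bsub>k\<^esub>"
      if r: "integral_poly r" "Polynomials.degree (reduce_poly v r) = ?d" for r
    proof -
      have ne: "reduce_poly v r \<noteq> []" using r d by auto
      have "polynomial\<^bsub>k\<^esub> (carrier k) (reduce_poly v r)"
        unfolding reduce_poly_def by (rule k.normalize_gives_polynomial[OF set_coeffs_carrier[OF r(1)]])
      hence "Polynomials.lead_coeff (reduce_poly v r) \<noteq> \<zero>\<^bsub>k\<^esub>" using ne by (simp add: polynomial_def)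
      thus ?thesis using k.lead_coeff_simp[OF ne] r(2) by simp
    qed
    show False
      using deg(3) zero[OF int(1) small(1)] zero[OF int(2) small(2)] lead[OF int(1)] lead[OF int(2)]
      by (auto simp: max_def split: if_splits)
  qed
qed

text \<open>Good reduction keeps the coordinates normalized along the orbit, so iteration and
  reduction commute without rescaling. The hypothesis on \<open>SOME\<close> names the model that
  \<open>reduced_map\<close> uses.\<close>

lemma reduced_map_iterate:
  assumes good: "good_model v f p q" and pq: "(SOME (p, q). good_model v f p q) = (p, q)"
    and d: "rat_degree f > 0" and ab: "max (v a) (v b) = 1"
  defines "Z \<equiv> \<lambda>n. (hstep (rat_degree f) p q ^^ n) (a, b)"
  shows "max (v (fst (Z n))) (v (snd (Z n))) = 1 \<and>
    (reduced_map v f ^^ n) (proj_point k (\<rho> a) (\<rho> b)) = proj_point k (\<rho> (fst (Z n))) (\<rho> (snd (Z n)))"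
proof (induction n)
  case 0
  thus ?case using ab by (simp add: Z_def)
next
  case (Suc n)
  have int: "integral_poly p" "integral_poly q" using good by (auto simp: good_model_def integral_poly_def)
  have le: "v (fst (Z n)) \<le> 1" "v (snd (Z n)) \<le> 1" using Suc by auto
  have S: "Z (Suc n) = hstep (rat_degree f) p q (Z n)" by (simp add: Z_def)
  have "(reduced_map v f ^^ Suc n) (proj_point k (\<rho> a) (\<rho> b)) =
      reduced_map v f (proj_point k (\<rho> (fst (Z n))) (\<rho> (snd (Z n))))"
    using Suc by simp
  also have "\<dots> = proj_point k (\<rho> (fst (Z (Suc n)))) (\<rho> (snd (Z (Suc n))))"
    unfolding reduced_map_def pq using int le
    by (simp add: k.proj_map_point set_reduce_poly homog_eval_reduce S hstep_def)
  finally show ?case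
    using good_model_nonvanishing[OF good d] Suc by (simp add: S hstep_def)
qed

text \<open>The condition \<open>close\<close> is homogeneous in the coordinates of both points,
  hence independent of their choice. The proof passes to normalized coordinates of \<alpha> and to
  the chosen good model, a constant multiple of the lowest terms; the iterates change only by a
  factor \<kappa>, and closeness becomes equality of residues.\<close>

lemma periodic_reduction:
  assumes good: "good_reduction v f" and lt: "lowest_terms f = (p0, q0)" and d: "rat_degree f > 0"
    and ab: "(a, b) \<noteq> (0, 0)" and n: "n > 0"
  defines "z \<equiv> (hstep (rat_degree f) p0 q0 ^^ n) (a, b)"
  assumes close: "v (fst z * b - snd z * a) < max (v (fst z)) (v (snd z)) * max (v a) (v b)"
  shows "periodic (reduced_map v f) (reduce_point v (proj_point type_ring a b))"
proof -
  let ?d = "rat_degree f"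
  obtain p q where pq: "(SOME (p, q). good_model v f p q) = (p, q)" by force
  have "\<exists>x. (\<lambda>(p, q). good_model v f p q) x" using good by (auto simp: good_reduction_def)
  from someI_ex[OF this] have gm: "good_model v f p q" unfolding pq by simp
  obtain c where c: "c \<noteq> 0" "p = Polynomial.smult c p0" "q = Polynomial.smult c q0"
  proof -
    have "Fract p q = Fract p0 q0" "q \<noteq> 0" using gm lowest_terms(3)[OF lt] by (auto simp: good_model_def)
    moreover have "max (degree p) (degree q) = max (degree p0) (degree q0)"
      using gm by (simp add: good_model_def rat_degree_def lt)
    ultimately show ?thesis using that fract_lowest_multiple lowest_terms(1,2)[OF lt] by blast
  qed
  \<comment> \<open>The coordinate of larger absolute value; dividing by it normalizes (a,
    b).\<close>
  define m where "m = (if v a \<le> v b then b else a)"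
  have m: "v m = max (v a) (v b)" "m \<noteq> 0"
    using ab nonarch_pos[OF v, of a] nonarch_pos[OF v, of b]
    by (auto simp: m_def max_def nonarchD(5)[OF v] split: if_splits)
  have vm: "v m > 0" by (rule nonarch_pos[OF v m(2)])
  define a' b' where "a' = inverse m * a" and "b' = inverse m * b"
  have ab': "max (v a') (v b') = 1"
  proof -
    have "max (v a') (v b') = inverse (v m) * max (v a) (v b)"
      using vm by (simp add: a'_def b'_def nonarchD(3)[OF v] nonarch_inverse[OF v] max_mult_distrib_left)
    thus ?thesis using vm m by simp
  qed
  have scale: "\<exists>\<kappa>. \<kappa> \<noteq> 0 \<and> (hstep ?d p q ^^ j) (a', b') =
      (\<kappa> * fst ((hstep ?d p0 q0 ^^ j) (a, b)), \<kappa> * snd ((hstep ?d p0 q0 ^^ j) (a, b)))" for j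
  proof (induction j)
    case 0
    thus ?case using m by (auto simp: a'_def b'_def intro!: exI[of _ "inverse m"])
  next
    case (Suc j)
    then obtain \<kappa> where \<kappa>: "\<kappa> \<noteq> 0" "(hstep ?d p q ^^ j) (a', b') =
      (\<kappa> * fst ((hstep ?d p0 q0 ^^ j) (a, b)), \<kappa> * snd ((hstep ?d p0 q0 ^^ j) (a, b)))" by blast
    have "hstep ?d p q (\<kappa> * s, \<kappa> * t) =
        (c * \<kappa> ^ ?d * fst (hstep ?d p0 q0 (s, t)), c * \<kappa> ^ ?d * snd (hstep ?d p0 q0 (s, t)))" for s t
      by (simp add: hstep_def c(2,3) homog_smult homog_scale mult.assoc)
    hence "(hstep ?d p q ^^ Suc j) (a', b') =
        (c * \<kappa> ^ ?d * fst ((hstep ?d p0 q0 ^^ Suc j) (a, b)), c * \<kappa> ^ ?d * snd ((hstep ?d p0 q0 ^^ Suc j) (a, b)))"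
      by (simp only: funpow.simps comp_apply \<kappa>(2) prod.collapse)
    thus ?case using \<kappa>(1) c(1) by (intro exI[of _ "c * \<kappa> ^ ?d"]) simp
  qed
  obtain \<kappa> where \<kappa>: "\<kappa> \<noteq> 0" "(hstep ?d p q ^^ n) (a', b') = (\<kappa> * fst z, \<kappa> * snd z)"
    using scale[of n] by (auto simp: z_def)
  note it = reduced_map_iterate[OF gm pq d ab', of n, unfolded \<kappa>(2) fst_conv snd_conv]
  have mx: "v \<kappa> * max (v (fst z)) (v (snd z)) = 1"
    using it by (simp add: nonarchD(3)[OF v] nonarchD(1)[OF v] max_mult_distrib_left)
  have le: "v (\<kappa> * fst z) \<le> 1" "v (\<kappa> * snd z) \<le> 1" "v a' \<le> 1" "v b' \<le> 1" using it ab' by auto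
  have "(\<kappa> * fst z) * b' - a' * (\<kappa> * snd z) = \<kappa> * inverse m * (fst z * b - snd z * a)"
    by (simp add: a'_def b'_def algebra_simps)
  hence "v ((\<kappa> * fst z) * b' - a' * (\<kappa> * snd z)) = v \<kappa> * inverse (v m) * v (fst z * b - snd z * a)"
    by (simp add: nonarchD(3)[OF v] nonarch_inverse[OF v])
  also have "\<dots> < v \<kappa> * inverse (v m) * (max (v (fst z)) (v (snd z)) * v m)"
    using close vm nonarch_pos[OF v \<kappa>(1)] unfolding m(1) by (intro mult_strict_left_mono) auto
  also have "\<dots> = (v \<kappa> * max (v (fst z)) (v (snd z))) * (inverse (v m) * v m)" by (simp add: mult_ac)
  also have "\<dots> = 1" using mx vm by simp
  finally have cl: "v ((\<kappa> * fst z) * b' - a' * (\<kappa> * snd z)) < 1" .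
  have eq: "\<rho> ((\<kappa> * fst z) * b') = \<rho> (a' * (\<kappa> * snd z))"
    by (rule residue_eqI) (use le cl in \<open>auto intro: le_mult\<close>)
  have nz: "(\<rho> x, \<rho> y) \<noteq> (\<zero>\<^bsub>k\<^esub>, \<zero>\<^bsub>k\<^esub>)" if "max (v x) (v y) = 1" for x y
    using that by (auto simp: max_def residue_eq_zero_iff split: if_splits)
  have "proj_point k (\<rho> (\<kappa> * fst z)) (\<rho> (\<kappa> * snd z)) = proj_point k (\<rho> a') (\<rho> b')"
    by (rule k.proj_point_eqI[OF _ _ _ _ nz[OF it[THEN conjunct1]] nz[OF ab']])
      (use le eq in \<open>simp_all add: residue_mult\<close>)
  hence "(reduced_map v f ^^ n) (proj_point k (\<rho> a') (\<rho> b')) = proj_point k (\<rho> a') (\<rho> b')"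
    using it by simp
  moreover have "proj_point type_ring a b = proj_point type_ring a' b'"
  proof -
    interpret T: field "type_ring :: 'k ring" by (rule field_type_ring)
    show ?thesis using T.proj_point_scale[of "inverse m" a b] m by (simp add: a'_def b'_def)
  qed
  ultimately show ?thesis using n reduce_point[OF ab'] by (auto simp: periodic_def)
qed

end

section \<open>Periodicity modulo infinitely many places\<close>

lemma funpow_eq_imp_preperiodic:
  assumes "(F ^^ i) x = (F ^^ j) x" "i < j"
  shows "preperiodic F x"
proof -
  have "(F ^^ n) x \<in> (\<lambda>n. (F ^^ n) x) ` {..<j}" for n
  proof (induction n rule: less_induct)
    case (less n)
    show ?case
    proof (cases "n < j")
      case False
      have "(F ^^ n) x = (F ^^ (n - j)) ((F ^^ j) x)"
        using False by (simp flip: funpow_add comp_apply[of "F ^^ (n - j)"])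
      also have "\<dots> = (F ^^ (n - j + i)) x" by (simp flip: assms(1) add: funpow_add)
      finally show ?thesis using less[of "n - j + i"] False assms(2) by simp
    qed auto
  qed
  hence "range (\<lambda>n. (F ^^ n) x) \<subseteq> (\<lambda>n. (F ^^ n) x) ` {..<j}" by blast
  thus ?thesis unfolding preperiodic_def by (rule finite_subset) simp
qed

text \<open>Bounds the denominators at the exceptional places. Some natural number M is small at w,
  a power of it is below \<epsilon> there, and products keep what was gained before because natural
  numbers never exceed 1.\<close>

lemma exists_small_nat:
  fixes R :: "('k::field_char_0 \<Rightarrow> real) set"
  assumes K: "number_field TYPE('k)" and R: "finite R" "\<And>w. w \<in> R \<Longrightarrow> nonarch_absval w" and e: "\<epsilon> > 0"
  shows "\<exists>N::nat. N > 0 \<and> (\<forall>w\<in>R. w (of_nat N) \<le> \<epsilon>)"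
  using R
proof (induction R rule: finite_induct)
  case empty
  show ?case by (auto intro: exI[of _ 1])
next
  case (insert w R)
  then obtain N where N: "N > 0" "\<forall>u\<in>R. u (of_nat N) \<le> \<epsilon>" by auto
  have w: "nonarch_absval w" using insert by simp
  then obtain z where "z \<noteq> 0" "w z \<noteq> 1" by (auto simp: nonarch_absval_def)
  then obtain M where M: "M > 0" "w (of_nat M) < 1" using number_field_bad_int[OF K] w by metis
  then obtain n where n: "w (of_nat M) ^ n < \<epsilon>" using real_arch_pow_inv[OF e] by blast
  have "u (of_nat (N * M ^ n)) \<le> \<epsilon>" if u: "u \<in> insert w R" for u
  proof -
    have nu: "nonarch_absval u" using insert.prems u by auto
    have prod: "u (of_nat (N * M ^ n)) = u (of_nat N) * u (of_nat (M ^ n))"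
      by (simp add: nonarchD(3)[OF nu])
    have le: "0 \<le> u (of_nat N)" "u (of_nat N) \<le> 1" "0 \<le> u (of_nat (M ^ n))" "u (of_nat (M ^ n)) \<le> 1"
      by (rule nonarchD(1)[OF nu] nonarch_of_nat[OF nu])+
    show ?thesis
    proof (cases "u = w")
      case True
      hence "u (of_nat (M ^ n)) < \<epsilon>" using n by (simp add: nonarch_power[OF w])
      thus ?thesis unfolding prod using mult_left_le_one_le[OF le(3) le(1,2)] by simp
    next
      case False
      hence "u (of_nat N) \<le> \<epsilon>" using N u by simp
      thus ?thesis unfolding prod using mult_right_le_one_le[OF le(1) le(3,4)] by simp
    qed
  qed
  thus ?case using N(1) M(1) by (intro exI[of _ "N * M ^ n"]) simp
qed

lemma equivalent_absval_le_1:
  assumes "V \<in> nonarch_places" "u \<in> V" "v \<in> V" "u y \<le> 1"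
  shows "v y \<le> 1"
proof -
  have "(u, v) \<in> absval_equiv" using nonarch_placeD(2)[OF assms(1,2)] assms(3) by blast
  then obtain s where s: "s > 0" "v y = u y powr s" by (auto simp: absval_equiv_def)
  have "u y powr s \<le> 1 powr s"
    using s assms nonarchD(1)[OF nonarch_placeD(1)[OF assms(1,2)]] by (intro powr_mono2) auto
  thus ?thesis using s by simp
qed

text \<open>With one coordinate equal to 1, \<open>max (v a) (v b)\<close> is at least 1 at every
  place, so it can later be dropped from lower bounds for \<beta>.\<close>

lemma proj_line_normalized:
  assumes "\<alpha> \<in> proj_line (type_ring :: 'k::field ring)"
  shows "\<exists>a b. (a = 1 \<or> b = 1) \<and> \<alpha> = proj_point type_ring a b"
proof -
  interpret field "type_ring :: 'k ring" by (rule field_type_ring)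
  obtain x y where xy: "(x, y) \<noteq> (0, 0)" "\<alpha> = proj_point type_ring x y"
    using proj_line_coordinates[OF assms] by auto
  show ?thesis
  proof (cases "y = 0")
    case True
    hence "\<alpha> = proj_point type_ring 1 (inverse x * y)"
      using xy proj_point_scale[of "inverse x" x y] by auto
    thus ?thesis by blast
  next
    case False
    hence "\<alpha> = proj_point type_ring (inverse y * x) 1"
      using xy proj_point_scale[of "inverse y" x y] by auto
    thus ?thesis by blast
  qed
qed

text \<open>Where all nonzero coefficients of p, q and of the Bezout factors u, w are units,
  \<open>good_modelI\<close> applies to the lowest terms themselves.\<close>

lemma finite_bad_places:
  fixes f :: "'k::field_char_0 poly fract"
  assumes K: "number_field TYPE('k)"
  shows "finite {V \<in> nonarch_places. \<exists>v\<in>V. \<not> good_reduction v f}"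
proof -
  obtain p q where lt: "lowest_terms f = (p, q)" by force
  obtain u w where bez: "u * p + w * q = 1" using coprime_poly_bezout[OF lowest_terms(2)[OF lt]] by blast
  define S where "S = (set (coeffs p) \<union> set (coeffs q) \<union> set (coeffs u) \<union> set (coeffs w)) - {0}"
  have "{V \<in> nonarch_places. \<exists>v\<in>V. \<not> good_reduction v f} \<subseteq> (\<Union>z\<in>S. {V \<in> nonarch_places. \<exists>v\<in>V. v z \<noteq> 1})"
  proof (rule subsetI, rule ccontr)
    fix V assume "V \<in> {V \<in> nonarch_places. \<exists>v\<in>V. \<not> good_reduction v f}"
      and no: "V \<notin> (\<Union>z\<in>S. {V \<in> nonarch_places. \<exists>v\<in>V. v z \<noteq> 1})"
    then obtain v where vV: "V \<in> nonarch_places" "v \<in> V" "\<not> good_reduction v f" by blast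
    have nv: "nonarch_absval v" by (rule nonarch_placeD[OF vV(1,2)])
    interpret nonarch v by (rule nonarch.intro[OF nv])
    have unit: "v z = 1" if "z \<in> S" for z
    proof (rule ccontr)
      assume "v z \<noteq> 1"
      hence "V \<in> {V \<in> nonarch_places. \<exists>v\<in>V. v z \<noteq> 1}" using vV by blast
      thus False using no that by blast
    qed
    have int: "integral_poly r" if "set (coeffs r) - {0} \<subseteq> S" for r
      unfolding integral_poly_def
    proof
      fix i
      show "v (poly.coeff r i) \<le> 1"
      proof (cases "poly.coeff r i = 0")
        case False
        hence i: "r \<noteq> 0" "i \<le> degree r" by (auto simp: le_degree)
        hence "coeffs r ! i \<in> set (coeffs r)" by (intro nth_mem) (simp add: length_coeffs_degree)
        hence "poly.coeff r i \<in> set (coeffs r) - {0}" using i False by (simp add: coeffs_nth)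
        thus ?thesis using unit that by auto
      qed (simp add: nonarchD(5)[OF nv])
    qed
    have lead: "r = 0 \<or> v (lead_coeff r) = 1" if "set (coeffs r) - {0} \<subseteq> S" for r
    proof (cases "r = 0")
      case False
      hence "lead_coeff r \<in> set (coeffs r) - {0}" by (auto simp: coeffs_def)
      thus ?thesis using unit that by auto
    qed simp
    have sub: "set (coeffs p) - {0} \<subseteq> S" "set (coeffs q) - {0} \<subseteq> S"
      "set (coeffs u) - {0} \<subseteq> S" "set (coeffs w) - {0} \<subseteq> S"
      by (auto simp: S_def)
    have "good_model v f p q"
      by (rule good_modelI[OF lt bez int[OF sub(1)] int[OF sub(2)] int[OF sub(3)] int[OF sub(4)]
            lead[OF sub(1)] lead[OF sub(2)]])
    thus False using vV(3) by (auto simp: good_reduction_def)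
  qed
  moreover have "finite (\<Union>z\<in>S. {V \<in> nonarch_places. \<exists>v\<in>V. v z \<noteq> 1})"
    using finite_places_not_unit[OF K] by (intro finite_UN_I) (auto simp: S_def)
  ultimately show ?thesis by (rule finite_subset)
qed

theorem theorem3p1:
  fixes f :: "'k::field_char_0 poly fract"
    and d :: nat
    and \<alpha> :: "('k \<times> 'k) set"
  assumes "number_field TYPE('k)"
    and "rat_degree f = d" and "d \<ge> 2"
    and "\<alpha> \<in> proj_line (ring_of_type_algebra :: 'k ring)"
    and "\<not> strictly_preperiodic (rat_map f) \<alpha>"
  shows "infinite {V \<in> nonarch_places. \<forall>v\<in>V.
           good_reduction v f \<and> periodic (reduced_map v f) (reduce_point v \<alpha>)}"
proof -
  note K = assms(1)
  define G where "G = {V \<in> nonarch_places. \<forall>v\<in>V. good_reduction v f \<and> periodic (reduced_map v f) (reduce_point v \<alpha>)}"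
  define Bad where "Bad = {V \<in> nonarch_places. \<exists>v\<in>V. \<not> good_reduction v f}"
  have finBad: "finite Bad" unfolding Bad_def by (rule finite_bad_places[OF K])
  obtain p q where lt: "lowest_terms f = (p, q)" by force
  have d: "d = max (degree p) (degree q)" "d > 0"
    using assms(2,3) by (auto simp: rat_degree_def lt)
  have rd: "rat_degree f > 0" using assms(2) d(2) by simp
  note cop = lowest_terms(2)[OF lt]
  obtain a b where ab: "a = 1 \<or> b = 1" and \<alpha>: "\<alpha> = proj_point type_ring a b"
    using proj_line_normalized[OF assms(4)] by blast
  have ab0: "(a, b) \<noteq> (0, 0)" using ab by auto
  define Z where "Z n = (hstep d p q ^^ n) (a, b)" for n
  define x y \<beta> where "x n = fst (Z n)" and "y n = snd (Z n)" and "\<beta> n = x n * b - y n * a" for n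
  have Z0: "(x n, y n) \<noteq> (0, 0)" for n
    using hstep_iterate_nonzero[OF cop d ab0, of n] by (simp add: x_def y_def Z_def)
  have iter: "(rat_map f ^^ n) \<alpha> = proj_point type_ring (x n) (y n)" for n
    unfolding \<alpha> x_def y_def Z_def using rat_map_iterate[OF lt, of n a b] assms(2) by simp
  have red: "periodic (reduced_map v f) (reduce_point v \<alpha>)"
    if "nonarch_absval v" "good_reduction v f" "n > 0" "v (\<beta> n) < max (v (x n)) (v (y n)) * max (v a) (v b)" for v n
    using nonarch.periodic_reduction[OF nonarch.intro[OF that(1)] that(2) lt rd ab0 that(3)] that(4) assms(2)
    by (simp add: \<alpha> x_def y_def \<beta>_def Z_def)
  have maxpos: "max (v s) (v t) > 0" if "nonarch_absval v" "(s, t) \<noteq> (0, 0)" for v :: "'k \<Rightarrow> real" and s t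
    using that nonarch_pos[OF that(1), of s] nonarch_pos[OF that(1), of t]
    by (auto simp: less_max_iff_disj)
  have "infinite G"
  proof (cases "periodic (rat_map f) \<alpha>")
    case True
    then obtain n where n: "n > 0" "(rat_map f ^^ n) \<alpha> = \<alpha>" by (auto simp: periodic_def)
    have "proj_point type_ring (x n) (y n) = proj_point type_ring a b" using iter[of n] n(2) \<alpha> by simp
    \<comment> \<open>A vanishing \<beta> satisfies the closeness condition of \<open>red\<close> at
      every place of good reduction.\<close>
    hence "\<beta> n = 0" unfolding proj_point_type_ring_eq_iff[OF ab0 Z0] \<beta>_def .
    hence "V \<in> G" if V: "V \<in> nonarch_places - Bad" for V
      using V n maxpos[OF _ Z0] maxpos[OF _ ab0] nonarch_placeD(1)[of V]
      by (auto simp: G_def Bad_def nonarchD(5) intro!: red[of _ n] mult_pos_pos)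
    hence "nonarch_places - Bad \<subseteq> G" by blast
    moreover have "infinite (nonarch_places - Bad)" using infinite_nonarch_places[OF K] finBad by simp
    ultimately show ?thesis using infinite_super by blast
  next
    case False
    show ?thesis
    proof
      assume finG: "finite G"
      have \<beta>0: "\<beta> n \<noteq> 0" if "n > 0" for n
      proof
        assume "\<beta> n = 0"
        hence "proj_point type_ring (x n) (y n) = proj_point type_ring a b"
          unfolding proj_point_type_ring_eq_iff[OF ab0 Z0] \<beta>_def .
        hence "(rat_map f ^^ n) \<alpha> = \<alpha>" using iter[of n] \<alpha> by simp
        thus False using False that unfolding periodic_def by blast
      qed
      \<comment> \<open>A place is an infinite class of absolute values; one representative for each
        exceptional place keeps W finite. Being at most 1 passes from it to the other
        members.\<close>
      define rep where "rep V = (SOME v :: 'k \<Rightarrow> real. v \<in> V)" for V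
      have rep: "rep V \<in> V" if V: "V \<in> nonarch_places" for V
      proof -
        obtain v where "nonarch_absval v" "V = absval_equiv `` {v}"
          using V by (auto simp: nonarch_places_def quotient_def)
        hence "v \<in> V" using nonarch_placeI by blast
        thus ?thesis unfolding rep_def by (rule someI[of "\<lambda>v. v \<in> V"])
      qed
      define R where "R = rep ` (Bad \<union> G)"
      have R: "finite R" "\<And>w. w \<in> R \<Longrightarrow> nonarch_absval w"
        using finBad finG nonarch_placeD(1) rep by (auto simp: R_def Bad_def G_def)
      define W where "W = R \<union> (\<lambda>\<sigma> x. cmod (\<sigma> x)) ` {\<sigma>. hom_on UNIV \<sigma>}"
      have W: "finite W" "\<And>w. w \<in> W \<Longrightarrow> absval w"
        using R finite_embeddings[OF K] nonarch_imp_absval embedding_absval by (auto simp: W_def)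
      obtain \<epsilon> where \<epsilon>: "\<epsilon> > 0" "\<And>n. \<exists>j\<ge>n. \<forall>w\<in>W. \<epsilon> * max (w (x j)) (w (y j)) \<le> w (\<beta> j)"
        using infinitely_often_far[OF W ab0 cop d] \<beta>0
        unfolding \<beta>_def x_def y_def Z_def by blast
      define J where "J = {j. j > 0 \<and> (\<forall>w\<in>W. \<epsilon> * max (w (x j)) (w (y j)) \<le> w (\<beta> j))}"
      have "infinite J"
        unfolding infinite_nat_iff_unbounded_le
      proof
        fix m
        obtain j where "j \<ge> Suc m" "\<forall>w\<in>W. \<epsilon> * max (w (x j)) (w (y j)) \<le> w (\<beta> j)" using \<epsilon>(2) by blast
        thus "\<exists>n\<ge>m. n \<in> J" by (intro exI[of _ j]) (auto simp: J_def)
      qed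
      obtain N where N: "N > 0" "\<forall>w\<in>R. w (of_nat N) \<le> \<epsilon>" using exists_small_nat[OF K R \<epsilon>(1)] by blast
      \<comment> \<open>Multiplying by N clears the factor 1 / \<epsilon> at the places of R and
        costs a factor N in the bound on the conjugates.\<close>
      define T where "T = {t::'k. algebraic_int t \<and> (\<forall>\<sigma>. hom_on UNIV \<sigma> \<longrightarrow> cmod (\<sigma> t) \<le> real N / \<epsilon>)}"
      have "finite T" unfolding T_def by (rule northcott_integral[OF K])
      have bound: "w c \<le> w (\<beta> j) / \<epsilon>" if "j \<in> J" "w \<in> W" "c = x j \<or> c = y j" for j w c
      proof -
        have "\<epsilon> * w c \<le> \<epsilon> * max (w (x j)) (w (y j))" using that \<epsilon>(1) by (intro mult_left_mono) auto
        also have "\<dots> \<le> w (\<beta> j)" using that by (simp add: J_def)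
        finally show ?thesis using \<epsilon>(1) by (simp add: field_simps)
      qed
      have inT: "of_nat N * c / \<beta> j \<in> T" if j: "j \<in> J" and c: "c = x j \<or> c = y j" for j c
      proof -
        define t where "t = of_nat N * c / \<beta> j"
        have \<beta>j: "\<beta> j \<noteq> 0" using j \<beta>0 by (simp add: J_def)
        have tc: "t * \<beta> j = of_nat N * c" using \<beta>j by (simp add: t_def)
        have eq: "w t * w (\<beta> j) = w (of_nat N) * w c" if "absval w" for w
          using tc absvalD(3)[OF that] by metis
        have \<beta>pos: "w (\<beta> j) > 0" if "absval w" for w
          using absvalD(1,2)[OF that, of "\<beta> j"] \<beta>j by simp
        have "algebraic_int t"
        proof (rule ccontr)
          assume "\<not> algebraic_int t"
          then obtain v where v: "nonarch_absval v" "v t > 1" using exists_absval_gt_1[OF K] by blast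
          define V where "V = absval_equiv `` {v}"
          have V: "V \<in> nonarch_places" "v \<in> V" unfolding V_def by (rule nonarch_placeI[OF v(1)])+
          \<comment> \<open>One member at which t is small contradicts \<open>v t > 1\<close>, since
            all members of V are equivalent. In the exceptional case the representative in W
            serves.\<close>
          have "\<exists>u\<in>V. u t \<le> 1"
          proof (cases "V \<in> Bad \<union> G")
            case True
            hence u: "rep V \<in> R" "rep V \<in> W" by (auto simp: R_def W_def)
            have nu: "absval (rep V)" using W u by blast
            have "rep V t * rep V (\<beta> j) \<le> \<epsilon> * (rep V (\<beta> j) / \<epsilon>)"
              unfolding eq[OF nu] using N u bound[OF j u(2) c] \<epsilon>(1) absvalD(1)[OF nu]
              by (intro mult_mono) auto
            also have "\<dots> = 1 * rep V (\<beta> j)" using \<epsilon>(1) by simp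
            finally have "rep V t \<le> 1" using \<beta>pos[OF nu] by (simp only: mult_le_cancel_right_pos)
            thus ?thesis using rep[OF V(1)] by blast
          next
            case F: False
            \<comment> \<open>V is neither bad nor in G, so some member has good reduction without
              periodicity; the contrapositive of \<open>red\<close> then bounds both coordinates by
              \<beta>, with no loss of \<epsilon>.\<close>
            then obtain u where u: "u \<in> V" "good_reduction u f" "\<not> periodic (reduced_map u f) (reduce_point u \<alpha>)"
              using V by (auto simp: Bad_def G_def)
            have nu: "nonarch_absval u" using nonarch_placeD(1)[OF V(1) u(1)] .
            note au = nonarch_imp_absval[OF nu]
            have "1 \<le> max (u a) (u b)" using ab nonarch_one[OF nu] by auto
            hence "max (u (x j)) (u (y j)) * 1 \<le> max (u (x j)) (u (y j)) * max (u a) (u b)"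
              using maxpos[OF nu Z0[of j]] by (intro mult_left_mono) auto
            also have "\<dots> \<le> u (\<beta> j)" using red[OF nu u(2), of j] u(3) j by (force simp: J_def not_less)
            finally have "u c \<le> u (\<beta> j)" using c by auto
            hence "u t * u (\<beta> j) \<le> 1 * u (\<beta> j)"
              unfolding eq[OF au] using nonarch_of_nat[OF nu, of N] absvalD(1)[OF au] by (intro mult_mono) auto
            hence "u t \<le> 1" using \<beta>pos[OF au] by (simp only: mult_le_cancel_right_pos)
            thus ?thesis using u(1) by blast
          qed
          then obtain u where "u \<in> V" "u t \<le> 1" by blast
          hence "v t \<le> 1" using equivalent_absval_le_1[OF V(1) _ V(2)] by blast
          thus False using v(2) by simp
        qed
        moreover have "cmod (\<sigma> t) \<le> real N / \<epsilon>" if \<sigma>: "hom_on UNIV \<sigma>" for \<sigma>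
        proof -
          let ?w = "\<lambda>x. cmod (\<sigma> x)"
          have wW: "?w \<in> W" using \<sigma> by (auto simp: W_def)
          have aw: "absval ?w" using W wW by blast
          have "?w t * ?w (\<beta> j) = real N * ?w c" using eq[OF aw] by (simp add: hom_of_nat[OF \<sigma>])
          also have "\<dots> \<le> real N * (?w (\<beta> j) / \<epsilon>)" using bound[OF j wW c] by (intro mult_left_mono) auto
          also have "\<dots> = real N / \<epsilon> * ?w (\<beta> j)" by simp
          finally show ?thesis using \<beta>pos[OF aw] by (simp only: mult_le_cancel_right_pos)
        qed
        ultimately show ?thesis by (simp add: T_def t_def)
      qed
      define \<phi> where "\<phi> j = (of_nat N * x j / \<beta> j, of_nat N * y j / \<beta> j)" for j
      have "\<phi> ` J \<subseteq> T \<times> T" using inT by (auto simp: \<phi>_def)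
      hence "finite (\<phi> ` J)" using \<open>finite T\<close> by (meson finite_SigmaI finite_subset)
      hence "\<not> inj_on \<phi> J" using \<open>infinite J\<close> finite_imageD by blast
      then obtain i j where "i \<in> J" "j \<in> J" "i \<noteq> j" "\<phi> i = \<phi> j" by (auto simp: inj_on_def)
      then obtain i j where ij: "i \<in> J" "j \<in> J" "i < j" "\<phi> i = \<phi> j" by (metis linorder_neqE_nat)
      have nz: "\<beta> i \<noteq> 0" "\<beta> j \<noteq> 0" "(of_nat N :: 'k) \<noteq> 0" using ij \<beta>0 N(1) by (auto simp: J_def)
      \<comment> \<open>Equal pairs make the coordinates of the i-th and j-th orbit points
        proportional, so their determinant vanishes and the points coincide.\<close>
      have eqs: "x i * \<beta> j = x j * \<beta> i" "y i * \<beta> j = y j * \<beta> i"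
        using ij(4) nz by (auto simp: \<phi>_def field_simps)
      have "(x i * y j - y i * x j) * \<beta> j = (x i * \<beta> j) * y j - (y i * \<beta> j) * x j"
        by (simp add: algebra_simps)
      also have "\<dots> = 0" unfolding eqs by (simp add: mult_ac)
      finally have "x i * y j - y i * x j = 0" using nz by simp
      hence "(rat_map f ^^ i) \<alpha> = (rat_map f ^^ j) \<alpha>"
        unfolding iter proj_point_type_ring_eq_iff[OF Z0 Z0] .
      hence "preperiodic (rat_map f) \<alpha>" using ij(3) by (rule funpow_eq_imp_preperiodic)
      thus False using assms(5) False by (simp add: strictly_preperiodic_def)
    qed
  qed
  thus ?thesis by (simp add: G_def)
qed

end
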